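(* Let $\mathfrak A$ be a von Neumann algebra, regarded as a unital ring. (1) $\mathfrak A$ is strongly clean if and only if there exist finitely many mutually orthogonal central projections $P_1,\dots,P_k\in\mathfrak A$ with $\sum_i P_i=I$ such that each $P_i\mathfrak A$ is a von Neumann algebra of type $\mathrm{I}_{n_i}$ with $n_i<\infty$. (2) $\mathfrak A$ is strongly $*$-clean if and only if $\mathfrak A$ is abelian.
   Context: A unital ring is strongly clean if every element can be written as $U+P$ with $U$ invertible, $P$ idempotent and $UP=PU$ (equivalently, $P$ commutes with the element). A $*$-ring is strongly $*$-clean if every element can be written as $U+P$ with $U$ invertible, $P$ a projection ($P=P^*=P^2$) and $UP=PU$. *)

theory Defs
  imports "HOL-Analysis.Analysis"
begin

class complex_inner = real_normed_vector +
  fixes cscale :: "complex \<Rightarrow> 'a \<Rightarrow> 'a"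
    and cinner :: "'a \<Rightarrow> 'a \<Rightarrow> complex"
  assumes cscale_add_right: "cscale a (x + y) = cscale a x + cscale a y"
    and cscale_add_left: "cscale (a + b) x = cscale a x + cscale b x"
    and cscale_cscale: "cscale a (cscale b x) = cscale (a * b) x"
    and cscale_one: "cscale 1 x = x"
    and cscale_of_real: "cscale (complex_of_real r) x = r *\<^sub>R x"
    and cinner_commute: "cinner x y = cnj (cinner y x)"
    and cinner_add_left: "cinner (x + y) z = cinner x z + cinner y z"
    and cinner_cscale_left: "cinner (cscale a x) y = cnj a * cinner x y"
    and cinner_ge_zero: "0 \<le> Re (cinner x x)"
    and cinner_eq_zero_iff: "cinner x x = 0 \<longleftrightarrow> x = 0"
    and norm_eq_sqrt_cinner: "norm x = sqrt (Re (cinner x x))"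

class chilbert_space = complex_inner + complete_space

instantiation complex :: chilbert_space
begin
definition cscale_complex :: "complex \<Rightarrow> complex \<Rightarrow> complex" where
  "cscale_complex a x = a * x"
definition cinner_complex :: "complex \<Rightarrow> complex \<Rightarrow> complex" where
  "cinner_complex x y = cnj x * y"
instance
proof
  fix a b x y z :: complex and r :: real
  show "cscale a (x + y) = cscale a x + cscale a y" by (simp add: cscale_complex_def algebra_simps)
  show "cscale (a + b) x = cscale a x + cscale b x" by (simp add: cscale_complex_def algebra_simps)
  show "cscale a (cscale b x) = cscale (a * b) x" by (simp add: cscale_complex_def)
  show "cscale 1 x = x" by (simp add: cscale_complex_def)
  show "cscale (complex_of_real r) x = r *\<^sub>R x" by (simp add: cscale_complex_def scaleR_conv_of_real)
  show "cinner x y = cnj (cinner y x)" by (simp add: cinner_complex_def)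
  show "cinner (x + y) z = cinner x z + cinner y z" by (simp add: cinner_complex_def algebra_simps)
  show "cinner (cscale a x) y = cnj a * cinner x y" by (simp add: cinner_complex_def cscale_complex_def)
  show "0 \<le> Re (cinner x x)" by (simp add: cinner_complex_def)
  show "cinner x x = 0 \<longleftrightarrow> x = 0" by (simp add: cinner_complex_def)
  show "norm x = sqrt (Re (cinner x x))"
    by (simp add: cinner_complex_def cmod_def power2_eq_square)
qed
end

text \<open>Bounded complex-linear operators on a complex Hilbert space, as functions.
  Ring operations: addition is pointwise, multiplication is composition, unit is id.\<close>

definition bounded_op :: "('h::chilbert_space \<Rightarrow> 'h) \<Rightarrow> bool" where
  "bounded_op T \<longleftrightarrow> (\<forall>x y. T (x + y) = T x + T y) \<and> (\<forall>c x. T (cscale c x) = cscale c (T x))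
     \<and> (\<exists>K. \<forall>x. norm (T x) \<le> K * norm x)"

definition is_adjoint :: "('h::chilbert_space \<Rightarrow> 'h) \<Rightarrow> ('h \<Rightarrow> 'h) \<Rightarrow> bool" where
  "is_adjoint T S \<longleftrightarrow> (\<forall>x y. cinner (T x) y = cinner x (S y))"

definition commutant :: "('h::chilbert_space \<Rightarrow> 'h) set \<Rightarrow> ('h \<Rightarrow> 'h) set" where
  "commutant A = {T. bounded_op T \<and> (\<forall>S\<in>A. T \<circ> S = S \<circ> T)}"

definition von_neumann_algebra :: "('h::chilbert_space \<Rightarrow> 'h) set \<Rightarrow> bool" where
  "von_neumann_algebra A \<longleftrightarrow>
     (\<forall>T\<in>A. bounded_op T) \<and> id \<in> A \<and>
     (\<forall>S\<in>A. \<forall>T\<in>A. (\<lambda>x. S x + T x) \<in> A \<and> S \<circ> T \<in> A) \<and>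
     (\<forall>c. \<forall>T\<in>A. (\<lambda>x. cscale c (T x)) \<in> A) \<and>
     (\<forall>T\<in>A. \<exists>S\<in>A. is_adjoint T S) \<and>
     commutant (commutant A) = A"

definition projection :: "('h::chilbert_space \<Rightarrow> 'h) \<Rightarrow> bool" where
  "projection P \<longleftrightarrow> P \<circ> P = P \<and> is_adjoint P P"

definition central_projection :: "('h::chilbert_space \<Rightarrow> 'h) set \<Rightarrow> ('h \<Rightarrow> 'h) \<Rightarrow> bool" where
  "central_projection A P \<longleftrightarrow> P \<in> A \<and> projection P \<and> (\<forall>T\<in>A. P \<circ> T = T \<circ> P)"

text \<open>The corner \<open>P A\<close> for a central projection \<open>P\<close> (a von Neumann algebra on \<open>P H\<close> with unit \<open>P\<close>).\<close>

definition corner :: "('h \<Rightarrow> 'h) \<Rightarrow> ('h \<Rightarrow> 'h) set \<Rightarrow> ('h \<Rightarrow> 'h) set" where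
  "corner P A = (\<lambda>T. P \<circ> T) ` A"

definition abelian_projection :: "('h::chilbert_space \<Rightarrow> 'h) set \<Rightarrow> ('h \<Rightarrow> 'h) \<Rightarrow> bool" where
  "abelian_projection B E \<longleftrightarrow> E \<in> B \<and> projection E \<and>
     (\<forall>S\<in>B. \<forall>T\<in>B. (E \<circ> S \<circ> E) \<circ> (E \<circ> T \<circ> E) = (E \<circ> T \<circ> E) \<circ> (E \<circ> S \<circ> E))"

definition mvn_equiv :: "('h::chilbert_space \<Rightarrow> 'h) set \<Rightarrow> ('h \<Rightarrow> 'h) \<Rightarrow> ('h \<Rightarrow> 'h) \<Rightarrow> bool" where
  "mvn_equiv B E F \<longleftrightarrow> (\<exists>V\<in>B. \<exists>W\<in>B. is_adjoint V W \<and> W \<circ> V = E \<and> V \<circ> W = F)"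

text \<open>A von Neumann algebra \<open>B\<close> with unit \<open>U\<close> is of type \<open>I_n\<close> (\<open>n\<close> a positive integer)
  if \<open>U\<close> is the sum of \<open>n\<close> mutually orthogonal, mutually equivalent abelian projections in \<open>B\<close>
  (Kadison--Ringrose, Def. 6.5.1 / 6.5.2).\<close>

definition type_I_n :: "('h::chilbert_space \<Rightarrow> 'h) set \<Rightarrow> ('h \<Rightarrow> 'h) \<Rightarrow> nat \<Rightarrow> bool" where
  "type_I_n B U n \<longleftrightarrow> 1 \<le> n \<and>
     (\<exists>E :: nat \<Rightarrow> ('h \<Rightarrow> 'h).
        (\<forall>i<n. abelian_projection B (E i)) \<and>
        (\<forall>i<n. \<forall>j<n. i \<noteq> j \<longrightarrow> E i \<circ> E j = (\<lambda>x. 0)) \<and>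
        (\<forall>i<n. \<forall>j<n. mvn_equiv B (E i) (E j)) \<and>
        (\<lambda>x. \<Sum>i<n. E i x) = U)"

definition invertible_in :: "('h \<Rightarrow> 'h) set \<Rightarrow> ('h \<Rightarrow> 'h) \<Rightarrow> bool" where
  "invertible_in A U \<longleftrightarrow> U \<in> A \<and> (\<exists>V\<in>A. U \<circ> V = id \<and> V \<circ> U = id)"

definition strongly_clean :: "('h::chilbert_space \<Rightarrow> 'h) set \<Rightarrow> bool" where
  "strongly_clean A \<longleftrightarrow> (\<forall>X\<in>A. \<exists>U P. invertible_in A U \<and> P \<in> A \<and> P \<circ> P = P \<and>
      X = (\<lambda>x. U x + P x) \<and> U \<circ> P = P \<circ> U)"

definition strongly_star_clean :: "('h::chilbert_space \<Rightarrow> 'h) set \<Rightarrow> bool" where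
  "strongly_star_clean A \<longleftrightarrow> (\<forall>X\<in>A. \<exists>U P. invertible_in A U \<and> P \<in> A \<and> projection P \<and>
      X = (\<lambda>x. U x + P x) \<and> U \<circ> P = P \<circ> U)"

definition abelian_algebra :: "('h \<Rightarrow> 'h) set \<Rightarrow> bool" where
  "abelian_algebra A \<longleftrightarrow> (\<forall>S\<in>A. \<forall>T\<in>A. S \<circ> T = T \<circ> S)"

end

theory Submission
  imports Defs "HOL-Computational_Algebra.Polynomial_Factorial" "HOL-Computational_Algebra.Field_as_Ring"
begin

text \<open>Let \<open>X\<close> lie in a type \<open>I\<^sub>n\<close> algebra, viewed as \<open>n \<times> n\<close> matrices over an abelian von Neumann algebra. If no
  central decomposition made \<open>X\<close> strongly clean, repeated bisection of the spectra of the entries would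
  produce nested central summands on which \<open>X\<close> is not strongly clean but tends in norm to a scalar matrix.
  A scalar matrix \<open>a\<close> is algebraic, so it has a Fitting idempotent \<open>q(a)\<close> with \<open>q\<close> a polynomial; near \<open>a\<close> the
  almost idempotent \<open>q(X)\<close> is corrected to an idempotent by a power series, which shows that every
  element near \<open>a\<close> is strongly clean.

  Conversely, if the algebra contains mutually orthogonal blocks of matrix units of unbounded size, then the
  sum of the shifts \<open>w\<^sub>0 \<mapsto> w\<^sub>1 \<mapsto> \<dots> \<mapsto> w\<^sub>k \<mapsto> w\<^sub>k\<close> is not strongly clean, because the idempotent
  belonging to the eigenvalue \<open>1\<close> would be unbounded. If there are no such blocks, every nonzero projection
  contains an abelian one, every abelian projection contains one with finitely many copies of central sum,
  and splitting off maximal summands of type \<open>I\<^sub>1, I\<^sub>2, \<dots>\<close> exhausts the identity after finitely many steps.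

  If the algebra is strongly \<open>*\<close>-clean, its idempotents are self-adjoint, so \<open>p + p x (1 - p)\<close> is, and all
  projections are central. In an abelian algebra idempotents are normal and hence projections.\<close>

section \<open>Unital Banach algebras\<close>

text \<open>A decomposition X = U + P splits the space into complementary invariant pieces: X - 1 is
  invertible on the range of P and X on the range of 1 - P. So a bounded idempotent has to separate
  the spectral points 0 and 1. For one matrix this is Fitting's lemma, but the norm of the
  idempotent depends on the matrix, and a choice made point by point over the centre need not be
  bounded. What is uniform is a norm neighbourhood of a single scalar matrix; bisection stands in
  for compactness of the spectrum of the centre. In the converse direction the same growth of norms
  is the obstruction. No spectral measures, polar decomposition or comparison theory enter. Square
  roots come from the binomial series, which converges on the closed unit ball and gives absolute
  values; the kernel of |H| + H then serves as a spectral projection of H. Whatever is built from X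
  in this way commutes with everything that commutes with X, and by the bicommutant condition it
  lies in the algebra.\<close>

text \<open>The library classes \<open>ring_1\<close> and \<open>real_algebra_1\<close> demand \<open>0 \<noteq> 1\<close>, which fails for the operators
  on a zero-dimensional space.\<close>

class unital_algebra = real_algebra + monoid_mult

class unital_banach_algebra = unital_algebra + real_normed_algebra + banach

lemma commute_inverse:
  fixes z w v :: "'a::monoid_mult"
  assumes "w * v = 1" "v * w = 1" "z * w = w * z"
  shows "z * v = v * z"
  by (metis assms mult.assoc mult.left_neutral mult.right_neutral)

lemma norm_power_Suc_le:
  fixes x :: "'a::unital_banach_algebra"
  shows "norm (x ^ Suc n) \<le> norm x ^ Suc n"
proof (induction n)
  case (Suc n)
  have "norm (x ^ Suc (Suc n)) \<le> norm x * norm (x ^ Suc n)"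
    by (simp add: norm_mult_ineq)
  also have "\<dots> \<le> norm x * norm x ^ Suc n"
    using Suc by (intro mult_left_mono) auto
  finally show ?case by simp
qed simp

text \<open>Submultiplicativity controls only the powers with positive exponent, and the axioms
  leave \<open>norm 1\<close> free; hence the factor \<open>max 1 (norm 1)\<close>.\<close>

lemma norm_scaled_power_le:
  fixes x :: "'a::unital_banach_algebra"
  assumes "norm x \<le> 1"
  shows "norm (c k *\<^sub>R x ^ k) \<le> max 1 (norm (1::'a)) * \<bar>c k\<bar>"
proof (cases k)
  case 0
  have "\<bar>c 0\<bar> * norm (1::'a) \<le> \<bar>c 0\<bar> * max 1 (norm (1::'a))"
    by (intro mult_left_mono) auto
  then show ?thesis using 0 by (simp add: mult.commute)
next
  case (Suc n)
  have "norm (x ^ k) \<le> norm x ^ k" using Suc norm_power_Suc_le by blast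
  also have "\<dots> \<le> 1" using assms by (simp add: power_le_one)
  finally have "norm (x ^ k) \<le> max 1 (norm (1::'a))" by simp
  then have "\<bar>c k\<bar> * norm (x ^ k) \<le> \<bar>c k\<bar> * max 1 (norm (1::'a))"
    by (intro mult_left_mono) auto
  then show ?thesis by (simp add: mult.commute)
qed

text \<open>The Neumann series is split into 1 and a tail, because the tail has a bound that does
  not involve \<open>norm 1\<close>.\<close>

lemma neumann_inverse:
  fixes x :: "'a::unital_banach_algebra"
  assumes "norm x < 1"
  obtains v where "(1 - x) * v = 1" "v * (1 - x) = 1" "norm (v - 1) \<le> norm x / (1 - norm x)"
proof -
  have le: "norm (x ^ Suc n) \<le> norm x * norm x ^ n" for n
    using norm_power_Suc_le[of x n] by simp
  have g: "(\<lambda>n. norm x * norm x ^ n) sums (norm x * (1 / (1 - norm x)))"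
    using assms by (intro sums_mult geometric_sums) auto
  have sn: "summable (\<lambda>n. norm (x ^ Suc n))"
    using le by (intro summable_comparison_test'[OF sums_summable[OF g], of 0]) auto
  then have "summable (\<lambda>n. x ^ Suc n)" by (rule summable_norm_cancel)
  then have s0: "summable (\<lambda>n. x ^ n)" using summable_Suc_iff[of "\<lambda>n. x ^ n"] by blast
  define v where "v = (\<Sum>n. x ^ n)"
  have v1: "v = 1 + (\<Sum>n. x ^ Suc n)"
    unfolding v_def using suminf_split_head[OF s0] by simp
  have "x * v = (\<Sum>n. x ^ Suc n)" unfolding v_def using suminf_mult[OF s0, of x] by simp
  moreover have "v * x = (\<Sum>n. x ^ Suc n)"
    unfolding v_def using suminf_mult2[OF s0, of x] by (simp add: power_commutes)
  moreover have "norm (v - 1) \<le> norm x / (1 - norm x)"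
  proof -
    have "norm (\<Sum>n. x ^ Suc n) \<le> (\<Sum>n. norm (x ^ Suc n))" using summable_norm[OF sn] .
    also have "\<dots> \<le> (\<Sum>n. norm x * norm x ^ n)"
      using le sn sums_summable[OF g] by (intro suminf_le) auto
    finally show ?thesis using sums_unique[OF g] v1 by simp
  qed
  ultimately show ?thesis using that[of v] v1 by (simp add: algebra_simps)
qed

section \<open>The binomial series of the square root of 1 - t\<close>

definition sqrt_coeff :: "nat \<Rightarrow> real" where
  "sqrt_coeff k = (-1) ^ k * ((1/2) gchoose k)"

lemma sqrt_coeff_0 [simp]: "sqrt_coeff 0 = 1"
  by (simp add: sqrt_coeff_def)

lemma sqrt_coeff_Suc: "sqrt_coeff (Suc k) = sqrt_coeff k * ((of_nat k - 1/2) / of_nat (Suc k))"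
proof -
  have "((1/2::real) gchoose Suc k) = ((1/2) gchoose k) * ((1/2 - of_nat k) / of_nat (Suc k))"
    using gbinomial_mult_1[of "1/2::real" k] by (simp add: field_simps)
  moreover have "(1/2 - real k) / of_nat (Suc k) = - ((of_nat k - 1/2) / of_nat (Suc k))"
    by (simp only: minus_divide_left) simp
  ultimately show ?thesis
    by (simp only: sqrt_coeff_def power_Suc mult_minus_right mult_minus_left minus_minus mult_1_left mult.assoc)
qed

lemma sqrt_coeff_nonpos: "sqrt_coeff (Suc k) \<le> 0"
proof (induction k)
  case 0
  show ?case by (simp add: sqrt_coeff_Suc)
next
  case (Suc k)
  then show ?case by (subst sqrt_coeff_Suc) (intro mult_nonpos_nonneg, auto)
qed

text \<open>All coefficients after the constant term 1 are nonpositive, so their absolute values add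
  up to 1 minus a partial sum of the series at t = 1. That partial sum is, up to sign, a binomial
  coefficient of -1/2, and it is nonnegative. Hence the series converges absolutely on the closed
  unit ball, boundary included.\<close>

lemma sum_abs_sqrt_coeff_le: "(\<Sum>k<n. \<bar>sqrt_coeff (Suc k)\<bar>) \<le> 1"
proof -
  have nn: "(-1) ^ m * ((- (1/2::real)) gchoose m) \<ge> 0" for m
  proof (induction m)
    case (Suc m)
    have "((- (1/2::real)) gchoose Suc m) = ((-(1/2)) gchoose m) * ((-(1/2) - of_nat m) / of_nat (Suc m))"
      using gbinomial_mult_1[of "-(1/2)::real" m] by (simp add: field_simps)
    moreover have "(-(1/2) - real m) / of_nat (Suc m) = - ((1/2 + of_nat m) / of_nat (Suc m))"
      by (simp only: minus_divide_left) simp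
    ultimately have "(-1) ^ Suc m * ((- (1/2::real)) gchoose Suc m)
        = ((-1) ^ m * ((- (1/2::real)) gchoose m)) * ((1/2 + of_nat m) / of_nat (Suc m))"
      by (simp only: power_Suc mult_minus_right mult_minus_left minus_minus mult_1_left mult.assoc)
    then show ?case using Suc by simp
  qed simp
  have "(\<Sum>k<n. \<bar>sqrt_coeff (Suc k)\<bar>) = - (\<Sum>k<n. sqrt_coeff (Suc k))"
    using sqrt_coeff_nonpos by (subst sum_negf [symmetric], intro sum.cong) auto
  also have "\<dots> = 1 - (\<Sum>k\<le>n. sqrt_coeff k)"
    by (simp only: lessThan_Suc_atMost [symmetric] sum.lessThan_Suc_shift) simp
  also have "(\<Sum>k\<le>n. sqrt_coeff k) = (-1) ^ n * ((1/2 - 1) gchoose n)"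
    unfolding sqrt_coeff_def using gbinomial_sum_lower_neg[of "1/2::real" n] by (simp add: mult.commute)
  finally show ?thesis using nn[of n] by simp
qed

lemma summable_sqrt_coeff: "summable (\<lambda>k. \<bar>sqrt_coeff (Suc k)\<bar>)"
  by (rule summableI_nonneg_bounded[where x = 1]) (use sum_abs_sqrt_coeff_le in auto)

text \<open>Vandermonde's identity with 1/2 + 1/2 = 1 turns the convolution into
  \<open>1 choose n\<close> up to sign: the series squares to 1 - t.\<close>

lemma sum_sqrt_coeff_convolution:
  "(\<Sum>i\<le>n. sqrt_coeff i * sqrt_coeff (n - i)) = (if n = 0 then 1 else if n = 1 then -1 else 0)"
proof -
  have "(\<Sum>i\<le>n. sqrt_coeff i * sqrt_coeff (n - i))
      = (-1) ^ n * (\<Sum>i\<le>n. ((1/2) gchoose i) * ((1/2) gchoose (n - i)))"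
    unfolding sum_distrib_left by (rule sum.cong) (auto simp: sqrt_coeff_def simp flip: power_add)
  also have "\<dots> = (-1) ^ n * ((1/2 + 1/2 :: real) gchoose n)"
    by (simp add: gbinomial_Vandermonde atMost_atLeast0)
  also have "((1/2 + 1/2 :: real) gchoose n) = of_nat (1 choose n)"
    by (simp add: binomial_gbinomial)
  finally show ?thesis by (cases "n = 0"; cases "n = 1") auto
qed

definition sqrt1m :: "'a::unital_banach_algebra \<Rightarrow> 'a" where
  "sqrt1m y = (\<Sum>k. sqrt_coeff k *\<^sub>R y ^ k)"

context
  fixes y :: "'a::unital_banach_algebra"
  assumes y: "norm y \<le> 1"
begin

lemma summable_norm_sqrt1m: "summable (\<lambda>k. norm (sqrt_coeff k *\<^sub>R y ^ k))"
proof -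
  have "summable (\<lambda>k. \<bar>sqrt_coeff k\<bar>)"
    using summable_sqrt_coeff summable_Suc_iff[of "\<lambda>k. \<bar>sqrt_coeff k\<bar>"] by blast
  then have "summable (\<lambda>k. max 1 (norm (1::'a)) * \<bar>sqrt_coeff k\<bar>)" by (rule summable_mult)
  then show ?thesis
    by (rule summable_comparison_test'[where N = 0])
       (use norm_scaled_power_le[OF y, of sqrt_coeff] in auto)
qed

lemma summable_sqrt1m: "summable (\<lambda>k. sqrt_coeff k *\<^sub>R y ^ k)"
  by (rule summable_norm_cancel[OF summable_norm_sqrt1m])

lemma sqrt1m_square: "sqrt1m y * sqrt1m y = 1 - y"
proof -
  have eq: "(\<Sum>i\<le>k. sqrt_coeff i *\<^sub>R y ^ i * (sqrt_coeff (k - i) *\<^sub>R y ^ (k - i)))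
      = (if k = 0 then 1 else if k = 1 then - y else 0)" (is "?f k = ?g k") for k
  proof -
    have "?f k = (\<Sum>i\<le>k. (sqrt_coeff i * sqrt_coeff (k - i)) *\<^sub>R y ^ k)"
      by (rule sum.cong) (auto simp flip: power_add)
    also have "\<dots> = (if k = 0 then 1 else if k = 1 then -1 else 0) *\<^sub>R y ^ k"
      by (simp add: sum_sqrt_coeff_convolution flip: scaleR_left.sum)
    finally show ?thesis by (cases "k = 0"; cases "k = 1") auto
  qed
  have "(\<lambda>k. \<Sum>i\<le>k. sqrt_coeff i *\<^sub>R y ^ i * (sqrt_coeff (k - i) *\<^sub>R y ^ (k - i)))
      sums (sqrt1m y * sqrt1m y)"
    using Cauchy_product_sums[OF summable_norm_sqrt1m summable_norm_sqrt1m]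
    unfolding sqrt1m_def .
  then have "(\<lambda>k. if k = 0 then 1 else if k = 1 then - y else 0) sums (sqrt1m y * sqrt1m y)"
    unfolding eq .
  moreover have "(\<lambda>k. if k = 0 then 1 else if k = 1 then - y else 0) sums
      (\<Sum>k\<in>{0,1::nat}. if k = 0 then 1 else if k = 1 then - y else 0)"
    by (rule sums_finite) auto
  ultimately have "sqrt1m y * sqrt1m y = (\<Sum>k\<in>{0,1::nat}. if k = 0 then 1 else if k = 1 then - y else 0)"
    by (rule sums_unique2)
  then show ?thesis by simp
qed

text \<open>The coefficients after the first have total mass at most 1, and every power they
  multiply is bounded by \<open>norm y\<close>. The bound serves twice: for the correction of an
  almost idempotent and for the positivity of the root.\<close>

lemma norm_one_minus_sqrt1m: "norm (1 - sqrt1m y) \<le> norm y"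
proof -
  have sn: "summable (\<lambda>k. norm (sqrt_coeff (Suc k) *\<^sub>R y ^ Suc k))"
    using summable_norm_sqrt1m summable_Suc_iff[of "\<lambda>k. norm (sqrt_coeff k *\<^sub>R y ^ k)"] by blast
  have "1 - sqrt1m y = - (\<Sum>k. sqrt_coeff (Suc k) *\<^sub>R y ^ Suc k)"
    unfolding sqrt1m_def using suminf_split_head[OF summable_sqrt1m] by simp
  then have "norm (1 - sqrt1m y) \<le> (\<Sum>k. norm (sqrt_coeff (Suc k) *\<^sub>R y ^ Suc k))"
    using summable_norm[OF sn] by simp
  also have "\<dots> \<le> (\<Sum>k. \<bar>sqrt_coeff (Suc k)\<bar> * norm y)"
  proof (intro suminf_le sn summable_mult2 summable_sqrt_coeff allI)
    fix k
    have "norm (y ^ Suc k) \<le> norm y ^ Suc k" by (rule norm_power_Suc_le)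
    also have "\<dots> \<le> norm y" using y power_le_one[of "norm y" k] by (simp add: mult_left_le)
    finally show "norm (sqrt_coeff (Suc k) *\<^sub>R y ^ Suc k) \<le> \<bar>sqrt_coeff (Suc k)\<bar> * norm y"
      by (simp add: mult_left_mono)
  qed
  also have "\<dots> = (\<Sum>k. \<bar>sqrt_coeff (Suc k)\<bar>) * norm y"
    by (simp add: suminf_mult2[OF summable_sqrt_coeff])
  also have "\<dots> \<le> 1 * norm y"
    by (intro mult_right_mono suminf_le_const summable_sqrt_coeff sum_abs_sqrt_coeff_le) auto
  finally show ?thesis by simp
qed

lemma sqrt1m_commute:
  assumes "z * y = y * z"
  shows "z * sqrt1m y = sqrt1m y * z"
proof -
  have "z * y ^ k = y ^ k * z" for k
  proof (induction k)
    case (Suc k)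
    have "z * y ^ Suc k = y * (z * y ^ k)" by (simp add: assms flip: mult.assoc)
    then show ?case by (simp add: Suc mult.assoc)
  qed simp
  then show ?thesis
    unfolding sqrt1m_def
    by (subst suminf_mult[OF summable_sqrt1m, symmetric], subst suminf_mult2[OF summable_sqrt1m]) simp
qed

end


section \<open>Real polynomials in an algebra and the neighbourhood of an algebraic element\<close>

definition peval :: "real poly \<Rightarrow> 'a::unital_algebra \<Rightarrow> 'a" where
  "peval p a = fold_coeffs (\<lambda>c r. c *\<^sub>R 1 + a * r) p 0"

lemma peval_0 [simp]: "peval 0 a = 0"
  by (simp add: peval_def)

lemma peval_pCons [simp]: "peval (pCons c p) a = c *\<^sub>R 1 + a * peval p a"
  by (cases "p = 0 \<and> c = 0") (auto simp: peval_def)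

lemma peval_1 [simp]: "peval 1 a = 1"
  by (simp add: one_pCons)

lemma peval_add [simp]: "peval (p + q) a = peval p a + peval q a"
  by (induction p q rule: poly_induct2) (auto simp: algebra_simps)

lemma peval_smult [simp]: "peval (smult c p) a = c *\<^sub>R peval p a"
  by (induction p) (auto simp: algebra_simps)

lemma peval_minus [simp]: "peval (- p) a = - peval p a"
  using peval_smult[of "-1" p a] by simp

lemma peval_diff [simp]: "peval (p - q) a = peval p a - peval q a"
  using peval_add[of p "- q" a] by simp

lemma peval_mult [simp]: "peval (p * q) a = peval p a * peval q a"
  by (induction p) (auto simp: algebra_simps)

lemma peval_commute: "z * a = a * z \<Longrightarrow> z * peval p a = peval p a * z"
proof (induction p)
  case (pCons c p)
  have "z * (a * peval p a) = a * (z * peval p a)" using pCons(3) by (simp flip: mult.assoc)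
  then show ?case using pCons by (simp add: algebra_simps)
qed simp

lemma peval_sum: "peval (sum f S) a = (\<Sum>i\<in>S. peval (f i) a)"
  by (induction S rule: infinite_finite_induct) auto

lemma peval_monom: "peval (monom c n) a = c *\<^sub>R a ^ n"
  by (induction n) (auto simp: monom_0 monom_Suc)

lemma continuous_peval:
  fixes a :: "'a::unital_banach_algebra"
  shows "isCont (\<lambda>x. peval p x) a"
  by (induction p) (auto intro!: continuous_intros)

text \<open>The span is stable under left multiplication by \<open>a\<close> and so contains its
  powers; \<open>card S + 1\<close> of them cannot be independent. Exponents start at 1 because the
  span need not contain the unit.\<close>

lemma algebraic_element:
  fixes a :: "'a::unital_algebra"
  assumes "finite S" "a \<in> span S" "\<And>s. s \<in> S \<Longrightarrow> a * s \<in> span S"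
  obtains p where "p \<noteq> 0" "peval p a = 0"
proof -
  have "linear ((*) a)" by (rule linearI) (auto simp: algebra_simps)
  then have "(*) a ` span S = span ((*) a ` S)" by (metis linear_span_image)
  also have "\<dots> \<subseteq> span S" using assms(3) by (intro span_minimal) auto
  finally have mul: "a * s \<in> span S" if "s \<in> span S" for s
    using that by auto
  have pw: "a ^ Suc k \<in> span S" for k
    by (induction k) (use assms(2) mul in auto)
  show ?thesis
  proof (cases "inj_on (\<lambda>k. a ^ Suc k) {..card S}")
    \<comment> \<open>With repetitions the set of powers is too small for the dimension count, but
      then a difference of two monomials already annihilates \<open>a\<close>.\<close>
    case False
    then obtain i j where "i \<noteq> j" "a ^ Suc i = a ^ Suc j" unfolding inj_on_def by blast
    then show ?thesis
      by (intro that[of "monom 1 (Suc i) - monom 1 (Suc j)"]) (auto simp: peval_monom monom_eq_iff')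
  next
    case inj: True
    define B where "B = (\<lambda>k. a ^ Suc k) ` {..card S}"
    have "card B = Suc (card S)" using inj by (simp add: B_def card_image)
    moreover have "B \<subseteq> span S" using pw by (auto simp: B_def)
    ultimately have "dependent B" using independent_span_bound[OF assms(1), of B] by auto
    moreover have "finite B" by (simp add: B_def)
    ultimately obtain u where u: "\<exists>v\<in>B. u v \<noteq> 0" "(\<Sum>v\<in>B. u v *\<^sub>R v) = 0"
      by (auto simp: dependent_finite)
    define p where "p = (\<Sum>k\<le>card S. monom (u (a ^ Suc k)) (Suc k))"
    have "peval p a = (\<Sum>k\<le>card S. u (a ^ Suc k) *\<^sub>R a ^ Suc k)"
      by (simp add: p_def peval_sum peval_monom)
    also have "\<dots> = (\<Sum>v\<in>B. u v *\<^sub>R v)"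
      unfolding B_def using inj by (subst sum.reindex) auto
    finally have "peval p a = 0" using u(2) by simp
    moreover obtain k where k: "k \<le> card S" "u (a ^ Suc k) \<noteq> 0" using u(1) by (auto simp: B_def)
    have "coeff p (Suc k) = (\<Sum>j\<le>card S. if j = k then u (a ^ Suc j) else 0)"
      unfolding p_def coeff_sum by (rule sum.cong) auto
    then have "p \<noteq> 0" using k by auto
    ultimately show ?thesis using that by blast
  qed
qed

text \<open>Write p = X^m f with f(0) nonzero. The Chinese remainder theorem gives a q that is 1
  modulo X^(m+1) and 0 modulo f; at an element annihilated by \<open>p\<close> it becomes the
  idempotent of the generalised eigenvalue 0. Moreover X - q is a unit modulo p: modulo f it is X,
  and at 0 it takes the value -1.\<close>

lemma idempotent_polynomial:
  fixes p :: "real poly"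
  assumes "p \<noteq> 0"
  obtains q u v where "p dvd q * q - q" "([:0, 1:] - q) * u + p * v = 1"
proof -
  define X :: "real poly" where "X = [:0, 1:]"
  define f where "f = p div X ^ order 0 p"
  have pf: "p = X ^ order 0 p * f" using order_1[of 0 p] by (simp add: f_def X_def)
  have f0: "\<not> X dvd f"
  proof
    assume "X dvd f"
    then have "X ^ order 0 p * X dvd X ^ order 0 p * f" by (rule mult_dvd_mono[OF dvd_refl])
    then show False using order_2[OF assms, of 0] pf by (simp add: X_def mult.commute)
  qed
  have irr: "prime_elem X"
    unfolding X_def by (intro irreducible_imp_prime_elem_gcd irreducible_linear_field_poly) auto
  have cop: "coprime X f" by (rule prime_elem_imp_coprime[OF irr f0])
  \<comment> \<open>The exponent exceeds the multiplicity of 0 by one, so that \<open>q\<close> has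
    the value 1 at 0 even if \<open>p\<close> has no root there.\<close>
  then have "coprime (X ^ Suc (order 0 p)) f" by simp
  then obtain a b where ab: "a * X ^ Suc (order 0 p) + b * f = 1"
    by (metis bezout_coefficients_fst_snd coprime_imp_gcd_eq_1)
  define q where "q = b * f"
  have "q * q - q = - (b * f) * (1 - b * f)"
    by (simp add: q_def algebra_simps)
  also have "1 - b * f = a * X ^ Suc (order 0 p)" using ab by (simp only: diff_eq_eq)
  also have "- (b * f) * (a * X ^ Suc (order 0 p)) = X ^ order 0 p * f * (- a * X * b)"
    by (simp add: mult_ac)
  finally have "p dvd q * q - q" using pf by (metis dvd_triv_left)
  moreover have "coprime (X - q) p"
  proof -
    have "coprime (X - q) f"
    proof (rule coprimeI)
      fix c assume c: "c dvd X - q" "c dvd f"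
      then have "c dvd (X - q) + b * f" by (intro dvd_add) auto
      then have "c dvd X" by (simp add: q_def)
      then show "is_unit c" using c(2) cop by (meson coprime_common_divisor)
    qed
    moreover have "coprime X (X - q)"
    proof (rule prime_elem_imp_coprime[OF irr])
      have "poly q 0 = 1" using arg_cong[OF ab, of "\<lambda>p. poly p 0"] by (simp add: q_def X_def)
      then show "\<not> X dvd X - q"
        using poly_eq_0_iff_dvd[of "X - q" 0] by (simp add: X_def)
    qed
    ultimately show ?thesis by (subst pf) (simp add: coprime_commute)
  qed
  then obtain u v where "u * (X - q) + v * p = 1"
    by (metis bezout_coefficients_fst_snd coprime_imp_gcd_eq_1)
  ultimately show ?thesis using that[of q u v] by (simp add: mult.commute X_def)
qed


text \<open>For \<open>x\<close> near \<open>a\<close> the element Q = q(x) is only almost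
  idempotent, but (2Q - 1)^2 = 1 - y with y small. Dividing 2Q - 1 by the square root of 1 - y gives
  an exact involution and thus an idempotent \<open>P\<close> close to Q. The Bezout identity for X
  - q then inverts \<open>x - P\<close> up to a small error. The clause on commuting elements is
  what later places \<open>P\<close> and \<open>V\<close> in a von Neumann algebra.\<close>

lemma algebraic_element_strongly_clean_nhd:
  fixes a :: "'a::unital_banach_algebra"
  assumes "p \<noteq> 0" "peval p a = 0"
  obtains e where "e > 0"
    "\<And>x. norm (x - a) < e \<Longrightarrow> \<exists>P V. P * P = P \<and> (x - P) * V = 1 \<and> V * (x - P) = 1 \<and>
        (\<forall>z. z * x = x * z \<longrightarrow> z * P = P * z \<and> z * V = V * z)"
proof -
  obtain q u v where q: "p dvd q * q - q" and uv: "([:0, 1:] - q) * u + p * v = 1"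
    using idempotent_polynomial[OF assms(1)] by blast
  define y where "y x = peval (smult 4 (q - q * q)) x" for x :: 'a
  \<comment> \<open>\<open>g x\<close> bounds the distance of \<open>(x - P) * U\<close> from 1; its
    second summand dominates the contribution of \<open>P - Q\<close>.\<close>
  define g where "g x = norm (peval (p * v) x) + norm (peval (smult 2 q - 1) x) * norm (peval u x) * norm (y x)" for x :: 'a
  obtain r where r: "q * q - q = p * r" using q by (auto simp: dvd_def)
  have "y a = - (4 *\<^sub>R peval (q * q - q) a)"
    unfolding y_def by (simp add: algebra_simps)
  also have "\<dots> = 0" by (simp only: r) (simp add: assms)
  finally have ya: "y a = 0" .
  then have ga: "g a = 0" by (simp add: g_def assms(2))
  have cy: "isCont (\<lambda>x. norm (y x)) a" and cg: "isCont g a"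
    unfolding g_def y_def by (intro continuous_intros continuous_peval)+
  have "eventually (\<lambda>x. norm (y x) < 1/2) (nhds a)"
    using order_tendstoD(2)[OF cy[unfolded isCont_def], of "1/2"] ya by (simp add: eventually_nhds_conv_at)
  moreover have "eventually (\<lambda>x. g x < 1) (nhds a)"
    using order_tendstoD(2)[OF cg[unfolded isCont_def], of "1"] ga by (simp add: eventually_nhds_conv_at)
  ultimately have "eventually (\<lambda>x. norm (y x) < 1/2 \<and> g x < 1) (nhds a)"
    by eventually_elim auto
  then obtain e where e: "e > 0" "\<And>x. dist x a < e \<Longrightarrow> norm (y x) < 1/2 \<and> g x < 1"
    unfolding eventually_nhds_metric by blast
  show ?thesis
  proof (rule that[OF e(1)])
    fix x assume "norm (x - a) < e"
    then have y2: "norm (y x) < 1/2" and g1: "g x < 1" using e(2) by (auto simp: dist_norm)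
    then have y1: "norm (y x) \<le> 1" by simp
    define Q where "Q = peval q x"
    define s where "s = sqrt1m (y x)"
    define U where "U = peval u x"
    have ss: "s * s = 1 - y x" unfolding s_def by (rule sqrt1m_square[OF y1])
    have ns: "norm (1 - s) \<le> norm (y x)" unfolding s_def by (rule norm_one_minus_sqrt1m[OF y1])
    then have ns1: "norm (1 - s) < 1" using y2 by linarith
    obtain t where t: "s * t = 1" "t * s = 1" "norm (t - 1) \<le> norm (1 - s) / (1 - norm (1 - s))"
      using neumann_inverse[OF ns1] by auto
    have "norm (1 - s) / (1 - norm (1 - s)) \<le> 2 * norm (y x)"
    proof -
      have "norm (1 - s) / (1 - norm (1 - s)) \<le> norm (y x) / (1/2)"
        using ns y2 by (intro frac_le) auto
      then show ?thesis by simp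
    qed
    then have nt: "norm (t - 1) \<le> 2 * norm (y x)" using t(3) by linarith
    define P where "P = (1/2) *\<^sub>R (1 + (2 *\<^sub>R Q - 1) * t)"
    have comm: "z * Q = Q * z \<and> z * U = U * z \<and> z * s = s * z \<and> z * t = t * z \<and> z * P = P * z" if "z * x = x * z" for z
    proof -
      have zy: "z * y x = y x * z" unfolding y_def by (rule peval_commute[OF that])
      have zQ: "z * Q = Q * z" "z * U = U * z" unfolding Q_def U_def by (rule peval_commute[OF that])+
      have zs: "z * s = s * z" unfolding s_def by (rule sqrt1m_commute[OF y1 zy])
      have zt: "z * t = t * z" by (rule commute_inverse[OF t(1,2) zs])
      have "z * (Q * t) = Q * t * z" by (metis mult.assoc zQ(1) zt)
      then have "z * P = P * z" unfolding P_def using zt zQ by (simp add: algebra_simps)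
      then show ?thesis using zQ zs zt by simp
    qed
    have Qx: "Q * x = x * Q" unfolding Q_def by (rule peval_commute[symmetric]) simp
    have Qt: "Q * t = t * Q" using comm[OF Qx] by simp
    have "(2 *\<^sub>R Q - 1) * (2 *\<^sub>R Q - 1) = s * s"
      unfolding ss y_def by (simp add: Q_def algebra_simps flip: scaleR_2)
    moreover have "(2 *\<^sub>R Q - 1) * t = t * (2 *\<^sub>R Q - 1)" using Qt by (simp add: algebra_simps)
    ultimately have "((2 *\<^sub>R Q - 1) * t) * ((2 *\<^sub>R Q - 1) * t) = 1"
      by (metis mult.assoc t(1,2) mult.right_neutral)
    then have "(1 + (2 *\<^sub>R Q - 1) * t) * (1 + (2 *\<^sub>R Q - 1) * t) = 2 *\<^sub>R (1 + (2 *\<^sub>R Q - 1) * t)"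
      by (simp only: distrib_left distrib_right scaleR_2 mult_1_left mult_1_right) (simp add: add_ac)
    then have PP: "P * P = P" unfolding P_def by simp
    have "P - Q = (1/2) *\<^sub>R ((2 *\<^sub>R Q - 1) * (t - 1))"
      unfolding P_def by (simp add: algebra_simps)
    then have "norm (P - Q) \<le> 1/2 * (norm (2 *\<^sub>R Q - 1) * norm (t - 1))"
      using norm_mult_ineq[of "2 *\<^sub>R Q - 1" "t - 1"] by simp
    also have "\<dots> \<le> 1/2 * (norm (2 *\<^sub>R Q - 1) * (2 * norm (y x)))"
      using nt by (intro mult_left_mono) auto
    finally have "norm (P - Q) \<le> norm (2 *\<^sub>R Q - 1) * norm (y x)" by simp
    then have "norm (P - Q) * norm U \<le> norm (2 *\<^sub>R Q - 1) * norm (y x) * norm U"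
      by (rule mult_right_mono) simp
    with norm_mult_ineq[of "P - Q" U]
    have "norm ((P - Q) * U) \<le> norm (2 *\<^sub>R Q - 1) * norm (y x) * norm U" by (rule order_trans)
    then have n1: "norm ((P - Q) * U) \<le> norm (2 *\<^sub>R Q - 1) * norm U * norm (y x)" by (simp add: mult_ac)
    define w where "w = peval (p * v) x + (P - Q) * U"
    have "norm w \<le> g x"
      unfolding w_def g_def using n1 norm_triangle_ineq[of "peval (p * v) x" "(P - Q) * U"]
      by (simp add: Q_def U_def)
    then have "norm w < 1" using g1 by simp
    then obtain v' where v': "(1 - w) * v' = 1" "v' * (1 - w) = 1" using neumann_inverse by blast
    have "(x - Q) * U + peval (p * v) x = 1"
      using arg_cong[OF uv, of "\<lambda>p. peval p x"] by (simp add: Q_def U_def)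
    then have w1: "1 - w = (x - P) * U" unfolding w_def by (simp add: algebra_simps)
    have commv: "z * v' = v' * z" if "z * x = x * z" for z
    proof -
      have "z * ((x - P) * U) = (x - P) * U * z"
      proof -
        have "z * (x - P) = (x - P) * z" using that comm[OF that] by (simp add: algebra_simps)
        then show ?thesis using comm[OF that] by (metis mult.assoc)
      qed
      then show ?thesis using commute_inverse[OF v'] w1 by metis
    qed
    have "P * x = x * P" using comm[of x] by simp
    then have cm: "(x - P) * x = x * (x - P)" by (simp add: algebra_simps)
    show "\<exists>P V. P * P = P \<and> (x - P) * V = 1 \<and> V * (x - P) = 1 \<and>
        (\<forall>z. z * x = x * z \<longrightarrow> z * P = P * z \<and> z * V = V * z)"
    proof (intro exI conjI allI impI)
      show "P * P = P" by (rule PP)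
      show *: "(x - P) * (U * v') = 1" using v'(1) w1 by (simp add: mult.assoc)
      show "(U * v') * (x - P) = 1"
        using * commv[OF cm] comm[OF cm] by (metis mult.assoc)
      fix z assume z: "z * x = x * z"
      show "z * P = P * z" using comm[OF z] by simp
      show "z * (U * v') = U * v' * z" using comm[OF z] commv[OF z] by (metis mult.assoc)
    qed
  qed
qed

section \<open>Operators on a Hilbert space\<close>

instance chilbert_space \<subseteq> banach ..

text \<open>Only the real part of the inner product is used: operators are complex linear, so adjoints with
  respect to the real part are adjoints.\<close>

definition rip :: "'h::chilbert_space \<Rightarrow> 'h \<Rightarrow> real" where
  "rip x y = Re (cinner x y)"

abbreviation icscale :: "'h::chilbert_space \<Rightarrow> 'h" where
  "icscale \<equiv> cscale \<i>"

lemma rip_commute: "rip x y = rip y x"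
  unfolding rip_def by (subst cinner_commute) simp

lemma rip_add_left: "rip (x + y) z = rip x z + rip y z"
  by (simp add: rip_def cinner_add_left)

lemma rip_add_right: "rip z (x + y) = rip z x + rip z y"
  by (metis rip_add_left rip_commute)

lemma rip_scaleR_left: "rip (r *\<^sub>R x) y = r * rip x y"
  by (simp add: rip_def cinner_cscale_left flip: cscale_of_real)

lemma rip_scaleR_right: "rip x (r *\<^sub>R y) = r * rip x y"
  by (metis rip_scaleR_left rip_commute)

lemma rip_minus_left [simp]: "rip (- x) y = - rip x y"
  using rip_scaleR_left[of "-1"] by simp

lemma rip_minus_right [simp]: "rip x (- y) = - rip x y"
  using rip_scaleR_right[of x "-1"] by simp

lemma rip_diff_left: "rip (x - y) z = rip x z - rip y z"
  using rip_add_left[of x "- y"] by simp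

lemma rip_diff_right: "rip z (x - y) = rip z x - rip z y"
  using rip_add_right[of z x "- y"] by simp

lemma rip_0_left [simp]: "rip 0 x = 0"
  using rip_scaleR_left[of 0 0 x] by simp

lemma rip_0_right [simp]: "rip x 0 = 0"
  by (metis rip_0_left rip_commute)

lemmas rip_simps = rip_add_left rip_add_right rip_diff_left rip_diff_right rip_scaleR_left rip_scaleR_right

lemma rip_self: "rip x x = (norm x)\<^sup>2"
  by (simp add: rip_def norm_eq_sqrt_cinner cinner_ge_zero)

lemma norm_add_sq: "(norm (x + y))\<^sup>2 = (norm x)\<^sup>2 + 2 * rip x y + (norm y)\<^sup>2"
  using rip_commute[of x y] by (simp add: rip_simps flip: rip_self)

lemma norm_diff_sq: "(norm (x - y))\<^sup>2 = (norm x)\<^sup>2 - 2 * rip x y + (norm y)\<^sup>2"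
  using rip_commute[of x y] by (simp add: rip_simps flip: rip_self)

lemma rip_le_norm: "rip x y \<le> norm x * norm y"
proof (cases "x = 0 \<or> y = 0")
  case False
  have "0 \<le> (norm (norm y *\<^sub>R x - norm x *\<^sub>R y))\<^sup>2" by simp
  also have "\<dots> = 2 * (norm x * norm y) * (norm x * norm y - rip x y)"
    unfolding norm_diff_sq by (simp add: rip_simps power2_eq_square algebra_simps)
  finally have "0 \<le> (norm x * norm y) * (norm x * norm y - rip x y)" by simp
  then show ?thesis using False by (simp add: zero_le_mult_iff mult_le_0_iff)
qed auto

lemma abs_rip_le_norm: "\<bar>rip x y\<bar> \<le> norm x * norm y"
  using rip_le_norm[of x y] rip_le_norm[of "- x" y] by auto

lemma bounded_bilinear_rip: "bounded_bilinear (rip :: 'h::chilbert_space \<Rightarrow> 'h \<Rightarrow> real)"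
  by (rule bounded_bilinear.intro) (auto simp: rip_simps intro!: exI[of _ 1] abs_rip_le_norm)

lemma rip_eq_0I: "(\<And>y. rip x y = 0) \<Longrightarrow> x = 0"
  using rip_self[of x] by simp

lemma rip_eqI: "(\<And>y. rip x y = rip x' y) \<Longrightarrow> x = x'"
  using rip_eq_0I[of "x - x'"] by (simp add: rip_simps)

lemma icscale_icscale [simp]: "icscale (icscale x) = - x"
  using cscale_of_real[of "-1" x] by (simp add: cscale_cscale)

lemma cscale_decompose: "cscale c x = Re c *\<^sub>R x + Im c *\<^sub>R icscale x"
proof -
  have "cscale c x = cscale (complex_of_real (Re c) + complex_of_real (Im c) * \<i>) x"
    by (subst complex_eq[of c]) (simp only: mult.commute)
  then show ?thesis by (simp add: cscale_add_left cscale_of_real flip: cscale_cscale)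
qed

lemma rip_icscale_left: "rip (icscale x) y = - rip x (icscale y)"
proof -
  have "cinner x (icscale y) = \<i> * cinner x y"
    by (metis cinner_commute cinner_cscale_left complex_cnj_cnj complex_cnj_mult)
  then show ?thesis by (simp add: rip_def cinner_cscale_left)
qed

lemma cinner_eq_rip: "cinner x y = complex_of_real (rip x y) + \<i> * complex_of_real (rip (icscale x) y)"
  by (rule complex_eqI) (simp_all add: rip_def cinner_cscale_left)

section \<open>Orthogonal decomposition and Riesz representation\<close>

lemma parallelogram: "(norm (x + y))\<^sup>2 + (norm (x - y))\<^sup>2 = 2 * (norm x)\<^sup>2 + 2 * (norm (y::'h::chilbert_space))\<^sup>2"
  by (simp add: norm_add_sq norm_diff_sq)

text \<open>A sequence in \<open>M\<close> minimising the distance to \<open>x\<close> is Cauchy by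
  the parallelogram law, since midpoints stay in \<open>M\<close>; its limit is the foot of the
  perpendicular.\<close>

lemma orthogonal_decomposition:
  fixes M :: "'h::chilbert_space set"
  assumes M: "subspace M" "closed M"
  obtains m where "m \<in> M" "\<And>y. y \<in> M \<Longrightarrow> rip (x - m) y = 0"
proof -
  define d where "d = (INF m\<in>M. (norm (x - m))\<^sup>2)"
  have M0: "0 \<in> M" using M(1) by (rule subspace_0)
  have bdd: "bdd_below ((\<lambda>m. (norm (x - m))\<^sup>2) ` M)" by (rule bdd_belowI[of _ 0]) auto
  have dle: "d \<le> (norm (x - m))\<^sup>2" if "m \<in> M" for m
    unfolding d_def by (rule cINF_lower[OF bdd that])
  have "\<exists>m\<in>M. (norm (x - m))\<^sup>2 < d + e" if "e > 0" for e
    using cINF_less_iff[OF _ bdd, of "d + e"] that M0 unfolding d_def[symmetric] by auto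
  then have "\<exists>m\<in>M. (norm (x - m))\<^sup>2 < d + 1 / Suc n" for n by simp
  then obtain m where m: "\<And>n. m n \<in> M" "\<And>n. (norm (x - m n))\<^sup>2 < d + 1 / Suc n" by metis
  have near: "(norm (m i - m j))\<^sup>2 \<le> 2 / Suc i + 2 / Suc j" for i j
  proof -
    have mid: "(1/2) *\<^sub>R (m i + m j) \<in> M" using M(1) m(1) by (intro subspace_scale subspace_add)
    have "(norm ((x - m i) + (x - m j)))\<^sup>2 + (norm ((x - m i) - (x - m j)))\<^sup>2
        = 2 * (norm (x - m i))\<^sup>2 + 2 * (norm (x - m j))\<^sup>2" by (rule parallelogram)
    moreover have "(x - m i) + (x - m j) = 2 *\<^sub>R (x - (1/2) *\<^sub>R (m i + m j))" by (simp add: algebra_simps scaleR_2)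
    then have "(norm ((x - m i) + (x - m j)))\<^sup>2 = 4 * (norm (x - (1/2) *\<^sub>R (m i + m j)))\<^sup>2"
      by (simp only: norm_scaleR) (simp add: power_mult_distrib)
    moreover have "norm ((x - m i) - (x - m j)) = norm (m i - m j)" by (simp add: norm_minus_commute)
    ultimately show ?thesis using dle[OF mid] m(2)[of i] m(2)[of j] by simp
  qed
  have "Cauchy m"
  proof (rule metric_CauchyI)
    fix e :: real assume "e > 0"
    then obtain N where N: "4 / e\<^sup>2 < real N" using reals_Archimedean2 by blast
    have Np: "real N > 0" using N \<open>e > 0\<close> by (smt (verit) divide_pos_pos zero_less_power)
    have "dist (m i) (m j) < e" if ij: "i \<ge> N" "j \<ge> N" for i j
    proof -
      have "(norm (m i - m j))\<^sup>2 \<le> 2 / Suc i + 2 / Suc j" by (rule near)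
      also have "\<dots> \<le> 2 / N + 2 / N" using ij Np by (intro add_mono divide_left_mono) auto
      also have "\<dots> < e\<^sup>2" using N Np \<open>e > 0\<close> by (simp add: field_simps)
      finally show ?thesis using \<open>e > 0\<close> by (simp add: dist_norm power_less_imp_less_base)
    qed
    then show "\<exists>N. \<forall>i\<ge>N. \<forall>j\<ge>N. dist (m i) (m j) < e" by blast
  qed
  then obtain l where l: "m \<longlonglongrightarrow> l" using Cauchy_convergent convergent_def by blast
  have lM: "l \<in> M" by (rule closed_sequentially[OF M(2) m(1) l])
  have "(\<lambda>n. (norm (x - m n))\<^sup>2) \<longlonglongrightarrow> (norm (x - l))\<^sup>2" by (intro tendsto_intros l)
  moreover have "(\<lambda>n. d + 1 / Suc n) \<longlonglongrightarrow> d + 0" by (intro tendsto_intros LIMSEQ_Suc[OF lim_1_over_n])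
  ultimately have ld: "(norm (x - l))\<^sup>2 \<le> d"
    using m(2) by (intro LIMSEQ_le[of "\<lambda>n. (norm (x - m n))\<^sup>2" _ "\<lambda>n. d + 1 / Suc n"]) (auto intro: less_imp_le)
  have "rip (x - l) y = 0" if y: "y \<in> M" for y
  proof (cases "y = 0")
    case False
    \<comment> \<open>This \<open>c\<close> minimises the norm of
      \<open>(x - l) - c *\<^sub>R y\<close>; as \<open>l\<close> is already optimal, it has to
      vanish.\<close>
    define c where "c = rip (x - l) y / (norm y)\<^sup>2"
    have "l + c *\<^sub>R y \<in> M" using M(1) lM y by (intro subspace_add subspace_scale)
    then have "(norm (x - l))\<^sup>2 \<le> (norm ((x - l) - c *\<^sub>R y))\<^sup>2" using dle ld
      by (metis diff_diff_eq order_trans)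
    also have "\<dots> = (norm (x - l))\<^sup>2 - 2 * c * rip (x - l) y + c\<^sup>2 * (norm y)\<^sup>2"
      unfolding norm_diff_sq by (simp add: rip_simps power_mult_distrib)
    finally have "2 * c * rip (x - l) y \<le> c\<^sup>2 * (norm y)\<^sup>2" by simp
    moreover have "c\<^sup>2 * (norm y)\<^sup>2 = c * rip (x - l) y" using False by (simp add: c_def power2_eq_square)
    ultimately have "c * rip (x - l) y \<le> 0" by simp
    then have "(rip (x - l) y)\<^sup>2 \<le> 0" using False by (simp add: c_def divide_le_0_iff power2_eq_square mult_le_0_iff)
    then show ?thesis by simp
  qed simp
  then show ?thesis using that lM by blast
qed

text \<open>A vector \<open>n\<close> orthogonal to the kernel represents \<open>f\<close> after
  rescaling: every vector differs from a multiple of \<open>n\<close> by an element of the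
  kernel.\<close>

lemma riesz:
  fixes f :: "'h::chilbert_space \<Rightarrow> real"
  assumes "bounded_linear f"
  obtains z where "\<And>x. f x = rip x z"
proof (cases "\<forall>x. f x = 0")
  case True
  then show ?thesis using that[of 0] by simp
next
  case False
  interpret f: bounded_linear f by fact
  obtain x where x: "f x \<noteq> 0" using False by blast
  have "subspace {x. f x = 0}" by (rule subspaceI) (auto simp: f.add f.scaleR f.zero)
  moreover have "closed {x. f x = 0}"
    by (intro closed_Collect_eq continuous_intros f.continuous_on)
  ultimately obtain m where m: "f m = 0" "\<And>y. f y = 0 \<Longrightarrow> rip (x - m) y = 0"
    using orthogonal_decomposition[of "{x. f x = 0}" x] by auto
  define n where "n = x - m"
  have fn: "f n \<noteq> 0" using x m(1) by (simp add: n_def f.diff)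
  have "f y = rip y ((f n / (norm n)\<^sup>2) *\<^sub>R n)" for y
  proof -
    have "f (y - (f y / f n) *\<^sub>R n) = 0" using fn by (simp add: f.diff f.scaleR)
    then have "rip n (y - (f y / f n) *\<^sub>R n) = 0" using m(2) n_def by blast
    then have "rip n y = f y / f n * (norm n)\<^sup>2" by (simp add: rip_simps rip_self)
    moreover have "n \<noteq> 0" using fn f.zero by auto
    ultimately show ?thesis using fn by (simp add: rip_simps rip_commute field_simps)
  qed
  then show ?thesis by (rule that)
qed

text \<open>Complex linearity is real linearity plus commutation with multiplication by i. The
  operators thus form a closed real subalgebra of the bounded real-linear maps and inherit norm and
  completeness.\<close>

typedef (overloaded) 'h op = "{T :: 'h::chilbert_space \<Rightarrow>\<^sub>L 'h. \<forall>x. T (icscale x) = icscale (T x)}"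
  by (rule exI[of _ "id_blinfun"]) simp

setup_lifting type_definition_op

lemma norm_icscale [simp]: "norm (icscale x) = norm (x::'h::chilbert_space)"
proof -
  have "(norm (icscale x))\<^sup>2 = (norm x)\<^sup>2" by (simp add: rip_icscale_left flip: rip_self)
  then show ?thesis by simp
qed

lemma bounded_linear_icscale: "bounded_linear (icscale :: 'h::chilbert_space \<Rightarrow> 'h)"
proof (rule bounded_linear_intro)
  show "icscale (x + y) = icscale x + icscale y" for x y :: 'h by (rule cscale_add_right)
  show "icscale (r *\<^sub>R x) = r *\<^sub>R icscale x" for r and x :: 'h
    by (simp add: cscale_cscale mult.commute flip: cscale_of_real)
  show "norm (icscale x) \<le> norm x * 1" for x :: 'h by simp
qed

lemmas icscale_simps = bounded_linear_icscale[THEN bounded_linear.linear, THEN linear_add]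
  bounded_linear_icscale[THEN bounded_linear.linear, THEN linear_diff]
  bounded_linear_icscale[THEN bounded_linear.linear, THEN linear_neg]
  bounded_linear_icscale[THEN bounded_linear.linear, THEN linear_0]
  bounded_linear_icscale[THEN bounded_linear.linear, THEN linear_scale]

lift_definition ap :: "'h::chilbert_space op \<Rightarrow> 'h \<Rightarrow> 'h" is blinfun_apply .

instantiation op :: (chilbert_space) real_normed_vector
begin

lift_definition zero_op :: "'a op" is 0 by (simp add: icscale_simps)
lift_definition plus_op :: "'a op \<Rightarrow> 'a op \<Rightarrow> 'a op" is "(+)" by (simp add: icscale_simps blinfun.bilinear_simps)
lift_definition minus_op :: "'a op \<Rightarrow> 'a op \<Rightarrow> 'a op" is "(-)" by (simp add: icscale_simps blinfun.bilinear_simps)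
lift_definition uminus_op :: "'a op \<Rightarrow> 'a op" is uminus by (simp add: icscale_simps blinfun.bilinear_simps)
lift_definition scaleR_op :: "real \<Rightarrow> 'a op \<Rightarrow> 'a op" is "(*\<^sub>R)" by (simp add: icscale_simps blinfun.bilinear_simps)
lift_definition norm_op :: "'a op \<Rightarrow> real" is norm .
lift_definition dist_op :: "'a op \<Rightarrow> 'a op \<Rightarrow> real" is dist .
lift_definition sgn_op :: "'a op \<Rightarrow> 'a op" is sgn by (simp add: icscale_simps blinfun.bilinear_simps sgn_div_norm)
definition uniformity_op :: "('a op \<times> 'a op) filter" where
  "uniformity_op = (INF e\<in>{0<..}. principal {(x, y). dist x y < e})"
definition open_op :: "'a op set \<Rightarrow> bool" where
  "open_op U = (\<forall>x\<in>U. \<forall>\<^sub>F (x', y) in uniformity. x' = x \<longrightarrow> y \<in> U)"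

instance
proof
  fix a b c :: "'a op" and r s :: real
  show "a + b + c = a + (b + c)" by transfer simp
  show "a + b = b + a" by transfer simp
  show "0 + a = a" by transfer simp
  show "- a + a = 0" by transfer simp
  show "a - b = a + - b" by transfer simp
  show "r *\<^sub>R (a + b) = r *\<^sub>R a + r *\<^sub>R b" by transfer (simp add: scaleR_add_right)
  show "(r + s) *\<^sub>R a = r *\<^sub>R a + s *\<^sub>R a" by transfer (simp add: scaleR_add_left)
  show "r *\<^sub>R s *\<^sub>R a = (r * s) *\<^sub>R a" by transfer simp
  show "1 *\<^sub>R a = a" by transfer simp
  show "dist a b = norm (a - b)" by transfer (rule dist_norm)
  show "sgn a = inverse (norm a) *\<^sub>R a" by transfer (simp add: sgn_div_norm divide_inverse)
  show "(norm a = 0) = (a = 0)" by transfer simp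
  show "norm (a + b) \<le> norm a + norm b" by transfer (rule norm_triangle_ineq)
  show "norm (r *\<^sub>R a) = \<bar>r\<bar> * norm a" by transfer simp
qed (fact uniformity_op_def open_op_def)+

end

instantiation op :: (chilbert_space) unital_banach_algebra
begin

lift_definition one_op :: "'a op" is id_blinfun by simp
lift_definition times_op :: "'a op \<Rightarrow> 'a op \<Rightarrow> 'a op" is "(o\<^sub>L)" by simp

instance
proof
  fix a b c :: "'a op" and r s :: real
  show "a * b * c = a * (b * c)" by transfer (rule blinfun_eqI, simp)
  show "(a + b) * c = a * c + b * c" by transfer (rule blinfun_eqI, simp add: blinfun.bilinear_simps)
  show "a * (b + c) = a * b + a * c" by transfer (rule blinfun_eqI, simp add: blinfun.bilinear_simps)
  show "r *\<^sub>R a * b = r *\<^sub>R (a * b)" by transfer (rule blinfun_eqI, simp add: blinfun.bilinear_simps)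
  show "a * r *\<^sub>R b = r *\<^sub>R (a * b)" by transfer (rule blinfun_eqI, simp add: blinfun.bilinear_simps)
  show "1 * a = a" by transfer (rule blinfun_eqI, simp)
  show "a * 1 = a" by transfer (rule blinfun_eqI, simp)
  show "norm (a * b) \<le> norm a * norm b" by transfer (rule norm_blinfun_compose)
next
  fix X :: "nat \<Rightarrow> 'a op"
  assume X: "Cauchy X"
  have "Cauchy (\<lambda>n. Rep_op (X n))" using X unfolding Cauchy_def by (simp add: dist_op.rep_eq)
  then obtain L where L: "(\<lambda>n. Rep_op (X n)) \<longlonglongrightarrow> L" using Cauchy_convergent convergent_def by blast
  have "L (icscale x) = icscale (L x)" for x
  proof (rule LIMSEQ_unique)
    show "(\<lambda>n. Rep_op (X n) (icscale x)) \<longlonglongrightarrow> L (icscale x)"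
      by (intro bounded_linear.tendsto[OF blinfun.bounded_linear_left] L)
    have "(\<lambda>n. icscale (Rep_op (X n) x)) \<longlonglongrightarrow> icscale (L x)"
      by (intro bounded_linear.tendsto[OF bounded_linear_icscale] bounded_linear.tendsto[OF blinfun.bounded_linear_left] L)
    moreover have "Rep_op (X n) (icscale x) = icscale (Rep_op (X n) x)" for n
      using Rep_op[of "X n"] by auto
    ultimately show "(\<lambda>n. Rep_op (X n) (icscale x)) \<longlonglongrightarrow> icscale (L x)" by simp
  qed
  then have "Rep_op (Abs_op L) = L" by (simp add: Abs_op_inverse)
  then have "X \<longlonglongrightarrow> Abs_op L" using L unfolding lim_sequentially by (simp add: dist_op.rep_eq)
  then show "convergent X" unfolding convergent_def by blast
qed

end

lemma op_eqI: "(\<And>x. ap S x = ap T x) \<Longrightarrow> S = T"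
  by transfer (rule blinfun_eqI)

lemma bounded_linear_ap: "bounded_linear (ap T)"
  by (simp add: ap.rep_eq blinfun.bounded_linear_right)

lemmas ap_linear = bounded_linear_ap[THEN bounded_linear.linear]

lemma ap_simps [simp]:
  "ap 0 x = 0" "ap 1 x = x" "ap (S + T) x = ap S x + ap T x" "ap (S - T) x = ap S x - ap T x"
  "ap (- T) x = - ap T x" "ap (r *\<^sub>R T) x = r *\<^sub>R ap T x" "ap (S * T) x = ap S (ap T x)"
  by (transfer, simp add: blinfun.bilinear_simps)+

lemma ap_arg_simps [simp]:
  "ap T 0 = 0" "ap T (x + y) = ap T x + ap T y" "ap T (x - y) = ap T x - ap T y"
  "ap T (- x) = - ap T x" "ap T (r *\<^sub>R x) = r *\<^sub>R ap T x" "ap T (icscale x) = icscale (ap T x)"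
  by (transfer, simp add: blinfun.bilinear_simps)+

lemma ap_sum: "ap (sum f S) x = (\<Sum>i\<in>S. ap (f i) x)"
  by (induction S rule: infinite_finite_induct) auto

lemma ap_cscale: "ap T (cscale c x) = cscale c (ap T x)"
  by (simp add: cscale_decompose[of c])

lemma norm_ap: "norm (ap T x) \<le> norm T * norm x"
  by transfer (rule norm_blinfun)

lemma norm_op_bound: "0 \<le> b \<Longrightarrow> (\<And>x. norm (ap T x) \<le> b * norm x) \<Longrightarrow> norm T \<le> b"
  by transfer (rule norm_blinfun_bound)

lemma op_exists:
  assumes "\<And>x y. f (x + y) = f x + f y" "\<And>r x. f (r *\<^sub>R x) = r *\<^sub>R f x"
    "\<And>x. f (icscale x) = icscale (f x)" "\<And>x. norm (f x) \<le> K * norm x"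
  obtains T where "ap T = f"
proof -
  have bl: "bounded_linear f"
    by (rule bounded_linear_intro[where K = K]) (use assms in \<open>auto simp: mult.commute\<close>)
  have "ap (Abs_op (Blinfun f)) = f"
    by (simp add: ap.rep_eq Abs_op_inverse bounded_linear_Blinfun_apply[OF bl] assms(3))
  then show ?thesis by (rule that)
qed

section \<open>Adjoints, and multiplication by i as an operator\<close>

definition adj :: "'h::chilbert_space op \<Rightarrow> 'h op" where
  "adj T = (SOME S. \<forall>x y. rip (ap T x) y = rip x (ap S y))"

lemma adj_exists:
  fixes T :: "'h::chilbert_space op"
  shows "\<exists>S. \<forall>x y. rip (ap T x) y = rip x (ap S y)"
proof -
  interpret R: bounded_bilinear "rip :: 'h \<Rightarrow> 'h \<Rightarrow> real" by (rule bounded_bilinear_rip)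
  have "\<exists>z. \<forall>x. rip (ap T x) y = rip x z" for y
    using riesz[OF bounded_linear_compose[OF R.bounded_linear_left[of y] bounded_linear_ap[of T]]] by metis
  then obtain f where f: "\<And>x y. rip (ap T x) y = rip x (f y)" by metis
  have eq: "u = v" if "\<And>x. rip x u = rip x v" for u v :: 'h
    using rip_eqI[of u v] that by (simp add: rip_commute)
  have "norm (f y) \<le> norm T * norm y" for y
  proof (cases "f y = 0")
    case False
    have "norm (f y) * norm (f y) = rip (ap T (f y)) y" by (simp add: f rip_self power2_eq_square)
    also have "\<dots> \<le> norm (ap T (f y)) * norm y" by (rule rip_le_norm)
    also have "\<dots> \<le> norm T * norm (f y) * norm y" by (intro mult_right_mono norm_ap) auto
    finally show ?thesis using False by (simp add: mult_ac)
  qed simp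
  moreover have "f (x + y) = f x + f y" for x y by (rule eq) (simp add: rip_simps flip: f)
  moreover have "f (r *\<^sub>R x) = r *\<^sub>R f x" for r x by (rule eq) (simp add: rip_simps flip: f)
  moreover have "f (icscale x) = icscale (f x)" for x
  proof (rule eq)
    fix z
    have "rip z (icscale (f x)) = - rip (icscale z) (f x)" by (simp add: rip_icscale_left)
    also have "\<dots> = - rip (icscale (ap T z)) x" by (simp flip: f)
    also have "\<dots> = rip z (f (icscale x))" by (simp add: rip_icscale_left flip: f)
    finally show "rip z (f (icscale x)) = rip z (icscale (f x))" by simp
  qed
  ultimately obtain S where "ap S = f" using op_exists[of f "norm T"] by metis
  then show ?thesis using f by metis
qed

lemma rip_ap: "rip (ap T x) y = rip x (ap (adj T) y)"
  using someI_ex[OF adj_exists[of T]] unfolding adj_def by blast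

lemma rip_ap_adj: "rip x (ap T y) = rip (ap (adj T) x) y"
  by (metis rip_ap rip_commute)

lemma adj_eqI: "(\<And>x y. rip (ap T x) y = rip x (ap S y)) \<Longrightarrow> adj T = S"
  by (rule op_eqI, rule rip_eqI) (metis rip_ap rip_commute)

lemma adj_adj [simp]: "adj (adj T) = T"
  by (rule adj_eqI) (metis rip_ap rip_commute)

lemma adj_simps [simp]:
  "adj 0 = 0" "adj 1 = 1" "adj (S + T) = adj S + adj T" "adj (S - T) = adj S - adj T"
  "adj (- T) = - adj T" "adj (r *\<^sub>R T) = r *\<^sub>R adj T"
  by (rule adj_eqI, simp add: rip_simps rip_ap)+

lemma adj_mult [simp]: "adj (S * T) = adj T * adj S"
  by (rule adj_eqI) (simp add: rip_ap)

lemma adj_sum: "adj (sum f S) = (\<Sum>i\<in>S. adj (f i))"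
  by (induction S rule: infinite_finite_induct) auto

lemma adj_power: "adj (T ^ n) = adj T ^ n"
  by (induction n) (auto simp: power_commutes)

lemma adj_eq_iff: "adj S = adj T \<longleftrightarrow> S = T"
  by (metis adj_adj)

lemma adj_eq_0_iff [simp]: "adj T = 0 \<longleftrightarrow> T = 0"
  using adj_eq_iff[of T 0] by simp

lemma norm_adj_le: "norm (adj T) \<le> norm T"
proof (rule norm_op_bound)
  fix x
  show "norm (ap (adj T) x) \<le> norm T * norm x"
  proof (cases "ap (adj T) x = 0")
    case False
    have "norm (ap (adj T) x) * norm (ap (adj T) x) = rip (ap T (ap (adj T) x)) x"
      by (simp add: rip_ap rip_self power2_eq_square)
    also have "\<dots> \<le> norm (ap T (ap (adj T) x)) * norm x" by (rule rip_le_norm)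
    also have "\<dots> \<le> norm T * norm (ap (adj T) x) * norm x" by (intro mult_right_mono norm_ap) auto
    finally show ?thesis using False by (simp add: mult_ac)
  qed simp
qed simp

lemma norm_adj [simp]: "norm (adj T) = norm T"
  using norm_adj_le[of T] norm_adj_le[of "adj T"] by simp

lemma bounded_linear_adj: "bounded_linear adj"
  by (rule bounded_linear_intro[where K = 1]) auto

lemma norm_ap_sq: "(norm (ap T x))\<^sup>2 = rip (ap (adj T * T) x) x"
  by (simp add: rip_self[symmetric] rip_ap rip_commute)

lemma adj_mult_self_eq_0: "adj T * T = 0 \<longleftrightarrow> T = 0"
proof
  assume "adj T * T = 0"
  then have "norm (ap T x) = 0" for x using norm_ap_sq[of T x] by simp
  then show "T = 0" by (intro op_eqI) auto
qed simp

text \<open>Complex scalars become real combinations of 1 and this central, skew-adjoint element, so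
  the algebra can be treated over the reals.\<close>

lift_definition imag_op :: "'h::chilbert_space op" is "Blinfun icscale"
  by (simp add: bounded_linear_Blinfun_apply[OF bounded_linear_icscale])

lemma ap_imag_op [simp]: "ap imag_op x = icscale x"
  by transfer (simp add: bounded_linear_Blinfun_apply[OF bounded_linear_icscale])

lemma imag_op_commute: "imag_op * T = T * imag_op"
  by (rule op_eqI) simp

lemma imag_op_sq [simp]: "imag_op * imag_op = - 1"
  by (rule op_eqI) simp

lemma adj_imag_op [simp]: "adj imag_op = - imag_op"
  by (rule adj_eqI) (simp add: rip_icscale_left)

lemma norm_imag_op_le: "norm imag_op \<le> 1"
  by (rule norm_op_bound) auto

section \<open>Projections and spectral cuts\<close>

definition proj :: "'h::chilbert_space op \<Rightarrow> bool" where
  "proj p \<longleftrightarrow> p * p = p \<and> adj p = p"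

text \<open>Membership in the corner with unit \<open>e\<close>; between projections it is the usual
  order.\<close>

definition under :: "'h::chilbert_space op \<Rightarrow> 'h op \<Rightarrow> bool" where
  "under x e \<longleftrightarrow> e * x = x \<and> x * e = x"

lemma projI: "p * p = p \<Longrightarrow> adj p = p \<Longrightarrow> proj p" by (simp add: proj_def)
lemma proj_idem [simp]: "proj p \<Longrightarrow> p * p = p" by (simp add: proj_def)
lemma proj_adj [simp]: "proj p \<Longrightarrow> adj p = p" by (simp add: proj_def)
lemma proj_idem_left: "proj p \<Longrightarrow> p * (p * x) = p * x" by (simp flip: mult.assoc)
lemma proj_0 [simp]: "proj 0" and proj_1 [simp]: "proj 1" by (auto simp: proj_def)
lemma proj_compl: "proj p \<Longrightarrow> proj (1 - p)" by (rule projI) (simp_all add: left_diff_distrib right_diff_distrib)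

lemma proj_mult_commute: "proj p \<Longrightarrow> proj q \<Longrightarrow> p * q = q * p \<Longrightarrow> proj (p * q)"
  by (rule projI) (metis mult.assoc proj_idem, metis adj_mult proj_adj)

lemma proj_under_iff: "proj e \<Longrightarrow> proj p \<Longrightarrow> under p e \<longleftrightarrow> e * p = p"
  unfolding under_def by (metis adj_mult proj_adj)

lemma proj_diff: "proj e \<Longrightarrow> proj p \<Longrightarrow> under p e \<Longrightarrow> proj (e - p)"
  by (rule projI) (simp_all add: left_diff_distrib right_diff_distrib under_def)

lemma norm_ap_proj_sq: "proj p \<Longrightarrow> (norm (ap p x))\<^sup>2 = rip (ap p x) x"
  by (simp add: norm_ap_sq)

lemma proj_pythagoras: "proj p \<Longrightarrow> (norm x)\<^sup>2 = (norm (ap p x))\<^sup>2 + (norm (ap (1 - p) x))\<^sup>2"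
  by (simp only: norm_ap_proj_sq proj_compl) (simp add: rip_simps rip_self)

lemma norm_ap_proj_le:
  assumes "proj p"
  shows "norm (ap p x) \<le> norm x"
proof (rule power2_le_imp_le)
  show "(norm (ap p x))\<^sup>2 \<le> (norm x)\<^sup>2"
    using proj_pythagoras[OF assms, of x] zero_le_power2[of "norm (ap (1 - p) x)"] by linarith
qed simp

lemma norm_proj_le: "proj p \<Longrightarrow> norm p \<le> 1"
  by (rule norm_op_bound) (auto intro: norm_ap_proj_le)

text \<open>The foot of the perpendicular is unique, which makes it real linear in the point and, as
  \<open>N\<close> is stable under multiplication by i, also complex linear.\<close>

lemma closed_subspace_proj:
  fixes N :: "'h::chilbert_space set"
  assumes N: "subspace N" "closed N" "\<And>x. x \<in> N \<Longrightarrow> icscale x \<in> N"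
  obtains Q where "proj Q" "\<And>x. ap Q x \<in> N" "\<And>x. x \<in> N \<Longrightarrow> ap Q x = x"
proof -
  have "\<exists>m\<in>N. \<forall>y\<in>N. rip (x - m) y = 0" for x
    using orthogonal_decomposition[OF N(1,2), of x] by metis
  then obtain f where f: "\<And>x. f x \<in> N" "\<And>x y. y \<in> N \<Longrightarrow> rip (x - f x) y = 0" by metis
  have uniq: "f x = m" if "m \<in> N" "\<And>y. y \<in> N \<Longrightarrow> rip (x - m) y = 0" for x m
  proof -
    have mem: "f x - m \<in> N" using N(1) f(1) that(1) by (intro subspace_diff)
    have "rip (f x - m) (f x - m) = rip (x - m) (f x - m) - rip (x - f x) (f x - m)"
      by (simp add: rip_simps)
    then have "rip (f x - m) (f x - m) = 0" using that(2)[OF mem] f(2)[OF mem] by simp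
    then show ?thesis by (simp add: rip_self)
  qed
  have "f (x + y) = f x + f y" for x y
  proof (rule uniq)
    show "rip (x + y - (f x + f y)) z = 0" if "z \<in> N" for z
      using f(2)[OF that, of x] f(2)[OF that, of y] by (simp add: rip_simps)
  qed (intro subspace_add N f(1))
  moreover have "f (r *\<^sub>R x) = r *\<^sub>R f x" for r x
  proof (rule uniq)
    show "rip (r *\<^sub>R x - r *\<^sub>R f x) z = 0" if "z \<in> N" for z
      using f(2)[OF that, of x] by (simp add: rip_simps flip: scaleR_diff_right)
  qed (intro subspace_scale N f(1))
  moreover have "f (icscale x) = icscale (f x)" for x
  proof (rule uniq)
    show "rip (icscale x - icscale (f x)) z = 0" if "z \<in> N" for z
      using f(2)[OF N(3)[OF that], of x] rip_icscale_left[of "x - f x" z] by (simp add: icscale_simps)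
  qed (intro N f(1))
  moreover have "norm (f x) \<le> 1 * norm x" for x
  proof -
    have "(norm x)\<^sup>2 = (norm (x - f x))\<^sup>2 + 2 * rip (x - f x) (f x) + (norm (f x))\<^sup>2"
      using norm_add_sq[of "x - f x" "f x"] by simp
    then have "(norm (f x))\<^sup>2 \<le> (norm x)\<^sup>2"
      using f(2)[OF f(1), of x x] zero_le_power2[of "norm (x - f x)"] by linarith
    then show ?thesis using power2_le_imp_le[OF _ norm_ge_zero] by simp
  qed
  ultimately obtain Q where Q: "ap Q = f" using op_exists[of f 1] by metis
  have fixed: "f x = x" if "x \<in> N" for x by (rule uniq) (use that in auto)
  have "Q * Q = Q" by (rule op_eqI) (simp add: Q fixed f(1))
  moreover have "adj Q = Q"
  proof (rule adj_eqI)
    fix x y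
    have "rip (f x) (y - f y) = 0" "rip (x - f x) (f y) = 0"
      using f(2)[OF f(1)] by (simp_all add: rip_commute)
    then show "rip (ap Q x) y = rip x (ap Q y)" by (simp add: Q rip_simps)
  qed
  ultimately have "proj Q" by (rule projI)
  then show ?thesis using that[of Q] Q f(1) fixed by simp
qed

lemma closure_of_subspace:
  fixes S :: "'a::real_normed_vector set"
  assumes "subspace S"
  shows "subspace (closure S)"
proof (rule subspaceI)
  show "0 \<in> closure S" using subspace_0[OF assms] closure_subset by blast
  show "x + y \<in> closure S" if xy: "x \<in> closure S" "y \<in> closure S" for x y
  proof -
    obtain f where "\<And>n. f n \<in> S" "f \<longlonglongrightarrow> x" using xy(1) unfolding closure_sequential by blast
    moreover obtain g where "\<And>n. g n \<in> S" "g \<longlonglongrightarrow> y" using xy(2) unfolding closure_sequential by blast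
    ultimately show ?thesis unfolding closure_sequential
      by (intro exI[of _ "\<lambda>n. f n + g n"]) (auto intro: tendsto_add subspace_add[OF assms])
  qed
  show "c *\<^sub>R x \<in> closure S" if x: "x \<in> closure S" for c x
  proof -
    obtain f where "\<And>n. f n \<in> S" "f \<longlonglongrightarrow> x"
      using x unfolding closure_sequential by blast
    then show ?thesis unfolding closure_sequential
      by (intro exI[of _ "\<lambda>n. c *\<^sub>R f n"]) (auto intro: tendsto_intros subspace_scale[OF assms])
  qed
qed

text \<open>\<open>F\<close> projects onto the kernel of \<open>G\<close> and is obtained as the
  complement of the closed range. The annihilator clause holds because an operator that kills the
  range kills its closure.\<close>

lemma kernel_proj:
  fixes G :: "'h::chilbert_space op"
  assumes G: "adj G = G"
  obtains F where "proj F" "G * F = 0" "\<And>B. B * G = 0 \<Longrightarrow> B * (1 - F) = 0"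
    "\<And>S. S * G = G * S \<Longrightarrow> S * F = F * S"
proof -
  let ?R = "range (ap G)"
  let ?N = "closure ?R"
  have "subspace ?R" by (rule linear_subspace_image[OF ap_linear subspace_UNIV])
  then have "subspace ?N" by (rule closure_of_subspace)
  moreover have "icscale x \<in> ?N" if "x \<in> ?N" for x
  proof -
    have "icscale ` ?N \<subseteq> closure (icscale ` ?R)"
      by (intro image_closure_subset closure_subset bounded_linear.continuous_on[OF bounded_linear_icscale] continuous_on_id) auto
    also have "icscale ` ?R \<subseteq> ?R" by (auto simp flip: ap_arg_simps(6))
    then have "closure (icscale ` ?R) \<subseteq> ?N" by (rule closure_mono)
    finally show ?thesis using that by blast
  qed
  ultimately obtain Q where Q: "proj Q" "\<And>x. ap Q x \<in> ?N" "\<And>x. x \<in> ?N \<Longrightarrow> ap Q x = x"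
    using closed_subspace_proj[of ?N] by auto
  have QG: "Q * G = G"
  proof (rule op_eqI)
    fix x
    have "ap G x \<in> ?N" using closure_subset[of ?R] by blast
    then show "ap (Q * G) x = ap G x" by (simp add: Q(3))
  qed
  define F where "F = 1 - Q"
  have pF: "proj F" using Q(1) by (simp add: F_def proj_compl)
  have FG: "F * G = 0" using QG by (simp add: F_def algebra_simps)
  have GF: "G * F = 0" using arg_cong[OF FG, of adj] G pF by simp
  have ann: "B * (1 - F) = 0" if B: "B * G = 0" for B
  proof (rule op_eqI)
    fix x
    have "closed {y. ap B y = 0}"
      by (intro closed_Collect_eq bounded_linear.continuous_on[OF bounded_linear_ap] continuous_intros)
    moreover have "?R \<subseteq> {y. ap B y = 0}" using B by (auto simp flip: ap_simps(7))
    ultimately have "?N \<subseteq> {y. ap B y = 0}" by (rule closure_minimal[rotated])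
    then show "ap (B * (1 - F)) x = ap 0 x" using Q(2)[of x] by (auto simp: F_def)
  qed
  \<comment> \<open>Both products equal \<open>F * S * F\<close> by the annihilator clause; for
    \<open>S * F\<close> it is applied to the adjoint.\<close>
  have "S * F = F * S" if S: "S * G = G * S" for S
  proof -
    have "adj S * G = G * adj S" using arg_cong[OF S, of adj] G by simp
    then have "adj (S * F) * G = 0" using pF by (metis FG adj_mult mult.assoc mult_zero_left proj_adj)
    then have "adj (S * F) * (1 - F) = 0" by (rule ann)
    then have "adj ((1 - F) * (S * F)) = 0" using pF by (simp add: mult.assoc)
    then have "(1 - F) * (S * F) = 0" using adj_eq_0_iff by blast
    then have 1: "S * F = F * S * F" by (simp add: left_diff_distrib mult.assoc)
    have "(F * S) * G = 0" using S FG by (metis mult.assoc mult_zero_left)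
    then have "(F * S) * (1 - F) = 0" by (rule ann)
    then have "F * S = F * S * F" by (simp add: right_diff_distrib)
    with 1 show ?thesis by (rule trans[OF _ sym])
  qed
  then show ?thesis using that[of F] pF GF ann by blast
qed

lemma adj_sqrt1m:
  assumes "norm y \<le> 1" "adj y = y"
  shows "adj (sqrt1m y) = sqrt1m y"
  unfolding sqrt1m_def
  by (subst bounded_linear.suminf[OF bounded_linear_adj summable_sqrt1m[OF assms(1)]])
     (simp add: adj_power assms(2))

text \<open>Positivity comes from the norm alone: \<open>1 - sqrt1m y\<close> has norm at most 1, so
  its quadratic form never exceeds that of the identity.\<close>

lemma sqrt1m_nonneg:
  assumes "norm y \<le> 1"
  shows "0 \<le> rip (ap (sqrt1m y) x) x"
proof -
  have "rip (ap (1 - sqrt1m y) x) x \<le> norm (1 - sqrt1m y) * norm x * norm x"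
    using rip_le_norm[of "ap (1 - sqrt1m y) x" x] norm_ap[of "1 - sqrt1m y" x]
    by (meson mult_right_mono norm_ge_zero order_trans)
  also have "\<dots> \<le> 1 * norm x * norm x"
    using norm_one_minus_sqrt1m[OF assms] assms by (intro mult_right_mono) auto
  finally show ?thesis by (simp add: rip_simps rip_self power2_eq_square)
qed

text \<open>\<open>s\<close> is the absolute value of \<open>H\<close>. After scaling to a
  contraction \<open>K\<close>, the element \<open>1 - K * K\<close> has norm at most 1, possibly
  equal to 1, which the series for the root still permits.\<close>

lemma abs_op:
  assumes H: "adj H = H"
  obtains s where "adj s = s" "s * s = H * H" "\<And>S. S * H = H * S \<Longrightarrow> S * s = s * S"
    "\<And>x. 0 \<le> rip (ap s x) x"
proof -
  \<comment> \<open>The added 1 keeps \<open>r\<close> positive when \<open>H = 0\<close>.\<close>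
  define r where "r = norm H + 1"
  have r: "r > 0" by (simp add: r_def add_nonneg_pos)
  define K where "K = (1 / r) *\<^sub>R H"
  have nK: "norm K \<le> 1" using r by (simp add: K_def r_def)
  have aK: "adj K = K" by (simp add: K_def H)
  define y where "y = 1 - K * K"
  have "norm (ap y x) \<le> 1 * norm x" for x
  proof -
    have Kle: "norm (ap K z) \<le> norm z" for z
      using norm_ap[of K z] nK by (smt (verit) mult_left_le_one_le norm_ge_zero)
    have "(norm (ap y x))\<^sup>2 = (norm x)\<^sup>2 - 2 * rip x (ap K (ap K x)) + (norm (ap K (ap K x)))\<^sup>2"
      by (simp add: y_def norm_diff_sq)
    also have "rip x (ap K (ap K x)) = (norm (ap K x))\<^sup>2" by (simp add: rip_ap_adj aK rip_self)
    finally have "(norm (ap y x))\<^sup>2 \<le> (norm x)\<^sup>2"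
      using power_mono[OF Kle[of "ap K x"] norm_ge_zero, of 2] zero_le_power2[of "norm (ap K x)"] by linarith
    then show ?thesis using power2_le_imp_le[OF _ norm_ge_zero] by simp
  qed
  then have ny: "norm y \<le> 1" by (intro norm_op_bound) auto
  have ay: "adj y = y" by (simp add: y_def aK)
  show ?thesis
  proof (rule that[of "r *\<^sub>R sqrt1m y"])
    show "adj (r *\<^sub>R sqrt1m y) = r *\<^sub>R sqrt1m y" by (simp add: adj_sqrt1m ny ay)
    show "r *\<^sub>R sqrt1m y * r *\<^sub>R sqrt1m y = H * H"
      using r by (simp add: sqrt1m_square[OF ny]) (simp add: y_def K_def)
    show "0 \<le> rip (ap (r *\<^sub>R sqrt1m y) x) x" for x
      using r sqrt1m_nonneg[OF ny, of x] by (simp add: rip_simps)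
    fix S assume "S * H = H * S"
    then have "S * K = K * S" by (simp add: K_def)
    then have "S * (K * K) = K * K * S" by (metis mult.assoc)
    then have "S * y = y * S" by (simp add: y_def left_diff_distrib right_diff_distrib)
    then show "S * (r *\<^sub>R sqrt1m y) = r *\<^sub>R sqrt1m y * S" by (simp add: sqrt1m_commute[OF ny])
  qed
qed

text \<open>With \<open>s\<close> the absolute value, \<open>F\<close> projects onto the kernel of
  \<open>s + H\<close>, where \<open>H\<close> is \<open>- s\<close>. As
  \<open>(s - H) * (s + H) = 0\<close>, on the complement \<open>H\<close> is \<open>s\<close>. So
  \<open>F\<close> serves as the spectral projection for the nonpositive half-line.\<close>

lemma spectral_cut:
  assumes H: "adj H = H"
  obtains F where "proj F" "\<And>S. S * H = H * S \<Longrightarrow> S * F = F * S"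
    "\<And>x. rip (ap H (ap F x)) (ap F x) \<le> 0"
    "\<And>x. 0 \<le> rip (ap H (ap (1 - F) x)) (ap (1 - F) x)"
proof -
  obtain s where s: "adj s = s" "s * s = H * H" "\<And>S. S * H = H * S \<Longrightarrow> S * s = s * S"
    "\<And>x. 0 \<le> rip (ap s x) x" using abs_op[OF H] by blast
  have Hs: "H * s = s * H" by (rule s(3)) simp
  have aG: "adj (s + H) = s + H" by (simp add: s(1) H)
  obtain F where F: "proj F" "(s + H) * F = 0" "\<And>B. B * (s + H) = 0 \<Longrightarrow> B * (1 - F) = 0"
    "\<And>S. S * (s + H) = (s + H) * S \<Longrightarrow> S * F = F * S"
    using kernel_proj[OF aG] by blast
  have "(s - H) * (s + H) = 0" by (simp add: algebra_simps s(2) Hs)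
  then have 1: "(s - H) * (1 - F) = 0" by (rule F(3))
  show ?thesis
  proof (rule that[OF F(1)])
    show "S * F = F * S" if "S * H = H * S" for S
      using that s(3)[OF that] by (intro F(4)) (simp add: algebra_simps)
    fix x
    have "ap ((s + H) * F) x = 0" unfolding F(2) by simp
    then have "ap H (ap F x) = - ap s (ap F x)" by (simp add: eq_neg_iff_add_eq_0 add.commute)
    then show "rip (ap H (ap F x)) (ap F x) \<le> 0" using s(4) by simp
    have "ap (s - H) (ap (1 - F) x) = 0" using arg_cong[OF 1, of "\<lambda>T. ap T x"] by (simp only: ap_simps(1,7))
    then have eq: "ap H (ap (1 - F) x) = ap s (ap (1 - F) x)" by (simp only: ap_simps(4)) simp
    show "0 \<le> rip (ap H (ap (1 - F) x)) (ap (1 - F) x)" unfolding eq by (rule s(4))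
  qed
qed

lemma norm_le_of_quadratic_form:
  assumes T: "adj T = T" and c: "0 \<le> c" and q: "\<And>x. \<bar>rip (ap T x) x\<bar> \<le> c * (norm x)\<^sup>2"
  shows "norm T \<le> c"
proof (rule norm_op_bound[OF c])
  fix x
  show "norm (ap T x) \<le> c * norm x"
  proof (cases "ap T x = 0")
    case True then show ?thesis using c by simp
  next
    case False
    define a b where "a = norm x" and "b = norm (ap T x)"
    have b: "b > 0" and a: "a > 0" using False by (auto simp: a_def b_def)
    \<comment> \<open>\<open>ap T x\<close> is rescaled to the norm of \<open>x\<close>, because
      polarisation loses nothing when both vectors have equal norm.\<close>
    define y where "y = (a / b) *\<^sub>R ap T x"
    have ny: "norm y = a" using a b by (simp add: y_def b_def)
    have "rip (ap T y) x = rip (ap T x) y" by (metis T rip_ap rip_commute)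
    then have "rip (ap T (x + y)) (x + y) - rip (ap T (x - y)) (x - y) = 4 * rip (ap T x) y"
      by (simp add: rip_simps)
    also have "\<dots> = 4 * (a * b)" using b by (simp add: y_def rip_simps rip_self b_def power2_eq_square)
    finally have "4 * (a * b) \<le> c * (norm (x + y))\<^sup>2 + c * (norm (x - y))\<^sup>2"
      using q[of "x + y"] q[of "x - y"] by linarith
    also have "\<dots> = c * (2 * (norm x)\<^sup>2 + 2 * (norm y)\<^sup>2)" by (simp only: distrib_left [symmetric] parallelogram)
    finally have "a * b \<le> a * (c * a)" by (simp add: ny a_def[symmetric] power2_eq_square algebra_simps)
    then show ?thesis using a by (simp add: a_def b_def)
  qed
qed

section \<open>Orthogonal direct sums\<close>

definition orthogonal_family :: "('i \<Rightarrow> 'h::chilbert_space op) \<Rightarrow> 'i set \<Rightarrow> bool" where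
  "orthogonal_family f I \<longleftrightarrow> (\<forall>i\<in>I. proj (f i)) \<and> (\<forall>i\<in>I. \<forall>j\<in>I. i \<noteq> j \<longrightarrow> f i * f j = 0)"

lemma norm_sum_orthogonal_sq:
  fixes y :: "'i \<Rightarrow> 'h::chilbert_space"
  assumes "finite F" "\<And>i j. i \<in> F \<Longrightarrow> j \<in> F \<Longrightarrow> i \<noteq> j \<Longrightarrow> rip (y i) (y j) = 0"
  shows "(norm (sum y F))\<^sup>2 = (\<Sum>i\<in>F. (norm (y i))\<^sup>2)"
  using assms
proof (induction F rule: finite_induct)
  case (insert i F)
  interpret R: bounded_bilinear "rip :: 'h \<Rightarrow> 'h \<Rightarrow> real" by (rule bounded_bilinear_rip)
  have "rip (y i) (sum y F) = (\<Sum>j\<in>F. rip (y i) (y j))" by (rule R.sum_right)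
  also have "\<dots> = 0" using insert by (intro sum.neutral) auto
  finally show ?case using insert by (simp add: norm_add_sq)
qed simp

text \<open>By Pythagoras, the norm of a further finite sum is controlled by the gap between the sum
  of squares already reached and its supremum \<open>s\<close>.\<close>

lemma orthogonal_summable:
  fixes y :: "'i \<Rightarrow> 'h::chilbert_space"
  assumes orth: "\<And>i j. i \<in> I \<Longrightarrow> j \<in> I \<Longrightarrow> i \<noteq> j \<Longrightarrow> rip (y i) (y j) = 0"
    and bd: "\<And>F. finite F \<Longrightarrow> F \<subseteq> I \<Longrightarrow> (\<Sum>i\<in>F. (norm (y i))\<^sup>2) \<le> b"
  shows "y summable_on I"
proof -
  define g where "g i = (norm (y i))\<^sup>2" for i
  define \<F> where "\<F> = {F. finite F \<and> F \<subseteq> I}"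
  define s where "s = (SUP F\<in>\<F>. sum g F)"
  have bdd: "bdd_above (sum g ` \<F>)" by (rule bdd_aboveI[of _ b]) (use bd in \<open>auto simp: g_def \<F>_def\<close>)
  have le_s: "sum g F \<le> s" if "F \<in> \<F>" for F unfolding s_def by (rule cSUP_upper[OF that bdd])
  have "\<exists>P. eventually P (finite_subsets_at_top I) \<and>
      (\<forall>F F'. P F \<and> P F' \<longrightarrow> dist (sum y F) (sum y F') < e)" if e: "e > 0" for e
  proof (intro exI conjI allI impI)
    let ?P = "\<lambda>F. F \<in> \<F> \<and> s - (e/2)\<^sup>2 < sum g F"
    have "\<exists>F\<in>\<F>. s - (e/2)\<^sup>2 < sum g F"
      using less_cSUP_iff[OF _ bdd, of "s - (e/2)\<^sup>2"] e unfolding s_def[symmetric]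
      by (auto simp: \<F>_def)
    then obtain F0 where F0: "F0 \<in> \<F>" "s - (e/2)\<^sup>2 < sum g F0" by blast
    have "?P F" if "finite F" "F0 \<subseteq> F" "F \<subseteq> I" for F
    proof -
      have "sum g F0 \<le> sum g F" by (rule sum_mono2) (use that in \<open>auto simp: g_def\<close>)
      then show ?thesis using F0 that by (auto simp: \<F>_def)
    qed
    then show "eventually ?P (finite_subsets_at_top I)"
      unfolding eventually_finite_subsets_at_top using F0 by (intro exI[of _ F0]) (auto simp: \<F>_def)
    have close: "norm (sum y (F \<union> F') - sum y F) < e / 2" if F: "?P F" and F': "?P F'" for F F'
    proof -
      have fin: "finite F" "finite F'" "F \<subseteq> I" "F' \<subseteq> I" using F F' by (auto simp: \<F>_def)
      have eq: "sum h (F \<union> F') = sum h F + sum h (F' - F)" for h :: "'i \<Rightarrow> 'c::comm_monoid_add"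
        using sum.union_disjoint[of F "F' - F" h] fin by auto
      have "(norm (sum y (F' - F)))\<^sup>2 = sum g (F' - F)"
        unfolding g_def by (rule norm_sum_orthogonal_sq) (use fin in \<open>auto intro!: orth\<close>)
      also have "\<dots> = sum g (F \<union> F') - sum g F" by (simp add: eq)
      also have "\<dots> < (e/2)\<^sup>2" using le_s[of "F \<union> F'"] F fin by (simp add: \<F>_def)
      finally have "norm (sum y (F' - F)) < e/2" using e by (intro power_less_imp_less_base[of _ 2 "e/2"]) auto
      then show ?thesis by (simp add: eq)
    qed
    fix F F' assume "?P F \<and> ?P F'"
    then have "norm (sum y (F \<union> F') - sum y F) < e / 2" "norm (sum y (F' \<union> F) - sum y F') < e / 2"
      by (intro close; simp)+
    then have "norm (sum y (F \<union> F') - sum y F) + norm (sum y (F \<union> F') - sum y F') < e"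
      by (simp add: Un_commute)
    then show "dist (sum y F) (sum y F') < e"
      using norm_triangle_ineq4[of "sum y (F \<union> F') - sum y F'" "sum y (F \<union> F') - sum y F"]
      by (simp add: dist_norm)
  qed
  then have "cauchy_filter (filtermap (sum y) (finite_subsets_at_top I))"
    by (simp add: cauchy_filter_metric_filtermap)
  moreover have "complete (UNIV::'h set)"
    by (meson Cauchy_convergent UNIV_I complete_def convergent_def)
  ultimately obtain l where "(sum y \<longlongrightarrow> l) (finite_subsets_at_top I)"
    using complete_uniform[where S=UNIV] by (force simp add: filterlim_def)
  then show ?thesis using summable_on_def has_sum_def by blast
qed

lemma proj_sum:
  assumes "finite F" "orthogonal_family f F"
  shows "proj (sum f F)"
proof (rule projI)
  have "sum f F * sum f F = (\<Sum>i\<in>F. \<Sum>j\<in>F. f i * f j)" by (simp add: sum_product)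
  also have "\<dots> = (\<Sum>i\<in>F. \<Sum>j\<in>F. if j = i then f i else 0)"
    using assms(2) by (intro sum.cong) (auto simp: orthogonal_family_def)
  also have "\<dots> = sum f F" using assms(1) by simp
  finally show "sum f F * sum f F = sum f F" .
  show "adj (sum f F) = sum f F"
    using assms(2) by (simp add: adj_sum orthogonal_family_def)
qed

lemma bessel:
  fixes f :: "'i \<Rightarrow> 'h::chilbert_space op"
  assumes "finite F" "orthogonal_family f F"
  shows "(\<Sum>i\<in>F. (norm (ap (f i) x))\<^sup>2) \<le> (norm x)\<^sup>2"
proof -
  interpret R: bounded_bilinear "rip :: 'h \<Rightarrow> 'h \<Rightarrow> real" by (rule bounded_bilinear_rip)
  have "(\<Sum>i\<in>F. (norm (ap (f i) x))\<^sup>2) = (\<Sum>i\<in>F. rip (ap (f i) x) x)"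
    using assms(2) by (intro sum.cong) (auto simp: norm_ap_proj_sq orthogonal_family_def)
  also have "\<dots> = rip (ap (sum f F) x) x" by (simp add: ap_sum R.sum_left)
  also have "\<dots> = (norm (ap (sum f F) x))\<^sup>2" by (simp add: norm_ap_proj_sq proj_sum assms)
  also have "\<dots> \<le> (norm x)\<^sup>2" by (intro power_mono norm_ap_proj_le proj_sum assms) auto
  finally show ?thesis .
qed

text \<open>\<open>S\<close> is the strongly convergent sum of the \<open>T i\<close>. The clauses
  are purely algebraic, so that no convergence argument is needed afterwards; the last one puts
  \<open>S\<close> into every von Neumann algebra containing all \<open>T i\<close>.\<close>

lemma direct_sum:
  fixes f T :: "'i \<Rightarrow> 'h::chilbert_space op"
  assumes f: "orthogonal_family f I" and T: "\<And>i. i \<in> I \<Longrightarrow> under (T i) (f i)"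
    and K: "\<And>i. i \<in> I \<Longrightarrow> norm (T i) \<le> K" "0 \<le> K"
  obtains S where "\<And>i. i \<in> I \<Longrightarrow> S * f i = T i" "\<And>i. i \<in> I \<Longrightarrow> f i * S = T i"
    "\<And>B. (\<And>i. i \<in> I \<Longrightarrow> B * T i = 0) \<Longrightarrow> B * S = 0"
    "\<And>B. (\<And>i. i \<in> I \<Longrightarrow> f i * B = 0) \<Longrightarrow> S * B = 0"
    "\<And>R. (\<And>i. i \<in> I \<Longrightarrow> R * T i = T i * R) \<Longrightarrow> R * S = S * R"
proof -
  have fT: "f i * T i = T i" "T i * f i = T i" if "i \<in> I" for i using T[OF that] by (auto simp: under_def)
  have fp: "proj (f i)" if "i \<in> I" for i using f that by (auto simp: orthogonal_family_def)
  have ff: "f i * f j = 0" if "i \<in> I" "j \<in> I" "i \<noteq> j" for i j using f that by (auto simp: orthogonal_family_def)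
  have orth: "rip (ap (T i) x) (ap (T j) x) = 0" if "i \<in> I" "j \<in> I" "i \<noteq> j" for i j x
  proof -
    have "rip (ap (T i) x) (ap (T j) x) = rip (ap (f i) (ap (T i) x)) (ap (f j) (ap (T j) x))"
      using fT that by (metis ap_simps(7))
    also have "\<dots> = rip (ap (T i) x) (ap (f i * f j) (ap (T j) x))" using fp[OF that(1)] by (simp add: rip_ap)
    finally show ?thesis using ff that by simp
  qed
  have bd: "(\<Sum>i\<in>F. (norm (ap (T i) x))\<^sup>2) \<le> (K * norm x)\<^sup>2" if F: "finite F" "F \<subseteq> I" for F x
  proof -
    have "norm (ap (T i) x) \<le> K * norm (ap (f i) x)" if "i \<in> F" for i
    proof -
      have "norm (ap (T i) x) = norm (ap (T i) (ap (f i) x))" using fT(2) F that by (metis ap_simps(7) subsetD)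
      also have "\<dots> \<le> norm (T i) * norm (ap (f i) x)" by (rule norm_ap)
      also have "\<dots> \<le> K * norm (ap (f i) x)" using K(1) F that by (intro mult_right_mono) auto
      finally show ?thesis .
    qed
    then have "(\<Sum>i\<in>F. (norm (ap (T i) x))\<^sup>2) \<le> (\<Sum>i\<in>F. (K * norm (ap (f i) x))\<^sup>2)"
      by (intro sum_mono power_mono) auto
    also have "\<dots> = K\<^sup>2 * (\<Sum>i\<in>F. (norm (ap (f i) x))\<^sup>2)" by (simp add: power_mult_distrib sum_distrib_left)
    also have "\<dots> \<le> K\<^sup>2 * (norm x)\<^sup>2"
      using F f by (intro mult_left_mono bessel) (auto simp: orthogonal_family_def)
    finally show ?thesis by (simp add: power_mult_distrib)
  qed
  have sm: "(\<lambda>i. ap (T i) x) summable_on I" for x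
    by (rule orthogonal_summable[OF orth bd])
  define F where "F x = infsum (\<lambda>i. ap (T i) x) I" for x
  have hs: "((\<lambda>i. ap (T i) x) has_sum F x) I" for x
    unfolding F_def by (rule has_sum_infsum[OF sm])
  have lin: "h (F x) = F' " if "bounded_linear h" "((\<lambda>i. h (ap (T i) x)) has_sum F') I" for h :: "'h \<Rightarrow> 'h" and x F'
    using has_sum_bounded_linear[OF that(1) hs[of x]] that(2) by (rule has_sum_unique)
  have "norm (F x) \<le> K * norm x" for x
  proof (rule Lim_norm_ubound)
    show "(sum (\<lambda>i. ap (T i) x) \<longlongrightarrow> F x) (finite_subsets_at_top I)" using hs[of x] by (simp add: has_sum_def)
    have "norm (\<Sum>i\<in>G. ap (T i) x) \<le> K * norm x" if "finite G" "G \<subseteq> I" for G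
    proof (rule power2_le_imp_le)
      show "(norm (\<Sum>i\<in>G. ap (T i) x))\<^sup>2 \<le> (K * norm x)\<^sup>2"
        using bd[OF that] that by (subst norm_sum_orthogonal_sq) (auto intro!: orth)
    qed (use K in simp)
    then show "\<forall>\<^sub>F G in finite_subsets_at_top I. norm (\<Sum>i\<in>G. ap (T i) x) \<le> K * norm x"
      by (intro eventually_finite_subsets_at_top_weakI)
  qed (rule finite_subsets_at_top_neq_bot)
  moreover have "F (x + y) = F x + F y" for x y
    unfolding F_def by (simp add: infsum_add sm)
  moreover have "F (r *\<^sub>R x) = r *\<^sub>R F x" for r x
    unfolding F_def by (simp add: infsum_scaleR_right)
  moreover have "F (icscale x) = icscale (F x)" for x
    by (rule sym, rule lin[OF bounded_linear_icscale]) (use hs[of "icscale x"] in simp)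
  ultimately obtain S where S: "ap S = F" using op_exists[of F K] by metis
  show ?thesis
  proof (rule that[of S])
    fix i assume i: "i \<in> I"
    show "S * f i = T i"
    proof (rule op_eqI)
      fix x
      have "T j * f i = (if j = i then T i else 0)" if "j \<in> I" for j
        using fT[OF that] ff[OF that i] fT[OF i] by (metis mult.assoc mult_zero_right)
      then have "ap (T j) (ap (f i) x) = (if j = i then ap (T i) x else 0)" if "j \<in> I" for j
        using that by (metis ap_simps(1,7))
      then have "F (ap (f i) x) = infsum (\<lambda>j. ap (T i) x) {i}"
        unfolding F_def by (intro infsum_cong_neutral) (use i in auto)
      then show "ap (S * f i) x = ap (T i) x" by (simp add: S)
    qed
    show "f i * S = T i"
    proof (rule op_eqI)
      fix x
      have "f i * T j = (if j = i then T i else 0)" if "j \<in> I" for j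
        using fT[OF that] ff[OF i that] fT[OF i] by (metis mult.assoc mult_zero_left)
      then have "ap (f i) (ap (T j) x) = (if j = i then ap (T i) x else 0)" if "j \<in> I" for j
        using that by (metis ap_simps(1,7))
      moreover have "((\<lambda>j. ap (T i) x) has_sum ap (T i) x) {i}" by (rule has_sum_finiteI) auto
      ultimately have "((\<lambda>j. ap (f i) (ap (T j) x)) has_sum ap (T i) x) I"
        by (subst has_sum_cong_neutral[where T = "{i}" and g = "\<lambda>j. ap (T i) x"]) (use i in auto)
      then show "ap (f i * S) x = ap (T i) x" using lin[OF bounded_linear_ap] by (simp add: S)
    qed
  next
    fix B assume B: "\<And>i. i \<in> I \<Longrightarrow> B * T i = 0"
    show "B * S = 0"
    proof (rule op_eqI)
      fix x
      have "ap B (ap (T i) x) = 0" if "i \<in> I" for i using B[OF that] by (metis ap_simps(1,7))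
      then have "((\<lambda>i. ap B (ap (T i) x)) has_sum 0) I" by (intro has_sum_0) auto
      then show "ap (B * S) x = ap 0 x" using lin[OF bounded_linear_ap] by (simp add: S)
    qed
  next
    fix B assume B: "\<And>i. i \<in> I \<Longrightarrow> f i * B = 0"
    show "S * B = 0"
    proof (rule op_eqI)
      fix x
      have "ap (T i) (ap B x) = 0" if "i \<in> I" for i
        using B[OF that] fT(2)[OF that] by (metis ap_simps(1,7) ap_arg_simps(1))
      then have "F (ap B x) = 0" unfolding F_def by (intro infsum_0) auto
      then show "ap (S * B) x = ap 0 x" by (simp add: S)
    qed
  next
    fix R assume R: "\<And>i. i \<in> I \<Longrightarrow> R * T i = T i * R"
    show "R * S = S * R"
    proof (rule op_eqI)
      fix x
      have "ap R (ap (T i) x) = ap (T i) (ap R x)" if "i \<in> I" for i using R[OF that] by (metis ap_simps(7))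
      then have "((\<lambda>i. ap R (ap (T i) x)) has_sum F (ap R x)) I"
        using hs[of "ap R x"] by (simp cong: has_sum_cong)
      then show "ap (R * S) x = ap (S * R) x" using lin[OF bounded_linear_ap] by (simp add: S)
    qed
  qed
qed

section \<open>Von Neumann algebras\<close>

text \<open>Von Neumann algebras of operators, characterised by the two clauses of the definition from
  which the others follow.\<close>

locale vn_algebra =
  fixes A :: "'h::chilbert_space op set"
  assumes adj_closed: "T \<in> A \<Longrightarrow> adj T \<in> A"
    and bicommutant: "(\<And>S. (\<And>T. T \<in> A \<Longrightarrow> S * T = T * S) \<Longrightarrow> S * X = X * S) \<Longrightarrow> X \<in> A"
begin

lemma closed_0: "0 \<in> A" and closed_1: "1 \<in> A" and closed_imag: "imag_op \<in> A"
  by (rule bicommutant; simp add: imag_op_commute)+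

lemma closed_add: "X \<in> A \<Longrightarrow> Y \<in> A \<Longrightarrow> X + Y \<in> A"
  by (rule bicommutant) (simp add: distrib_left distrib_right)

lemma closed_diff: "X \<in> A \<Longrightarrow> Y \<in> A \<Longrightarrow> X - Y \<in> A"
  by (rule bicommutant) (simp add: left_diff_distrib right_diff_distrib)

lemma closed_minus: "X \<in> A \<Longrightarrow> - X \<in> A"
  by (rule bicommutant) simp

lemma closed_mult: "X \<in> A \<Longrightarrow> Y \<in> A \<Longrightarrow> X * Y \<in> A"
  by (rule bicommutant) (metis mult.assoc)

lemma closed_scaleR: "X \<in> A \<Longrightarrow> r *\<^sub>R X \<in> A"
  by (rule bicommutant) simp

lemma closed_sum: "(\<And>i. i \<in> S \<Longrightarrow> f i \<in> A) \<Longrightarrow> sum f S \<in> A"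
  by (rule bicommutant) (simp add: sum_distrib_left sum_distrib_right)

lemmas closed = closed_0 closed_1 closed_imag closed_add closed_diff closed_minus closed_mult
  closed_scaleR closed_sum adj_closed

lemma closed_spectral_cut:
  assumes "H \<in> A" "\<And>S. S * H = H * S \<Longrightarrow> S * F = F * S"
  shows "F \<in> A"
  by (rule bicommutant) (use assms in blast)

end

lemma adj_inverse:
  fixes X Y :: "'h::chilbert_space op"
  assumes "X * Y = 1" "Y * X = 1" "adj X = X"
  shows "adj Y = Y"
proof -
  have "adj Y * X = 1" using arg_cong[OF assms(1), of adj] assms(3) by simp
  then show ?thesis using assms(1) by (metis mult.assoc mult.left_neutral mult.right_neutral)
qed

text \<open>The adjoint of \<open>v * (1 - e)\<close> times itself is (1 - e) e (1 - e) = 0, so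
  \<open>v\<close> vanishes off \<open>e\<close>.\<close>

lemma partial_isometry_eq:
  fixes v :: "'h::chilbert_space op"
  assumes "adj v * v = e" "proj e"
  shows "v * e = v" "proj (v * adj v)"
proof -
  have "adj (v * (1 - e)) * (v * (1 - e)) = (1 - e) * (adj v * v) * (1 - e)"
    using assms(2) by (simp add: mult.assoc)
  also have "\<dots> = 0" using assms by (simp add: left_diff_distrib)
  finally have "v * (1 - e) = 0" by (simp only: adj_mult_self_eq_0)
  then show *: "v * e = v" by (simp add: right_diff_distrib)
  have "v * adj v * (v * adj v) = v * e * adj v" by (simp add: mult.assoc flip: assms(1))
  then show "proj (v * adj v)" using * by (intro projI) auto
qed

context vn_algebra
begin

text \<open>A substitute for the polar decomposition: \<open>v = y g k\<close> with \<open>g\<close> a spectral projection of \<open>y\<^sup>*y\<close> away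
  from \<open>0\<close> and \<open>k\<close> the inverse square root of \<open>y\<^sup>*y\<close> on the range of \<open>g\<close>.\<close>

lemma partial_isometry_exists:
  assumes y: "y \<in> A" "y \<noteq> 0"
  obtains v where "v \<in> A" "v \<noteq> 0" "proj (adj v * v)"
    "\<And>q. adj q = q \<Longrightarrow> y * q = y \<Longrightarrow> v * q = v" "\<And>p. p * y = y \<Longrightarrow> p * v = v"
proof -
  define z where "z = (1 / norm y) *\<^sub>R y"
  have nz: "norm z = 1" using y(2) by (simp add: z_def)
  have zA: "z \<in> A" using y(1) by (simp add: z_def closed)
  have "z \<noteq> 0" using nz by auto
  then obtain x0 where x0: "ap z x0 \<noteq> 0" using op_eqI[of z 0] by auto
  then have x00: "x0 \<noteq> 0" by auto
  have zle: "norm (ap z x) \<le> norm x" for x using norm_ap[of z x] nz by simp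
  \<comment> \<open>Half the Rayleigh quotient of \<open>adj z * z\<close> at \<open>x0\<close>: low
    enough for the part of \<open>h\<close> above \<open>d\<close> to be nonzero, and positive, so
    that \<open>h\<close> is invertible on that part.\<close>
  define d where "d = (norm (ap z x0))\<^sup>2 / (2 * (norm x0)\<^sup>2)"
  have d0: "d > 0" using x0 x00 by (simp add: d_def)
  have "(norm (ap z x0))\<^sup>2 \<le> (norm x0)\<^sup>2" using zle by (intro power_mono) auto
  then have d1: "d \<le> 1/2" using x00 by (simp add: d_def field_simps)
  define h where "h = adj z * z"
  have ah: "adj h = h" and hA: "h \<in> A" using zA by (auto simp: h_def closed)
  have riph: "rip (ap h x) x = (norm (ap z x))\<^sup>2" for x by (simp add: h_def norm_ap_sq)
  have adH: "adj (h - d *\<^sub>R 1) = h - d *\<^sub>R 1" by (simp add: ah)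
  obtain F where F: "proj F" "\<And>S. S * (h - d *\<^sub>R 1) = (h - d *\<^sub>R 1) * S \<Longrightarrow> S * F = F * S"
    "\<And>x. rip (ap (h - d *\<^sub>R 1) (ap F x)) (ap F x) \<le> 0"
    "\<And>x. 0 \<le> rip (ap (h - d *\<^sub>R 1) (ap (1 - F) x)) (ap (1 - F) x)"
    using spectral_cut[OF adH] by metis
  define g where "g = 1 - F"
  have pg: "proj g" using F(1) by (simp add: g_def proj_compl)
  have commg: "S * g = g * S" if "S * h = h * S" for S
    using F(2)[of S] that by (simp add: g_def left_diff_distrib right_diff_distrib)
  have "g \<noteq> 0"
  proof
    assume "g = 0"
    then have "F = 1" by (simp add: g_def)
    then have "(norm (ap z x0))\<^sup>2 \<le> d * (norm x0)\<^sup>2"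
      using F(3)[of x0] by (simp add: rip_simps riph rip_self)
    also have "\<dots> = (norm (ap z x0))\<^sup>2 / 2" using x00 by (simp add: d_def)
    finally show False using x0 by simp
  qed
  have gh: "g * h = h * g" using commg[of h] by simp
  have lower: "d * (norm (ap g x))\<^sup>2 \<le> (norm (ap z (ap g x)))\<^sup>2" for x
  proof -
    have "0 \<le> rip (ap h (ap g x) - d *\<^sub>R ap g x) (ap g x)" using F(4)[of x, folded g_def] by (simp only: ap_simps)
    then show ?thesis by (simp add: rip_simps riph rip_self)
  qed
  \<comment> \<open>\<open>1 - y1\<close> is \<open>h\<close> on the range of \<open>g\<close> and 1
    off it. It is bounded away from 0, so its inverse square root exists; \<open>t\<close> below is
    that, as root times inverse.\<close>
  define y1 where "y1 = (1 - h) * g"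
  have ay1: "adj y1 = y1" using ah pg gh by (simp add: y1_def left_diff_distrib right_diff_distrib)
  have y1g: "y1 = g * (1 - h) * g"
    using gh pg by (simp add: y1_def left_diff_distrib right_diff_distrib mult.assoc proj_idem_left)
  have "norm y1 \<le> 1 - d"
  proof (rule norm_le_of_quadratic_form[OF ay1])
    fix x
    have "rip (ap y1 x) x = rip (ap (1 - h) (ap g x)) (ap g x)"
      unfolding y1g using pg by (simp add: rip_ap del: ap_arg_simps)
    also have "\<dots> = (norm (ap g x))\<^sup>2 - (norm (ap z (ap g x)))\<^sup>2"
      by (simp add: rip_simps riph rip_self)
    finally have eq: "rip (ap y1 x) x = (norm (ap g x))\<^sup>2 - (norm (ap z (ap g x)))\<^sup>2" .
    have "(norm (ap z (ap g x)))\<^sup>2 \<le> (norm (ap g x))\<^sup>2" using zle by (intro power_mono) auto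
    then have "\<bar>rip (ap y1 x) x\<bar> \<le> (1 - d) * (norm (ap g x))\<^sup>2"
      using eq lower[of x] by (simp add: left_diff_distrib)
    also have "\<dots> \<le> (1 - d) * (norm x)\<^sup>2"
      using d1 norm_ap_proj_le[OF pg, of x] by (intro mult_left_mono power_mono) auto
    finally show "\<bar>rip (ap y1 x) x\<bar> \<le> (1 - d) * (norm x)\<^sup>2" .
  qed (use d1 in simp)
  then have ny1: "norm y1 < 1" using d0 by simp
  then have ny1': "norm y1 \<le> 1" by simp
  obtain w where w: "(1 - y1) * w = 1" "w * (1 - y1) = 1" using neumann_inverse[OF ny1] by metis
  define s where "s = sqrt1m y1"
  define t where "t = s * w"
  have commy1: "S * y1 = y1 * S" if "S * h = h * S" for S
  proof -
    have "S * (1 - h) = (1 - h) * S" using that by (simp add: left_diff_distrib right_diff_distrib)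
    then show ?thesis unfolding y1_def using commg[OF that] by (metis mult.assoc)
  qed
  have comms: "S * s = s * S" if "S * h = h * S" for S
    unfolding s_def by (rule sqrt1m_commute[OF ny1' commy1[OF that]])
  have commw: "S * w = w * S" if "S * h = h * S" for S
    by (rule commute_inverse[OF w]) (use commy1[OF that] in \<open>simp add: left_diff_distrib right_diff_distrib\<close>)
  have commt: "S * t = t * S" if "S * h = h * S" for S
    unfolding t_def using comms[OF that] commw[OF that] by (metis mult.assoc)
  have ws: "w * s = s * w"
    by (rule comms) (use commw[of h] in simp)
  have aw: "adj w = w" by (rule adj_inverse[OF w]) (simp add: ay1)
  have as: "adj s = s" unfolding s_def by (rule adj_sqrt1m[OF ny1' ay1])
  have at: "adj t = t" using aw as ws by (simp add: t_def)
  have ss: "s * s = 1 - y1" unfolding s_def by (rule sqrt1m_square[OF ny1'])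
  have "t * t = s * (w * s) * w" by (simp add: t_def mult.assoc)
  also have "\<dots> = s * s * w * w" by (simp add: ws mult.assoc)
  also have "\<dots> = w" using ss w by simp
  finally have tt: "t * t = w" .
  have gt: "g * t = t * g" by (rule commt[OF gh])
  have ht: "h * t = t * h" by (rule commt) simp
  define v where "v = z * g * t"
  have "adj v * v = t * g * h * g * t" using pg at by (simp add: v_def h_def mult.assoc)
  also have "\<dots> = g * h * g * (t * t)" using gt ht by (metis mult.assoc)
  also have "g * h * g = (1 - y1) * g"
    using gh pg by (simp add: y1_def left_diff_distrib mult.assoc)
  also have "\<dots> = g * (1 - y1)"
    using commy1[OF gh] by (simp add: left_diff_distrib right_diff_distrib)
  also have "g * (1 - y1) * (t * t) = g" using w by (simp add: tt mult.assoc)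
  finally have vv: "adj v * v = g" .
  have gA: "g \<in> A" by (rule closed_spectral_cut[OF hA]) (rule commg)
  have tA: "t \<in> A" by (rule closed_spectral_cut[OF hA]) (rule commt)
  show ?thesis
  proof (rule that[of v])
    show "v \<in> A" using zA gA tA by (simp add: v_def closed)
    show "v \<noteq> 0" using vv \<open>g \<noteq> 0\<close> by auto
    show "proj (adj v * v)" using vv pg by simp
    show "p * v = v" if "p * y = y" for p using that by (simp add: v_def z_def flip: mult.assoc)
    show "v * q = v" if q: "adj q = q" "y * q = y" for q
    proof -
      have zq: "z * q = z" using q(2) by (simp add: z_def)
      have "q * adj z = adj z" using arg_cong[OF zq, of adj] q(1) by simp
      then have "q * h = h" by (simp add: h_def flip: mult.assoc)
      moreover have "h * q = h" using zq by (simp add: h_def mult.assoc)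
      ultimately have qh: "q * h = h * q" by simp
      have "v * q = z * q * g * t" unfolding v_def using commg[OF qh] commt[OF qh] by (metis mult.assoc)
      then show ?thesis using zq by (simp add: v_def)
    qed
  qed
qed

text \<open>The kind of failure that a bisection can follow. It is used once for a violated norm
  bound and once for failing strong cleanness on a central summand.\<close>

definition splits :: "('h op \<Rightarrow> bool) \<Rightarrow> 'h op \<Rightarrow> bool" where
  "splits bad e0 \<longleftrightarrow> (\<forall>e F. e \<in> A \<and> proj e \<and> e0 * e = e \<and> bad e \<and> F \<in> A \<and> proj F \<and> e * F = F * e \<longrightarrow>
      bad (e * F) \<or> bad (e * (1 - F)))"

text \<open>Each stage halves an interval bounding the quadratic form of \<open>H\<close> on the
  range of \<open>e\<close>, and keeps a half on which \<open>bad\<close> survives. The cuts are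
  spectral projections of \<open>H\<close>, so \<open>e\<close> continues to commute with
  \<open>H\<close>.\<close>

lemma spectral_bisection:
  assumes H: "H \<in> A" "adj H = H" and e0: "e0 \<in> A" "proj e0" "e0 * H = H * e0" "bad e0"
    and step: "splits bad e0"
    and eps: "0 < \<epsilon>"
  obtains e l where "e \<in> A" "proj e" "e0 * e = e" "bad e" "norm ((H - l *\<^sub>R 1) * e) \<le> \<epsilon>"
proof -
  define R where "R = norm H + 1"
  have R: "R > 0" by (simp add: R_def add_nonneg_pos)
  have "\<exists>e a. e \<in> A \<and> proj e \<and> e0 * e = e \<and> e * H = H * e \<and> bad e \<and>
      (\<forall>x. a * (norm (ap e x))\<^sup>2 \<le> rip (ap H (ap e x)) (ap e x) \<and>
        rip (ap H (ap e x)) (ap e x) \<le> (a + 2 * R / 2 ^ n) * (norm (ap e x))\<^sup>2)" for n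
  proof (induction n)
    case 0
    have "\<bar>rip (ap H x) x\<bar> \<le> R * (norm x)\<^sup>2" for x
    proof -
      have "\<bar>rip (ap H x) x\<bar> \<le> norm (ap H x) * norm x" by (rule abs_rip_le_norm)
      also have "\<dots> \<le> norm H * norm x * norm x" by (intro mult_right_mono norm_ap) auto
      also have "\<dots> \<le> R * norm x * norm x" by (intro mult_right_mono) (auto simp: R_def)
      finally show ?thesis by (simp add: power2_eq_square mult.assoc)
    qed
    then have "- R * (norm x)\<^sup>2 \<le> rip (ap H x) x \<and> rip (ap H x) x \<le> (- R + 2 * R / 2 ^ 0) * (norm x)\<^sup>2" for x
      by (simp add: abs_le_iff minus_le_iff)
    then show ?case using e0 by (intro exI[of _ e0] exI[of _ "- R"]) auto
  next
    case (Suc n)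
    then obtain e a where e: "e \<in> A" "proj e" "e0 * e = e" "e * H = H * e" "bad e"
      and lo: "\<And>x. a * (norm (ap e x))\<^sup>2 \<le> rip (ap H (ap e x)) (ap e x)"
      and hi: "\<And>x. rip (ap H (ap e x)) (ap e x) \<le> (a + 2 * R / 2 ^ n) * (norm (ap e x))\<^sup>2" by blast
    \<comment> \<open>The midpoint of the current interval, whose length is
      \<open>2 * R / 2 ^ n\<close>.\<close>
    define t where "t = a + 2 * R / 2 ^ Suc n"
    have t2: "t + 2 * R / 2 ^ Suc n = a + 2 * R / 2 ^ n" by (simp add: t_def flip: add_divide_distrib)
    have adH: "adj (H - t *\<^sub>R 1) = H - t *\<^sub>R 1" by (simp add: H)
    obtain F where F: "proj F" "\<And>S. S * (H - t *\<^sub>R 1) = (H - t *\<^sub>R 1) * S \<Longrightarrow> S * F = F * S"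
      "\<And>x. rip (ap (H - t *\<^sub>R 1) (ap F x)) (ap F x) \<le> 0"
      "\<And>x. 0 \<le> rip (ap (H - t *\<^sub>R 1) (ap (1 - F) x)) (ap (1 - F) x)"
      using spectral_cut[OF adH] by metis
    have comm: "S * F = F * S" if "S * H = H * S" for S
      using F(2)[of S] that by (simp add: left_diff_distrib right_diff_distrib)
    have FA: "F \<in> A" by (rule closed_spectral_cut[OF H(1)]) (rule comm)
    have eF: "e * F = F * e" by (rule comm[OF e(4)])
    have HF: "H * F = F * H" by (rule comm) simp
    have eF': "e * (1 - F) = (1 - F) * e" using eF by (simp add: left_diff_distrib right_diff_distrib)
    have HF': "H * (1 - F) = (1 - F) * H" using HF by (simp add: left_diff_distrib right_diff_distrib)
    have inv: "e * G \<in> A \<and> proj (e * G) \<and> e0 * (e * G) = e * G \<and> e * G * H = H * (e * G)"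
      if G: "G \<in> A" "proj G" "e * G = G * e" "H * G = G * H" for G
    proof (intro conjI)
      show "e * G \<in> A" using e(1) G(1) by (rule closed_mult)
      show "proj (e * G)" by (rule proj_mult_commute[OF e(2) G(2,3)])
      show "e0 * (e * G) = e * G" using e(3) by (simp flip: mult.assoc)
      show "e * G * H = H * (e * G)" using e(4) G(4) by (metis mult.assoc)
    qed
    consider "bad (e * F)" | "bad (e * (1 - F))" using step e FA F(1) eF unfolding splits_def by blast
    then show ?case
    proof cases
      case 1
      have "rip (ap H (ap (e * F) x)) (ap (e * F) x) \<le> t * (norm (ap (e * F) x))\<^sup>2" for x
      proof -
        have "rip (ap H (ap (F * e) x) - t *\<^sub>R ap (F * e) x) (ap (F * e) x) \<le> 0"
          using F(3)[of "ap e x"] by (simp only: ap_simps)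
        then show ?thesis unfolding eF by (simp add: rip_simps rip_self)
      qed
      moreover have "a * (norm (ap (e * F) x))\<^sup>2 \<le> rip (ap H (ap (e * F) x)) (ap (e * F) x)" for x
        using lo[of "ap F x"] by simp
      ultimately show ?thesis using inv[OF FA F(1) eF HF] 1
        by (intro exI[of _ "e * F"] exI[of _ a]) (auto simp: t_def)
    next
      case 2
      have "t * (norm (ap (e * (1 - F)) x))\<^sup>2 \<le> rip (ap H (ap (e * (1 - F)) x)) (ap (e * (1 - F)) x)" for x
      proof -
        have "0 \<le> rip (ap H (ap ((1 - F) * e) x) - t *\<^sub>R ap ((1 - F) * e) x) (ap ((1 - F) * e) x)"
          using F(4)[of "ap e x"] by (simp only: ap_simps)
        then show ?thesis unfolding eF' by (simp only: rip_diff_left rip_scaleR_left rip_self diff_ge_0_iff_ge)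
      qed
      moreover have "rip (ap H (ap (e * (1 - F)) x)) (ap (e * (1 - F)) x)
          \<le> (t + 2 * R / 2 ^ Suc n) * (norm (ap (e * (1 - F)) x))\<^sup>2" for x
        unfolding t2 using hi[of "ap (1 - F) x"] by (simp only: ap_simps)
      ultimately show ?thesis using inv[of "1 - F"] FA proj_compl[OF F(1)] eF' HF' 2
        by (intro exI[of _ "e * (1 - F)"] exI[of _ t]) (auto simp: closed)
    qed
  qed
  note main = this
  obtain n where n: "R / \<epsilon> < 2 ^ n" using real_arch_pow[of 2 "R / \<epsilon>"] by auto
  from main[of n] obtain e a where e: "e \<in> A" "proj e" "e0 * e = e" "e * H = H * e" "bad e"
    and lohi: "\<forall>x. a * (norm (ap e x))\<^sup>2 \<le> rip (ap H (ap e x)) (ap e x) \<and>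
        rip (ap H (ap e x)) (ap e x) \<le> (a + 2 * R / 2 ^ n) * (norm (ap e x))\<^sup>2"
    by (elim exE conjE) (rule that)
  have lo: "a * (norm (ap e x))\<^sup>2 \<le> rip (ap H (ap e x)) (ap e x)"
    and hi: "rip (ap H (ap e x)) (ap e x) \<le> (a + 2 * R / 2 ^ n) * (norm (ap e x))\<^sup>2" for x
    using lohi by simp_all
  \<comment> \<open>Half the length of the last interval; \<open>a + r\<close> is its centre and
    becomes the scalar \<open>l\<close>.\<close>
  define r where "r = R / 2 ^ n"
  have "R < \<epsilon> * 2 ^ n" using n eps by (simp add: pos_divide_less_eq mult.commute)
  then have r: "0 < r" "r \<le> \<epsilon>" using R by (simp_all add: r_def pos_divide_le_eq)
  have comm: "(H - (a + r) *\<^sub>R 1) * e = e * (H - (a + r) *\<^sub>R 1)"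
    using e(4) by (simp add: left_diff_distrib right_diff_distrib)
  have "norm ((H - (a + r) *\<^sub>R 1) * e) \<le> r"
  proof (rule norm_le_of_quadratic_form)
    show "adj ((H - (a + r) *\<^sub>R 1) * e) = (H - (a + r) *\<^sub>R 1) * e"
      using e(2) H(2) comm by simp
    fix x
    have "(H - (a + r) *\<^sub>R 1) * e = e * ((H - (a + r) *\<^sub>R 1) * e)"
      by (metis comm e(2) mult.assoc proj_idem)
    then have "rip (ap ((H - (a + r) *\<^sub>R 1) * e) x) x = rip (ap (e * ((H - (a + r) *\<^sub>R 1) * e)) x) x" by simp
    also have "\<dots> = rip (ap (H - (a + r) *\<^sub>R 1) (ap e x)) (ap e x)"
      using e(2) by (simp only: ap_simps(7) rip_ap proj_adj)
    also have "\<dots> = rip (ap H (ap e x)) (ap e x) - (a + r) * (norm (ap e x))\<^sup>2"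
      by (simp add: rip_simps rip_self)
    finally have "\<bar>rip (ap ((H - (a + r) *\<^sub>R 1) * e) x) x\<bar> \<le> r * (norm (ap e x))\<^sup>2"
      using lo[of x] hi[of x] by (simp add: r_def abs_le_iff distrib_right flip: add_divide_distrib)
    also have "\<dots> \<le> r * (norm x)\<^sup>2"
      using r norm_ap_proj_le[OF e(2), of x] by (intro mult_left_mono power_mono) auto
    finally show "\<bar>rip (ap ((H - (a + r) *\<^sub>R 1) * e) x) x\<bar> \<le> r * (norm x)\<^sup>2" .
  qed (use r in simp)
  then show ?thesis using that[of e "a + r"] e r by simp
qed

end

section \<open>Abelian projections\<close>

definition abelian_proj :: "'h::chilbert_space op set \<Rightarrow> 'h op \<Rightarrow> bool" where
  "abelian_proj A e \<longleftrightarrow> e \<in> A \<and> proj e \<and>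
     (\<forall>S\<in>A. \<forall>T\<in>A. under S e \<longrightarrow> under T e \<longrightarrow> S * T = T * S)"

text \<open>On orthogonal blocks commuting with \<open>D\<close> norms combine by maximum and not by
  sum. Hence a bound violated on the whole is violated, with the same constant, on one of two
  pieces.\<close>

lemma norm_orthogonal_blocks_le:
  fixes p q D :: "'h::chilbert_space op"
  assumes p: "proj p" and q: "proj q" and pq: "p * q = 0"
    and D: "p * D = D * p" "q * D = D * q"
    and n: "norm (p * D) \<le> c" "norm (q * D) \<le> c"
  shows "norm ((p + q) * D) \<le> c"
proof (rule norm_op_bound)
  show c: "0 \<le> c" using n(1) norm_ge_zero order_trans by blast
  fix x
  have qp: "q * p = 0" using arg_cong[OF pq, of adj] p q by simp
  have pq': "proj (p + q)" by (rule projI) (use p q pq qp in \<open>simp_all add: distrib_left distrib_right\<close>)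
  have orth: "(norm (ap (p + q) z))\<^sup>2 = (norm (ap p z))\<^sup>2 + (norm (ap q z))\<^sup>2" for z
    unfolding norm_ap_proj_sq[OF p] norm_ap_proj_sq[OF q] norm_ap_proj_sq[OF pq'] by (simp add: rip_simps)
  have bd: "norm (ap r (ap D x)) \<le> c * norm (ap r x)" if "proj r" "r * D = D * r" "norm (r * D) \<le> c" for r
  proof -
    have "r * D = r * D * r" using that by (metis mult.assoc proj_idem)
    then have "norm (ap r (ap D x)) = norm (ap (r * D) (ap r x))" by (metis ap_simps(7))
    also have "\<dots> \<le> norm (r * D) * norm (ap r x)" by (rule norm_ap)
    also have "\<dots> \<le> c * norm (ap r x)" using that(3) by (rule mult_right_mono) simp
    finally show ?thesis .
  qed
  have "(norm (ap ((p + q) * D) x))\<^sup>2 = (norm (ap p (ap D x)))\<^sup>2 + (norm (ap q (ap D x)))\<^sup>2"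
    using orth[of "ap D x"] by (simp only: ap_simps(7))
  also have "\<dots> \<le> (c * norm (ap p x))\<^sup>2 + (c * norm (ap q x))\<^sup>2"
    using bd[OF p D(1) n(1)] bd[OF q D(2) n(2)] by (intro add_mono power_mono) auto
  also have "\<dots> = c\<^sup>2 * (norm (ap (p + q) x))\<^sup>2" unfolding orth by (simp add: power_mult_distrib distrib_left)
  also have "\<dots> \<le> c\<^sup>2 * (norm x)\<^sup>2" by (intro mult_left_mono power_mono norm_ap_proj_le pq') auto
  finally have "(norm (ap ((p + q) * D) x))\<^sup>2 \<le> (c * norm x)\<^sup>2" by (simp only: power_mult_distrib)
  then show "norm (ap ((p + q) * D) x) \<le> c * norm x" by (rule power2_le_imp_le) (use c in simp)
qed

lemma imag_op_sq_left [simp]: "imag_op * (imag_op * T) = - T"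
  by (simp flip: mult.assoc)

definition re_part :: "'h::chilbert_space op \<Rightarrow> 'h op" where
  "re_part T = (1/2) *\<^sub>R (T + adj T)"

definition im_part :: "'h::chilbert_space op \<Rightarrow> 'h op" where
  "im_part T = - (1/2) *\<^sub>R (imag_op * (T - adj T))"

lemma re_im_decomposition: "T = re_part T + imag_op * im_part T"
proof -
  have "imag_op * im_part T = (1/2) *\<^sub>R (T - adj T)" by (simp add: im_part_def scaleR_right_diff_distrib)
  also have "re_part T + \<dots> = (1/2) *\<^sub>R (2 *\<^sub>R T)"
    unfolding re_part_def by (simp only: scaleR_add_right [symmetric] scaleR_2) simp
  finally show ?thesis by simp
qed

lemma adj_re_part [simp]: "adj (re_part T) = re_part T"
  by (simp add: re_part_def add.commute)

lemma adj_im_part [simp]: "adj (im_part T) = im_part T"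
proof -
  have "adj (imag_op * (T - adj T)) = imag_op * (T - adj T)"
    using imag_op_commute[of T] imag_op_commute[of "adj T"] by (simp add: left_diff_distrib right_diff_distrib)
  then show ?thesis unfolding im_part_def by (simp only: adj_simps)
qed

lemma under_adj: "adj e = e \<Longrightarrow> under T e \<Longrightarrow> under (adj T) e"
  unfolding under_def by (metis adj_mult)

lemma under_re_part: "adj e = e \<Longrightarrow> under T e \<Longrightarrow> under (re_part T) e"
  using under_adj[of e T] by (simp add: under_def re_part_def distrib_left distrib_right)

lemma under_im_part: "adj e = e \<Longrightarrow> under T e \<Longrightarrow> under (im_part T) e"
proof -
  assume e: "adj e = e" and T: "under T e"
  have u: "under (T - adj T) e"
    using under_adj[OF e T] T by (simp add: under_def left_diff_distrib right_diff_distrib)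
  have "e * (imag_op * (T - adj T)) = imag_op * (e * (T - adj T))"
    using imag_op_commute[of e] by (simp flip: mult.assoc)
  then show ?thesis using u unfolding under_def im_part_def by (simp add: mult.assoc)
qed

context vn_algebra
begin

lemma closed_re_part: "T \<in> A \<Longrightarrow> re_part T \<in> A"
  unfolding re_part_def by (intro closed)

lemma closed_im_part: "T \<in> A \<Longrightarrow> im_part T \<in> A"
  unfolding im_part_def by (intro closed)

text \<open>The criterion makes every projection under \<open>e\<close> central in the corner. A
  nonzero commutator D of a self-adjoint \<open>H\<close> with \<open>S\<close> then decomposes
  along such projections; bisecting the spectrum of \<open>H\<close> leads to one where D is still
  large although \<open>H\<close> is nearly scalar there, a contradiction.\<close>

lemma abelian_projI:
  assumes e: "e \<in> A" "proj e"
    and c: "\<And>p x. p \<in> A \<Longrightarrow> proj p \<Longrightarrow> e * p = p \<Longrightarrow> x \<in> A \<Longrightarrow> p * x * (e - p) = 0"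
  shows "abelian_proj A e"
proof -
  have pc: "p * S = S * p" if p: "p \<in> A" "proj p" "e * p = p" and S: "S \<in> A" "under S e" for p S
  proof -
    have "p * S * (e - p) = 0" by (rule c[OF p S(1)])
    moreover have "p * S * (e - p) = p * S - p * S * p"
      using S(2) by (simp add: right_diff_distrib under_def mult.assoc)
    ultimately have 1: "p * S = p * S * p" by simp
    have "(e - p) * S * p = adj (p * adj S * (e - p))" using e(2) p(2) by (simp add: mult.assoc)
    also have "p * adj S * (e - p) = 0" by (rule c[OF p adj_closed[OF S(1)]])
    finally have "(e - p) * S * p = 0" by simp
    moreover have "(e - p) * S * p = S * p - p * S * p" using S(2) by (simp add: left_diff_distrib under_def)
    ultimately have "S * p = p * S * p" by simp
    with 1 show ?thesis by (rule trans[OF _ sym])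
  qed
  have sa: "H * S = S * H" if H: "H \<in> A" "adj H = H" "under H e" and S: "S \<in> A" "under S e" for H S
  proof (rule ccontr)
    assume ne: "H * S \<noteq> S * H"
    define D where "D = H * S - S * H"
    have nD: "norm D > 0" using ne by (simp add: D_def)
    have S1: "norm S + 1 > 0" by (simp add: add_nonneg_pos)
    \<comment> \<open>Chosen so that the threshold \<open>c\<close>, which equals
      \<open>k * norm S\<close>, is below \<open>norm D\<close>; the added 1 makes this
      strict.\<close>
    define k where "k = norm D / (norm S + 1)"
    have k: "k > 0" "k * (norm S + 1) = norm D" using nD S1 by (simp_all add: k_def)
    define \<epsilon> where "\<epsilon> = k / 2"
    have eps: "\<epsilon> > 0" using k by (simp add: \<epsilon>_def)
    define c where "c = 2 * \<epsilon> * norm S"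
    have cD: "c < norm D" using k by (simp add: c_def \<epsilon>_def distrib_left)
    define bad where "bad f \<longleftrightarrow> \<not> norm (f * D) \<le> c" for f
    have eD: "e * D = D" using H(3) S(2) by (simp add: D_def under_def right_diff_distrib flip: mult.assoc)
    have fD: "f * D = D * f" if f: "f \<in> A" "proj f" "e * f = f" for f
    proof -
      have "f * H = H * f" "f * S = S * f" using pc f H S by blast+
      then have "f * (H * S) = H * S * f" "f * (S * H) = S * H * f" by (metis mult.assoc)+
      then show ?thesis by (simp add: D_def left_diff_distrib right_diff_distrib)
    qed
    have step0: "bad (f * F) \<or> bad (f * (1 - F))"
      if f: "f \<in> A" "proj f" "e * f = f" "bad f" and F: "F \<in> A" "proj F" "f * F = F * f" for f F
    proof (rule ccontr)
      assume "\<not> (bad (f * F) \<or> bad (f * (1 - F)))"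
      then have good: "norm (f * F * D) \<le> c" "norm (f * (1 - F) * D) \<le> c" by (auto simp: bad_def)
      have F': "1 - F \<in> A" "proj (1 - F)" "f * (1 - F) = (1 - F) * f"
        using F proj_compl by (auto simp: closed left_diff_distrib right_diff_distrib)
      have 1: "f * F \<in> A" "proj (f * F)" "e * (f * F) = f * F"
        using f(1,3) F(1) proj_mult_commute[OF f(2) F(2,3)] by (simp_all add: closed flip: mult.assoc)
      have 2: "f * (1 - F) \<in> A" "proj (f * (1 - F))" "e * (f * (1 - F)) = f * (1 - F)"
        using f(1,3) F'(1) proj_mult_commute[OF f(2) F'(2,3)] by (simp_all add: closed flip: mult.assoc)
      have "f * F * (f * (1 - F)) = f * f * (F * (1 - F))" using F(3) by (metis mult.assoc)
      also have "F * (1 - F) = 0" using F(2) by (simp add: right_diff_distrib)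
      finally have "norm ((f * F + f * (1 - F)) * D) \<le> c"
        by (intro norm_orthogonal_blocks_le 1 2 fD good) simp
      moreover have "f * F + f * (1 - F) = f" by (simp add: right_diff_distrib)
      ultimately show False using f(4) by (simp add: bad_def)
    qed
    then have step: "splits bad e" by (simp add: splits_def)
    have "bad e" using cD eD by (simp add: bad_def)
    moreover have "e * H = H * e" using H(3) by (simp add: under_def)
    ultimately obtain f l where f: "f \<in> A" "proj f" "e * f = f" "bad f" "norm ((H - l *\<^sub>R 1) * f) \<le> \<epsilon>"
      using spectral_bisection[OF H(1,2) e _ _ step eps] by metis
    have fH: "f * H = H * f" and fS: "f * S = S * f" using pc f H S by blast+
    have "((H - l *\<^sub>R 1) * f) * S = f * (H * S) - l *\<^sub>R (f * S)"
      using fH by (simp add: left_diff_distrib flip: mult.assoc)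
    moreover have "S * ((H - l *\<^sub>R 1) * f) = f * (S * H) - l *\<^sub>R (f * S)"
    proof -
      have "S * (H * f) = f * (S * H)" using fH fS by (metis mult.assoc)
      then show ?thesis using fS by (simp add: left_diff_distrib right_diff_distrib)
    qed
    \<comment> \<open>The scalar \<open>l\<close> drops out of the commutator, so only the small
      operator \<open>(H - l *\<^sub>R 1) * f\<close> contributes.\<close>
    ultimately have "f * D = ((H - l *\<^sub>R 1) * f) * S - S * ((H - l *\<^sub>R 1) * f)"
      by (simp add: D_def right_diff_distrib)
    then have "norm (f * D) \<le> norm (((H - l *\<^sub>R 1) * f) * S) + norm (S * ((H - l *\<^sub>R 1) * f))"
      by (simp only: norm_triangle_ineq4)
    also have "\<dots> \<le> \<epsilon> * norm S + norm S * \<epsilon>"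
      by (rule add_mono[OF order_trans[OF norm_mult_ineq mult_right_mono[OF f(5) norm_ge_zero]]
            order_trans[OF norm_mult_ineq mult_left_mono[OF f(5) norm_ge_zero]]])
    finally show False using f(4) by (simp add: bad_def c_def)
  qed
  have "S * T = T * S" if S: "S \<in> A" "under S e" and T: "T \<in> A" "under T e" for S T
  proof -
    have "re_part T * S = S * re_part T" "im_part T * S = S * im_part T"
      using sa S T e by (simp_all add: closed_re_part closed_im_part under_re_part under_im_part)
    then have "(re_part T + imag_op * im_part T) * S = S * (re_part T + imag_op * im_part T)"
      using imag_op_commute[of S] by (simp add: distrib_left distrib_right) (metis mult.assoc)
    then show ?thesis using re_im_decomposition[of T] by simp
  qed
  then show ?thesis using e by (simp add: abelian_proj_def)
qed

text \<open>A nonzero p x (e - p) yields a partial isometry from under e - p into p. Its square is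
  0, so \<open>e\<close> contains two orthogonal equivalent nonzero projections.\<close>

lemma nonabelian_partial_isometry:
  assumes e: "e \<in> A" "proj e" "\<not> abelian_proj A e"
  obtains v where "v \<in> A" "adj v * v \<noteq> 0" "proj (adj v * v)" "e * (adj v * v) = adj v * v" "e * v = v" "v * v = 0"
proof -
  obtain p x where p: "p \<in> A" "proj p" "e * p = p" "x \<in> A" "p * x * (e - p) \<noteq> 0"
    using abelian_projI[OF e(1,2)] e(3) by blast
  have up: "under p e" using p e proj_under_iff by blast
  then have pe: "p * e = p" by (simp add: under_def)
  have "p * x * (e - p) \<in> A" using p e by (simp add: closed)
  from partial_isometry_exists[OF this p(5)] obtain v where v: "v \<in> A" "v \<noteq> 0" "proj (adj v * v)"
    "\<And>q. adj q = q \<Longrightarrow> p * x * (e - p) * q = p * x * (e - p) \<Longrightarrow> v * q = v"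
    "\<And>q. q * (p * x * (e - p)) = p * x * (e - p) \<Longrightarrow> q * v = v" by metis
  have pv: "p * v = v" using p(2) by (intro v(5)) (simp add: proj_idem_left mult.assoc)
  have ep: "proj (e - p)" using proj_diff e(2) p(2) up by blast
  have vq: "v * (e - p) = v"
    by (rule v(4)) (rule proj_adj[OF ep], simp only: mult.assoc proj_idem[OF ep])
  show ?thesis
  proof (rule that[of v])
    show "adj v * v \<noteq> 0" using v(2) by (simp add: adj_mult_self_eq_0)
    show "e * v = v" using pv p(3) by (metis mult.assoc)
    have "v * e = v"
    proof -
      have "(e - p) * e = e - p" using e(2) pe by (simp add: left_diff_distrib)
      then show ?thesis using vq by (metis mult.assoc)
    qed
    then have "e * adj v = adj v" using e(2) by (metis adj_mult proj_adj)
    then show "e * (adj v * v) = adj v * v" by (simp flip: mult.assoc)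
    have "(e - p) * p = 0" using p by (simp add: left_diff_distrib)
    then show "v * v = 0" using vq pv by (metis mult.assoc mult_zero_left mult_zero_right)
  qed (use v in auto)
qed

text \<open>One bisection for each operator, inside the projection left by the previous one; earlier
  bounds survive multiplication by a smaller projection. As \<open>E\<close> is abelian, this
  projection commutes with the next operator, which the bisection requires.\<close>

lemma simultaneous_approximation:
  assumes E: "abelian_proj A E" and fin: "finite \<H>"
    and \<H>: "\<And>H. H \<in> \<H> \<Longrightarrow> H \<in> A \<and> adj H = H \<and> under H E"
    and e0: "e0 \<in> A" "proj e0" "E * e0 = e0" "bad e0"
    and step: "splits bad E"
    and eps: "0 < \<epsilon>"
  shows "\<exists>e l. e \<in> A \<and> proj e \<and> e0 * e = e \<and> bad e \<and> (\<forall>H\<in>\<H>. norm ((H - l H *\<^sub>R 1) * e) \<le> \<epsilon>)"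
  using fin \<H> e0
proof (induction \<H> arbitrary: e0 rule: finite_induct)
  case empty
  then show ?case by (intro exI[of _ e0]) auto
next
  case (insert H \<H>)
  have pE: "proj E" and ab: "\<And>S T. S \<in> A \<Longrightarrow> T \<in> A \<Longrightarrow> under S E \<Longrightarrow> under T E \<Longrightarrow> S * T = T * S"
    using E by (auto simp: abelian_proj_def)
  have H: "H \<in> A" "adj H = H" "under H E" using insert(4)[of H] by auto
  have "under e0 E" using proj_under_iff[OF pE insert(6)] insert(7) by simp
  then have comm: "e0 * H = H * e0" using ab H insert(5) by blast
  have step0: "splits bad e0"
    using step insert(7) unfolding splits_def by (metis mult.assoc)
  obtain e1 l where e1: "e1 \<in> A" "proj e1" "e0 * e1 = e1" "bad e1" "norm ((H - l *\<^sub>R 1) * e1) \<le> \<epsilon>"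
    using spectral_bisection[OF H(1,2) insert(5,6) comm insert(8) step0 eps] by metis
  have "E * e1 = e1" using e1(3) insert(7) by (metis mult.assoc)
  then obtain e l' where e: "e \<in> A" "proj e" "e1 * e = e" "bad e" "\<And>H. H \<in> \<H> \<Longrightarrow> norm ((H - l' H *\<^sub>R 1) * e) \<le> \<epsilon>"
    using insert(3)[of e1] insert(4) e1 by blast
  have "norm ((H - l *\<^sub>R 1) * e) = norm ((H - l *\<^sub>R 1) * e1 * e)" using e(3) by (simp add: mult.assoc)
  also have "\<dots> \<le> norm ((H - l *\<^sub>R 1) * e1) * norm e" by (rule norm_mult_ineq)
  also have "\<dots> \<le> \<epsilon> * 1" using e1(5) norm_proj_le[OF e(2)] eps by (intro mult_mono) auto
  finally have nH: "norm ((H - l *\<^sub>R 1) * e) \<le> \<epsilon>" by simp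
  have "e0 * e = e" using e(3) e1(3) by (metis mult.assoc)
  then show ?case
    using e nH insert(2) by (intro exI[of _ e] exI[of _ "l'(H := l)"]) auto
qed

text \<open>The scalars \<open>l\<close> must not depend on \<epsilon>, because the size of the
  neighbourhood used later depends on the scalar matrix they form. With nested projections and
  tolerance (1/2)^n, two approximating scalars compared on a common nonzero projection differ by at
  most the sum of their tolerances, so they converge.\<close>

lemma simultaneous_limit:
  assumes E: "abelian_proj A E" and fin: "finite \<H>"
    and \<H>: "\<And>H. H \<in> \<H> \<Longrightarrow> H \<in> A \<and> adj H = H \<and> under H E"
    and badE: "bad E" and bad0: "\<not> bad 0"
    and step: "splits bad E"
  shows "\<exists>l. \<forall>\<epsilon>>0. \<exists>e\<in>A. proj e \<and> E * e = e \<and> bad e \<and> (\<forall>H\<in>\<H>. norm ((H - l H *\<^sub>R 1) * e) \<le> \<epsilon>)"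
proof -
  have EA: "E \<in> A" "proj E" using E by (auto simp: abelian_proj_def)
  define P where "P n x \<longleftrightarrow> fst x \<in> A \<and> proj (fst x) \<and> E * fst x = fst x \<and> bad (fst x) \<and>
     (\<forall>H\<in>\<H>. norm ((H - snd x H *\<^sub>R 1) * fst x) \<le> (1/2)^n)" for n :: nat and x :: "'h op \<times> ('h op \<Rightarrow> real)"
  have "\<exists>x. P 0 x"
    using simultaneous_approximation[OF E fin \<H> EA _ badE step, of 1] EA(2) by (auto simp: P_def)
  moreover have "\<exists>y. P (Suc n) y \<and> fst x * fst y = fst y" if x: "P n x" for n x
  proof -
    have x': "fst x \<in> A" "proj (fst x)" "E * fst x = fst x" "bad (fst x)" using x by (auto simp: P_def)
    obtain e l where e: "e \<in> A" "proj e" "fst x * e = e" "bad e" "\<forall>H\<in>\<H>. norm ((H - l H *\<^sub>R 1) * e) \<le> (1/2) ^ Suc n"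
      using simultaneous_approximation[OF E fin \<H> x' step, of "(1/2) ^ Suc n"] by auto
    moreover have "E * e = e" using e(3) x'(3) by (metis mult.assoc)
    ultimately show ?thesis by (intro exI[of _ "(e, l)"]) (simp add: P_def)
  qed
  ultimately obtain s where "\<forall>n. P n (s n) \<and> fst (s n) * fst (s (Suc n)) = fst (s (Suc n))"
    using dependent_nat_choice[of P "\<lambda>_ x y. fst x * fst y = fst y"] by blast
  then have s: "P n (s n)" "fst (s n) * fst (s (Suc n)) = fst (s (Suc n))" for n by auto
  define e where "e n = fst (s n)" for n
  define l where "l n = snd (s n)" for n
  have e: "e n \<in> A" "proj (e n)" "E * e n = e n" "bad (e n)" for n using s(1)[of n] by (auto simp: P_def e_def)
  have nl: "norm ((H - l n H *\<^sub>R 1) * e n) \<le> (1/2)^n" if "H \<in> \<H>" for H n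
    using s(1)[of n] that by (auto simp: P_def e_def l_def)
  have mono: "e m * e n = e n" if "m \<le> n" for m n
    using that
  proof (induction n rule: dec_induct)
    case base
    show ?case using e(2) by simp
  next
    case (step n)
    then show ?case using s(2)[of n] unfolding e_def[symmetric] by (metis mult.assoc)
  qed
  \<comment> \<open>Since \<open>bad 0\<close> fails, \<open>e n\<close> is nonzero; norm 1 is what
    turns bounds for operators into bounds for scalars.\<close>
  have ne: "norm (e n) = 1" for n
  proof -
    have "e n \<noteq> 0" using e(4)[of n] bad0 by auto
    moreover have "norm (e n) \<le> norm (e n) * norm (e n)" using norm_mult_ineq[of "e n" "e n"] e(2) by simp
    ultimately have "1 \<le> norm (e n)" by simp
    then show ?thesis using norm_proj_le[OF e(2)[of n]] by simp
  qed
  have close: "\<bar>l m H - l n H\<bar> \<le> 2 * (1/2)^m" if "H \<in> \<H>" "m \<le> n" for m n H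
  proof -
    have "(l m H - l n H) *\<^sub>R e n = (H - l n H *\<^sub>R 1) * e n - (H - l m H *\<^sub>R 1) * e m * e n"
      using mono[OF that(2)] by (simp add: left_diff_distrib scaleR_left_diff_distrib mult.assoc)
    then have "\<bar>l m H - l n H\<bar> * norm (e n) \<le> norm ((H - l n H *\<^sub>R 1) * e n) + norm ((H - l m H *\<^sub>R 1) * e m * e n)"
      by (metis norm_scaleR norm_triangle_ineq4)
    also have "norm ((H - l m H *\<^sub>R 1) * e m * e n) \<le> norm ((H - l m H *\<^sub>R 1) * e m) * norm (e n)"
      by (rule norm_mult_ineq)
    also have "norm ((H - l n H *\<^sub>R 1) * e n) + norm ((H - l m H *\<^sub>R 1) * e m) * norm (e n) \<le> (1/2)^n + (1/2)^m"
      unfolding ne mult_1_right by (intro add_mono nl that(1))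
    also have "(1/2::real)^n \<le> (1/2)^m" using that(2) by (intro power_decreasing) auto
    finally show ?thesis by (simp add: ne)
  qed
  have "\<exists>L. \<forall>m. \<bar>l m H - L\<bar> \<le> 2 * (1/2)^m" if H: "H \<in> \<H>" for H
  proof -
    have "Cauchy (\<lambda>n. l n H)"
    proof (rule metric_CauchyI)
      fix r :: real assume "0 < r"
      then obtain M where M: "(1/2::real)^M < r / 4" using real_arch_pow_inv[of "r/4" "1/2"] by auto
      have "dist (l m H) (l n H) < r" if "m \<ge> M" "n \<ge> M" for m n
        using close[OF H that(1)] close[OF H that(2)] M unfolding dist_real_def by linarith
      then show "\<exists>M. \<forall>m\<ge>M. \<forall>n\<ge>M. dist (l m H) (l n H) < r" by blast
    qed
    then obtain L where L: "(\<lambda>n. l n H) \<longlonglongrightarrow> L" using Cauchy_convergent convergent_def by blast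
    have "\<bar>l m H - L\<bar> \<le> 2 * (1/2)^m" for m
      by (rule LIMSEQ_le_const2[of "\<lambda>n. \<bar>l m H - l n H\<bar>"]) (auto intro!: tendsto_intros L exI[of _ m] close[OF H])
    then show ?thesis by blast
  qed
  then obtain L where L: "\<And>H m. H \<in> \<H> \<Longrightarrow> \<bar>l m H - L H\<bar> \<le> 2 * (1/2)^m" by metis
  have "\<exists>e\<in>A. proj e \<and> E * e = e \<and> bad e \<and> (\<forall>H\<in>\<H>. norm ((H - L H *\<^sub>R 1) * e) \<le> \<epsilon>)" if "\<epsilon> > 0" for \<epsilon>
  proof -
    obtain m where m: "(1/2::real)^m < \<epsilon> / 3" using real_arch_pow_inv[of "\<epsilon>/3" "1/2"] \<open>\<epsilon> > 0\<close> by auto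
    have "norm ((H - L H *\<^sub>R 1) * e m) \<le> \<epsilon>" if H: "H \<in> \<H>" for H
    proof -
      have "(H - L H *\<^sub>R 1) * e m = (H - l m H *\<^sub>R 1) * e m + (l m H - L H) *\<^sub>R e m"
        by (simp add: left_diff_distrib scaleR_left_diff_distrib)
      then have "norm ((H - L H *\<^sub>R 1) * e m) \<le> norm ((H - l m H *\<^sub>R 1) * e m) + norm ((l m H - L H) *\<^sub>R e m)"
        by (simp only: norm_triangle_ineq)
      also have "\<dots> \<le> (1/2)^m + 2 * (1/2)^m"
        using nl[OF H, of m] L[OF H, of m] ne by (intro add_mono) auto
      finally show ?thesis using m by simp
    qed
    then show ?thesis using e by blast
  qed
  then show ?thesis by blast
qed

end

section \<open>Strong cleanness of type I summands\<close>

text \<open>The summand stays inside \<open>A\<close> with \<open>c\<close> as its unit, so that the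
  witnesses of orthogonal summands can simply be added.\<close>

definition strongly_clean_at :: "'h::chilbert_space op set \<Rightarrow> 'h op \<Rightarrow> 'h op \<Rightarrow> bool" where
  "strongly_clean_at A c X \<longleftrightarrow> (\<exists>P\<in>A. \<exists>U\<in>A. \<exists>V\<in>A. P * P = P \<and> c * P = P \<and> c * U = U \<and> c * V = V \<and>
     U * V = c \<and> V * U = c \<and> c * X = U + P \<and> U * P = P * U)"

text \<open>The central summand \<open>f A\<close> consists of the \<open>n \<times> n\<close> matrices over the abelian algebra \<open>e A e\<close>, with matrix
  units \<open>V i * adj (V j)\<close>.\<close>

definition matrix_units :: "'h::chilbert_space op set \<Rightarrow> nat \<Rightarrow> 'h op \<Rightarrow> (nat \<Rightarrow> 'h op) \<Rightarrow> 'h op \<Rightarrow> bool" where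
  "matrix_units A n e V f \<longleftrightarrow> abelian_proj A e \<and> (\<forall>i<n. V i \<in> A) \<and>
     (\<forall>i<n. \<forall>j<n. adj (V i) * V j = (if i = j then e else 0)) \<and>
     (\<Sum>i<n. V i * adj (V i)) = f \<and> (\<forall>x\<in>A. f * x = x * f)"

lemma strongly_clean_at_cong: "c * X = c * Y \<Longrightarrow> strongly_clean_at A c X \<longleftrightarrow> strongly_clean_at A c Y"
  by (simp add: strongly_clean_at_def)

context vn_algebra
begin

lemma strongly_clean_at_0: "strongly_clean_at A 0 X"
  unfolding strongly_clean_at_def by (intro bexI[of _ 0]) (auto simp: closed)

lemma strongly_clean_at_add:
  assumes c: "\<And>x. x \<in> A \<Longrightarrow> c * x = x * c" and d: "\<And>x. x \<in> A \<Longrightarrow> d * x = x * d" and cd: "c * d = 0" "d * c = 0"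
    and X: "strongly_clean_at A c X" "strongly_clean_at A d X"
  shows "strongly_clean_at A (c + d) X"
proof -
  obtain P U V where 1: "P \<in> A" "U \<in> A" "V \<in> A" "P * P = P" "c * P = P" "c * U = U" "c * V = V"
    "U * V = c" "V * U = c" "c * X = U + P" "U * P = P * U"
    using X(1) unfolding strongly_clean_at_def by blast
  obtain P' U' V' where 2: "P' \<in> A" "U' \<in> A" "V' \<in> A" "P' * P' = P'" "d * P' = P'" "d * U' = U'" "d * V' = V'"
    "U' * V' = d" "V' * U' = d" "d * X = U' + P'" "U' * P' = P' * U'"
    using X(2) unfolding strongly_clean_at_def by blast
  have z1: "a * b = 0" if "a \<in> A" "c * a = a" "b \<in> A" "d * b = b" for a b
  proof -
    have "a * c = a" using c[OF that(1)] that(2) by metis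
    then have "a * b = a * (c * d) * b" using that(4) by (metis mult.assoc)
    then show ?thesis using cd(1) by simp
  qed
  have z2: "b * a = 0" if "a \<in> A" "c * a = a" "b \<in> A" "d * b = b" for a b
  proof -
    have "b * d = b" using d[OF that(3)] that(4) by metis
    then have "b * a = b * (d * c) * a" using that(2) by (metis mult.assoc)
    then show ?thesis using cd(2) by simp
  qed
  have z3: "d * a = 0" if "c * a = a" for a using that cd by (metis mult.assoc mult_zero_left)
  have z4: "c * b = 0" if "d * b = b" for b using that cd by (metis mult.assoc mult_zero_left)
  note z = z1[OF 1(1,5) 2(1,5)] z1[OF 1(1,5) 2(2,6)] z1[OF 1(2,6) 2(1,5)] z1[OF 1(2,6) 2(3,7)] z1[OF 1(3,7) 2(2,6)]
    z2[OF 1(1,5) 2(1,5)] z2[OF 1(1,5) 2(2,6)] z2[OF 1(2,6) 2(1,5)] z2[OF 1(2,6) 2(3,7)] z2[OF 1(3,7) 2(2,6)]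
    z3[OF 1(5)] z3[OF 1(6)] z3[OF 1(7)] z4[OF 2(5)] z4[OF 2(6)] z4[OF 2(7)]
  show ?thesis
    unfolding strongly_clean_at_def
  proof (rule bexI[of _ "P + P'"], rule bexI[of _ "U + U'"], rule bexI[of _ "V + V'"], intro conjI)
    show "P + P' \<in> A" "U + U' \<in> A" "V + V' \<in> A" using 1(1-3) 2(1-3) by (simp_all add: closed)
    show "(P + P') * (P + P') = P + P'" "(c + d) * (P + P') = P + P'" "(c + d) * (U + U') = U + U'"
      "(c + d) * (V + V') = V + V'" "(U + U') * (V + V') = c + d" "(V + V') * (U + U') = c + d"
      "(U + U') * (P + P') = (P + P') * (U + U')"
      using 1(4-9) 2(4-9) z by (simp_all add: distrib_left distrib_right 1(11) 2(11))
    show "(c + d) * X = U + U' + (P + P')" using 1(10) 2(10) by (simp add: distrib_right)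
  qed
qed

lemma strongly_clean_at_cut:
  assumes c: "c \<in> A" "\<And>x. x \<in> A \<Longrightarrow> c * x = x * c" "c * c = c" and X: "strongly_clean_at A 1 X"
  shows "strongly_clean_at A c X"
proof -
  obtain P U V where 1: "P \<in> A" "U \<in> A" "V \<in> A" "P * P = P" "U * V = 1" "V * U = 1" "X = U + P" "U * P = P * U"
    using X unfolding strongly_clean_at_def by auto
  have m: "(c * a) * (c * b) = c * (a * b)" if "a \<in> A" for a b
    using c(2)[OF that] c(3) by (metis mult.assoc)
  have cc: "c * (c * a) = c * a" for a using c(3) by (metis mult.assoc)
  show ?thesis
    unfolding strongly_clean_at_def
  proof (rule bexI[of _ "c * P"], rule bexI[of _ "c * U"], rule bexI[of _ "c * V"], intro conjI)
    show "c * P \<in> A" "c * U \<in> A" "c * V \<in> A" using 1(1-3) c(1) by (simp_all add: closed)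
    show "c * P * (c * P) = c * P" unfolding m[OF 1(1)] 1(4) ..
    show "c * U * (c * V) = c" unfolding m[OF 1(2)] 1(5) by simp
    show "c * V * (c * U) = c" unfolding m[OF 1(3)] 1(6) by simp
    show "c * U * (c * P) = c * P * (c * U)" unfolding m[OF 1(1)] m[OF 1(2)] 1(8) ..
    show "c * X = c * U + c * P" using 1(7) by (simp add: distrib_left)
  qed (rule cc)+
qed

text \<open>Idempotent and inverse commute with everything that commutes with \<open>X\<close>; by
  the bicommutant condition they belong to \<open>A\<close>.\<close>

lemma algebraic_nhd_strongly_clean:
  assumes "p \<noteq> 0" "peval p a = 0"
  obtains \<epsilon> where "0 < \<epsilon>" "\<And>X. X \<in> A \<Longrightarrow> norm (X - a) < \<epsilon> \<Longrightarrow> strongly_clean_at A 1 X"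
proof -
  obtain \<epsilon> where e: "0 < \<epsilon>" "\<And>x. norm (x - a) < \<epsilon> \<Longrightarrow> \<exists>P V. P * P = P \<and> (x - P) * V = 1 \<and> V * (x - P) = 1 \<and>
        (\<forall>z. z * x = x * z \<longrightarrow> z * P = P * z \<and> z * V = V * z)"
    using algebraic_element_strongly_clean_nhd[OF assms] by metis
  show ?thesis
  proof (rule that[OF e(1)])
    fix X assume X: "X \<in> A" "norm (X - a) < \<epsilon>"
    obtain P V where P: "P * P = P" "(X - P) * V = 1" "V * (X - P) = 1"
      and comm: "\<And>z. z * X = X * z \<Longrightarrow> z * P = P * z \<and> z * V = V * z" using e(2)[OF X(2)] by blast
    have PV: "P \<in> A" "V \<in> A" by (rule bicommutant, use comm X(1) in blast)+
    have XP: "(X - P) * P = P * (X - P)" using comm[of X] by (simp add: left_diff_distrib right_diff_distrib)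
    show "strongly_clean_at A 1 X"
      unfolding strongly_clean_at_def
      by (rule bexI[of _ P], rule bexI[of _ "X - P"], rule bexI[of _ V])
         (use P PV XP X(1) in \<open>auto simp: closed\<close>)
  qed
qed

lemma under_compress:
  assumes "x * e = x" "y * e = y" "adj e = e"
  shows "under (adj x * t * y) e"
  using assms unfolding under_def by (metis adj_mult mult.assoc)

section \<open>Matrices over an abelian corner\<close>

context
  fixes n e V f
  assumes mu: "matrix_units A n e V f" and n: "1 \<le> n"
begin

lemma mu_e: "e \<in> A" "proj e"
  and mu_V: "\<And>i. i < n \<Longrightarrow> V i \<in> A"
  and mu_orth: "\<And>i j. i < n \<Longrightarrow> j < n \<Longrightarrow> adj (V i) * V j = (if i = j then e else 0)"
  and mu_sum: "f = (\<Sum>i<n. V i * adj (V i))"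
  and mu_central: "\<And>x. x \<in> A \<Longrightarrow> f * x = x * f"
  and mu_comm: "\<And>S T. S \<in> A \<Longrightarrow> T \<in> A \<Longrightarrow> under S e \<Longrightarrow> under T e \<Longrightarrow> S * T = T * S"
  using mu by (auto simp: matrix_units_def abelian_proj_def)

lemma mu_Ve: "i < n \<Longrightarrow> V i * e = V i"
  using partial_isometry_eq(1)[of "V i" e] mu_orth[of i i] mu_e by simp

lemma mu_eV: "i < n \<Longrightarrow> e * adj (V i) = adj (V i)"
  using mu_Ve[of i] mu_e by (metis adj_mult proj_adj)

lemma mu_norm: "i < n \<Longrightarrow> norm (V i) \<le> 1"
proof (rule norm_op_bound)
  fix x assume i: "i < n"
  have "(norm (ap (V i) x))\<^sup>2 = (norm (ap e x))\<^sup>2"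
    using mu_orth[of i i] i mu_e by (simp add: norm_ap_sq norm_ap_proj_sq)
  then show "norm (ap (V i) x) \<le> 1 * norm x" using norm_ap_proj_le[OF mu_e(2), of x] by simp
qed simp

text \<open>The diagonal matrix with \<open>d\<close> in every place. For \<open>d\<close> in the
  abelian corner it is central, so cutting the corner cuts the whole summand.\<close>

definition ampl :: "'h op \<Rightarrow> 'h op" where
  "ampl d = (\<Sum>i<n. V i * d * adj (V i))"

lemma ampl_add: "ampl (c + d) = ampl c + ampl d"
  by (simp add: ampl_def distrib_left distrib_right sum.distrib)

lemma ampl_e: "ampl e = f"
  unfolding ampl_def mu_sum by (rule sum.cong) (auto simp: mu_Ve)

lemma ampl_0: "ampl 0 = 0"
  by (simp add: ampl_def)

lemma ampl_closed: "d \<in> A \<Longrightarrow> ampl d \<in> A"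
  unfolding ampl_def using mu_V by (intro closed) auto

lemma ampl_V:
  assumes "j < n" "d * e = d"
  shows "ampl d * V j = V j * d"
proof -
  have "ampl d * V j = (\<Sum>i<n. V i * d * (adj (V i) * V j))" by (simp add: ampl_def sum_distrib_right mult.assoc)
  also have "\<dots> = (\<Sum>i<n. if i = j then V j * d else 0)"
    using assms mu_orth by (intro sum.cong) (auto simp: mult.assoc)
  finally show ?thesis using assms(1) by simp
qed

lemma ampl_mult: "c * e = c \<Longrightarrow> ampl c * ampl d = ampl (c * d)"
  unfolding ampl_def[of d] sum_distrib_left
  by (subst ampl_def) (auto intro!: sum.cong simp: ampl_V mult.assoc simp flip: mult.assoc[of "ampl c"])

lemma ampl_mult_left:
  assumes d: "d \<in> A" "under d e" and x: "x \<in> A"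
  shows "ampl d * x = (\<Sum>i<n. \<Sum>j<n. V i * (d * (adj (V i) * x * V j)) * adj (V j))"
proof -
  have "ampl d * f = ampl d" using ampl_mult[of d e] d(2) ampl_e by (simp add: under_def)
  then have "ampl d * x = ampl d * x * f" using mu_central[OF x] by (metis mult.assoc)
  then show ?thesis
    by (simp add: ampl_def mu_sum sum_distrib_left sum_distrib_right mult.assoc) (rule sum.swap)
qed

lemma ampl_central:
  assumes d: "d \<in> A" "under d e" and x: "x \<in> A"
  shows "ampl d * x = x * ampl d"
proof -
  have "d * (adj (V i) * x * V j) = adj (V i) * x * V j * d" if "i < n" "j < n" for i j
    using that x mu_V mu_Ve mu_e by (intro mu_comm d under_compress) (auto simp: closed)
  then have "ampl d * x = (\<Sum>i<n. \<Sum>j<n. V i * (adj (V i) * x * V j * d) * adj (V j))"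
    unfolding ampl_mult_left[OF assms] by (intro sum.cong) auto
  also have "\<dots> = f * x * ampl d"
    by (simp add: ampl_def mu_sum sum_distrib_left sum_distrib_right mult.assoc) (rule sum.swap)
  also have "\<dots> = x * (f * ampl d)" using mu_central[OF x] by (simp add: mult.assoc)
  also have "f * ampl d = ampl d" using ampl_mult[of e d] mu_e d(2) by (simp add: ampl_e under_def)
  finally show ?thesis .
qed

text \<open>The products \<open>V a * adj (V b)\<close> and their multiples by i span a
  finite-dimensional real space that is stable under left multiplication by \<open>X0\<close>; this
  is why real polynomials suffice.\<close>

lemma scalar_matrix_algebraic:
  fixes \<alpha> \<beta> :: "nat \<Rightarrow> nat \<Rightarrow> real"
  defines "X0 \<equiv> (\<Sum>a<n. \<Sum>b<n. V a * (\<alpha> a b *\<^sub>R 1 + \<beta> a b *\<^sub>R imag_op) * adj (V b))"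
  obtains p where "p \<noteq> 0" "peval p X0 = 0"
proof -
  define S where "S = (\<lambda>(a, b). V a * adj (V b)) ` ({..<n} \<times> {..<n}) \<union>
     (\<lambda>(a, b). V a * imag_op * adj (V b)) ` ({..<n} \<times> {..<n})"
  have S1: "V a * adj (V b) \<in> span S" and S2: "V a * imag_op * adj (V b) \<in> span S" if "a < n" "b < n" for a b
    using that by (auto simp: S_def intro!: span_base)
  have eq: "V a * (r *\<^sub>R 1 + s *\<^sub>R imag_op) * W = r *\<^sub>R (V a * W) + s *\<^sub>R (V a * imag_op * W)" for a r s W
    by (simp add: distrib_left distrib_right)
  have X0V: "X0 * V c = (\<Sum>a<n. V a * (\<alpha> a c *\<^sub>R 1 + \<beta> a c *\<^sub>R imag_op))" if c: "c < n" for c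
  proof -
    have "X0 * V c = (\<Sum>a<n. \<Sum>b<n. V a * (\<alpha> a b *\<^sub>R 1 + \<beta> a b *\<^sub>R imag_op) * (adj (V b) * V c))"
      by (simp add: X0_def sum_distrib_right mult.assoc)
    also have "\<dots> = (\<Sum>a<n. \<Sum>b<n. if b = c then V a * (\<alpha> a c *\<^sub>R 1 + \<beta> a c *\<^sub>R imag_op) else 0)"
    proof (intro sum.cong refl)
      fix a b assume ab: "a \<in> {..<n}" "b \<in> {..<n}"
      have "(\<alpha> a c *\<^sub>R 1 + \<beta> a c *\<^sub>R imag_op) * e = e * (\<alpha> a c *\<^sub>R 1 + \<beta> a c *\<^sub>R imag_op)"
        using imag_op_commute[of e] by (simp add: distrib_left distrib_right)
      then have "V a * (\<alpha> a c *\<^sub>R 1 + \<beta> a c *\<^sub>R imag_op) * e = V a * (\<alpha> a c *\<^sub>R 1 + \<beta> a c *\<^sub>R imag_op)"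
        using mu_Ve[of a] ab by (metis lessThan_iff mult.assoc)
      then show "V a * (\<alpha> a b *\<^sub>R 1 + \<beta> a b *\<^sub>R imag_op) * (adj (V b) * V c) =
          (if b = c then V a * (\<alpha> a c *\<^sub>R 1 + \<beta> a c *\<^sub>R imag_op) else 0)"
        using ab c by (simp add: mu_orth)
    qed
    finally show ?thesis using c by simp
  qed
  have "finite S" by (simp add: S_def)
  moreover have "X0 \<in> span S"
    unfolding X0_def eq by (intro span_sum span_add span_scale S1 S2) auto
  moreover have "X0 * s \<in> span S" if "s \<in> S" for s
  proof -
    from that consider c d where "c < n" "d < n" "s = V c * adj (V d)"
      | c d where "c < n" "d < n" "s = V c * imag_op * adj (V d)" by (auto simp: S_def)
    then show ?thesis
    proof cases
      case (1 c d)
      have "X0 * s = (\<Sum>a<n. \<alpha> a c *\<^sub>R (V a * adj (V d)) + \<beta> a c *\<^sub>R (V a * imag_op * adj (V d)))"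
        unfolding 1(3) mult.assoc[symmetric] X0V[OF 1(1)] sum_distrib_right eq ..
      also have "\<dots> \<in> span S" using 1 by (intro span_sum span_add span_scale S1 S2) auto
      finally show ?thesis .
    next
      case (2 c d)
      have "X0 * s = X0 * V c * (imag_op * adj (V d))" by (simp add: 2 mult.assoc)
      also have "\<dots> = (\<Sum>a<n. \<alpha> a c *\<^sub>R (V a * imag_op * adj (V d)) + (- \<beta> a c) *\<^sub>R (V a * adj (V d)))"
        unfolding X0V[OF 2(1)] sum_distrib_right eq by (simp add: mult.assoc)
      also have "\<dots> \<in> span S" using 2 by (intro span_sum span_add span_scale S1 S2) auto
      finally show ?thesis .
    qed
  qed
  ultimately show ?thesis using algebraic_element that by blast
qed

text \<open>If the claim failed, it would fail on corners on which the matrix of \<open>X\<close> is arbitrarily close to one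
  fixed scalar matrix; but near a scalar matrix strong cleanness holds.\<close>

lemma strongly_clean_at_type_I:
  assumes X: "X \<in> A"
  shows "strongly_clean_at A f X"
proof (rule ccontr)
  assume not: "\<not> strongly_clean_at A f X"
  define bad where "bad d \<longleftrightarrow> \<not> strongly_clean_at A (ampl d) X" for d
  define M where "M a b = adj (V a) * X * V b" for a b
  \<comment> \<open>Bisection needs self-adjoint operators, hence the real and imaginary parts of
    the entries of the matrix of \<open>X\<close>.\<close>
  define \<H> where "\<H> = (\<lambda>(a, b). re_part (M a b)) ` ({..<n} \<times> {..<n}) \<union> (\<lambda>(a, b). im_part (M a b)) ` ({..<n} \<times> {..<n})"
  have M: "M a b \<in> A" "under (M a b) e" if "a < n" "b < n" for a b
    unfolding M_def using that X mu_V mu_Ve mu_e by (auto intro!: under_compress closed)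
  have ab: "abelian_proj A e" using mu by (simp add: matrix_units_def)
  have ae: "adj e = e" using mu_e by simp
  have \<H>: "H \<in> A \<and> adj H = H \<and> under H e" if "H \<in> \<H>" for H
    using that M ae by (auto simp: \<H>_def closed_re_part closed_im_part under_re_part under_im_part)
  have under_e: "under d e" if "proj d" "e * d = d" for d using proj_under_iff mu_e that by blast
  have step: "splits bad e"
    unfolding splits_def
  proof (intro allI impI)
    fix d F assume d: "d \<in> A \<and> proj d \<and> e * d = d \<and> bad d \<and> F \<in> A \<and> proj F \<and> d * F = F * d"
    define d1 d2 where "d1 = d * F" and "d2 = d * (1 - F)"
    have F': "1 - F \<in> A" "proj (1 - F)" "d * (1 - F) = (1 - F) * d"
      using d proj_compl by (auto simp: closed left_diff_distrib right_diff_distrib)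
    have d1: "d1 \<in> A" "proj d1" "e * d1 = d1"
      using d proj_mult_commute[of d F] unfolding d1_def by (simp add: closed, blast, metis mult.assoc)
    have d2: "d2 \<in> A" "proj d2" "e * d2 = d2"
      using d F' proj_mult_commute[of d "1 - F"] unfolding d2_def by (simp add: closed, blast, metis mult.assoc)
    have "d1 * d2 = d * d * (F * (1 - F))" using d unfolding d1_def d2_def by (metis mult.assoc)
    also have "F * (1 - F) = 0" using d by (simp add: right_diff_distrib)
    finally have 12: "d1 * d2 = 0" by simp
    then have 21: "d2 * d1 = 0" using d1 d2 by (metis adj_mult adj_simps(1) proj_adj)
    have u: "under d1 e" "under d2 e" using under_e d1 d2 by auto
    have "ampl d1 * ampl d2 = 0" "ampl d2 * ampl d1 = 0"
      using u 12 21 by (simp_all add: ampl_mult under_def ampl_0)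
    then have "strongly_clean_at A (ampl d1) X \<Longrightarrow> strongly_clean_at A (ampl d2) X \<Longrightarrow> strongly_clean_at A (ampl d1 + ampl d2) X"
      using d1 d2 u by (intro strongly_clean_at_add ampl_central)
    moreover have "d1 + d2 = d" by (simp add: d1_def d2_def right_diff_distrib)
    then have "ampl d1 + ampl d2 = ampl d" by (simp flip: ampl_add)
    ultimately show "bad (d * F) \<or> bad (d * (1 - F))" using d by (auto simp: bad_def d1_def d2_def)
  qed
  have "bad e" "\<not> bad 0" using not by (simp_all add: bad_def ampl_e ampl_0 strongly_clean_at_0)
  moreover have "finite \<H>" by (simp add: \<H>_def)
  ultimately obtain l where l: "\<And>\<epsilon>. \<epsilon> > 0 \<Longrightarrow> \<exists>d\<in>A. proj d \<and> e * d = d \<and> bad d \<and> (\<forall>H\<in>\<H>. norm ((H - l H *\<^sub>R 1) * d) \<le> \<epsilon>)"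
    using simultaneous_limit[OF ab _ \<H> _ _ step] by blast
  define \<mu> :: "nat \<Rightarrow> nat \<Rightarrow> 'h op" where "\<mu> a b = l (re_part (M a b)) *\<^sub>R 1 + l (im_part (M a b)) *\<^sub>R imag_op" for a b
  define X0 where "X0 = (\<Sum>a<n. \<Sum>b<n. V a * \<mu> a b * adj (V b))"
  obtain p where "p \<noteq> 0" "peval p X0 = 0"
    using scalar_matrix_algebraic[of "\<lambda>a b. l (re_part (M a b))" "\<lambda>a b. l (im_part (M a b))"] unfolding X0_def \<mu>_def by blast
  then obtain \<epsilon> where eps: "0 < \<epsilon>" "\<And>X. X \<in> A \<Longrightarrow> norm (X - X0) < \<epsilon> \<Longrightarrow> strongly_clean_at A 1 X"
    using algebraic_nhd_strongly_clean by blast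
  \<comment> \<open>Each of the n^2 entries is off by at most twice \<delta>, once for each part, so
    that the total error is at most half of \<epsilon>.\<close>
  define \<delta> where "\<delta> = \<epsilon> / (4 * real n * real n)"
  have del: "\<delta> > 0" using eps n by (simp add: \<delta>_def)
  obtain d where d: "d \<in> A" "proj d" "e * d = d" "bad d" and nH: "\<And>H. H \<in> \<H> \<Longrightarrow> norm ((H - l H *\<^sub>R 1) * d) \<le> \<delta>"
    using l[OF del] by blast
  have ud: "under d e" by (rule under_e[OF d(2,3)])
  have de: "d * e = d" using ud by (simp add: under_def)
  have \<mu>A: "\<mu> a b \<in> A" for a b unfolding \<mu>_def by (intro closed)
  have X0A: "X0 \<in> A" unfolding X0_def using mu_V \<mu>A by (intro closed) auto
  have "ampl d * X0 = (\<Sum>a<n. \<Sum>b<n. V a * (d * \<mu> a b) * adj (V b))"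
  proof -
    have "ampl d * X0 = (\<Sum>a<n. \<Sum>b<n. ampl d * V a * \<mu> a b * adj (V b))"
      by (simp add: X0_def sum_distrib_left mult.assoc)
    then show ?thesis using ampl_V de by (simp add: mult.assoc)
  qed
  moreover have "ampl d * X = (\<Sum>a<n. \<Sum>b<n. V a * (d * M a b) * adj (V b))"
    unfolding M_def by (rule ampl_mult_left[OF d(1) ud X])
  ultimately have diff: "ampl d * (X - X0) = (\<Sum>a<n. \<Sum>b<n. V a * (d * (M a b - \<mu> a b)) * adj (V b))"
    by (simp add: right_diff_distrib left_diff_distrib sum_subtractf)
  have small: "norm (V a * (d * (M a b - \<mu> a b)) * adj (V b)) \<le> 2 * \<delta>" if ab: "a < n" "b < n" for a b
  proof -
    let ?R = "re_part (M a b)" and ?I = "im_part (M a b)"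
    have R: "?R \<in> \<H>" "?I \<in> \<H>" using ab by (auto simp: \<H>_def)
    have cR: "d * ?R = ?R * d" "d * ?I = ?I * d" using \<H>[OF R(1)] \<H>[OF R(2)] ud d(1) mu_comm by blast+
    have "M a b - \<mu> a b = (?R - l ?R *\<^sub>R 1) + imag_op * (?I - l ?I *\<^sub>R 1)"
      unfolding \<mu>_def by (subst re_im_decomposition[of "M a b"]) (simp add: right_diff_distrib)
    moreover have "d * imag_op = imag_op * d" by (simp add: imag_op_commute)
    then have "d * (imag_op * (?I - l ?I *\<^sub>R 1)) = imag_op * (d * (?I - l ?I *\<^sub>R 1))" by (metis mult.assoc)
    ultimately have "d * (M a b - \<mu> a b) = (?R - l ?R *\<^sub>R 1) * d + imag_op * ((?I - l ?I *\<^sub>R 1) * d)"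
      using cR by (simp add: distrib_left left_diff_distrib right_diff_distrib)
    then have "norm (d * (M a b - \<mu> a b)) \<le> norm ((?R - l ?R *\<^sub>R 1) * d) + norm (imag_op * ((?I - l ?I *\<^sub>R 1) * d))"
      by (simp only: norm_triangle_ineq)
    also have "norm (imag_op * ((?I - l ?I *\<^sub>R 1) * d)) \<le> 1 * \<delta>"
      by (rule order_trans[OF norm_mult_ineq mult_mono[OF norm_imag_op_le nH[OF R(2)]]]) auto
    finally have "norm (d * (M a b - \<mu> a b)) \<le> 2 * \<delta>" using nH[OF R(1)] by simp
    then have "norm (V a) * norm (d * (M a b - \<mu> a b)) * norm (adj (V b)) \<le> 1 * (2 * \<delta>) * 1"
      using mu_norm[OF ab(1)] mu_norm[OF ab(2)] del by (intro mult_mono) auto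
    moreover have "norm (V a * (d * (M a b - \<mu> a b)) * adj (V b)) \<le> norm (V a) * norm (d * (M a b - \<mu> a b)) * norm (adj (V b))"
      by (rule order_trans[OF norm_mult_ineq mult_right_mono[OF norm_mult_ineq norm_ge_zero]])
    ultimately show ?thesis by simp
  qed
  have "norm (ampl d * (X - X0)) \<le> (\<Sum>a<n. \<Sum>b<n. 2 * \<delta>)"
    unfolding diff by (intro sum_norm_le small) auto
  also have "\<dots> = \<epsilon> / 2" using n by (simp add: \<delta>_def)
  \<comment> \<open>The neighbourhood result concerns the whole algebra. Therefore \<open>X\<close>
    is replaced by \<open>X0\<close> off the summand \<open>ampl d\<close>, where it need not be
    close to \<open>X0\<close>, and left unchanged on it.\<close>
  finally have close: "norm (X0 + ampl d * (X - X0) - X0) < \<epsilon>" using eps by simp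
  have adA: "ampl d \<in> A" by (rule ampl_closed[OF d(1)])
  have "strongly_clean_at A 1 (X0 + ampl d * (X - X0))"
    using X X0A adA by (intro eps(2)[OF _ close]) (simp add: closed)
  moreover have idem: "ampl d * ampl d = ampl d" using ampl_mult[OF de, of d] d(2) by simp
  ultimately have "strongly_clean_at A (ampl d) (X0 + ampl d * (X - X0))"
    using strongly_clean_at_cut[OF adA ampl_central[OF d(1) ud] idem] by blast
  moreover have "ampl d * (X0 + ampl d * (X - X0)) = ampl d * X"
    using idem by (simp add: distrib_left right_diff_distrib flip: mult.assoc)
  ultimately have "strongly_clean_at A (ampl d) X" using strongly_clean_at_cong by blast
  then show False using d(4) by (simp add: bad_def)
qed

end

end

section \<open>Failure of strong cleanness\<close>

text \<open>Orthogonal blocks, the \<open>k\<close>-th of which contains a copy of the \<open>(k + 1) \<times> (k + 1)\<close> matrices.\<close>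

definition block_sequence :: "'h::chilbert_space op set \<Rightarrow> (nat \<Rightarrow> nat \<Rightarrow> 'h op) \<Rightarrow> (nat \<Rightarrow> 'h op) \<Rightarrow> bool" where
  "block_sequence A W g \<longleftrightarrow> (\<forall>k. proj (g k) \<and> g k \<noteq> 0) \<and> (\<forall>k. \<forall>i\<le>k. W k i \<in> A) \<and>
     (\<forall>k. \<forall>i\<le>k. \<forall>j\<le>k. adj (W k i) * W k j = (if i = j then g k else 0)) \<and>
     (\<forall>k l i j. k \<noteq> l \<longrightarrow> i \<le> k \<longrightarrow> j \<le> l \<longrightarrow> adj (W k i) * W l j = 0)"

context vn_algebra
begin

text \<open>The obstruction: on the \<open>k\<close>-th block let \<open>T\<close> shift \<open>w\<^sub>0 \<mapsto> w\<^sub>1 \<mapsto> \<dots> \<mapsto> w\<^sub>k \<mapsto> w\<^sub>k\<close>. If \<open>T = U + P\<close>, then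
  \<open>1 - P\<close> maps every \<open>w\<^sub>i\<close> to \<open>w\<^sub>k\<close>, hence has norm at least \<open>\<surd>(k + 1)\<close>.\<close>

lemma block_sequence_not_strongly_clean:
  assumes bs: "block_sequence A W g"
  obtains T where "T \<in> A" "\<not> strongly_clean_at A 1 T"
proof -
  have g: "proj (g k)" "g k \<noteq> 0" for k using bs by (auto simp: block_sequence_def)
  have WA: "W k i \<in> A" if "i \<le> k" for k i using bs that by (auto simp: block_sequence_def)
  have orth: "adj (W k i) * W k j = (if i = j then g k else 0)" if "i \<le> k" "j \<le> k" for k i j
    using bs that by (auto simp: block_sequence_def)
  have orth2: "adj (W k i) * W l j = 0" if "k \<noteq> l" "i \<le> k" "j \<le> l" for k l i j
    using bs that unfolding block_sequence_def by blast
  have Wg: "W k i * g k = W k i" "proj (W k i * adj (W k i))" if "i \<le> k" for k i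
    using partial_isometry_eq[of "W k i" "g k"] orth[OF that that] g(1) by auto
  have gW: "g k * adj (W k i) = adj (W k i)" if "i \<le> k" for k i
    using Wg(1)[OF that] g(1)[of k] by (metis adj_mult proj_adj)
  define q where "q k i = W k i * adj (W k i)" for k i
  define f where "f k = (\<Sum>i\<le>k. q k i)" for k
  define Sh where "Sh k = (\<Sum>i<k. W k (Suc i) * adj (W k i))" for k
  define t where "t k = Sh k + q k k" for k
  have of: "orthogonal_family (q k) {..k}" for k
    unfolding orthogonal_family_def q_def
  proof (intro conjI ballI impI)
    fix i j assume ij: "i \<in> {..k}" "j \<in> {..k}" "i \<noteq> j"
    have "W k i * adj (W k i) * (W k j * adj (W k j)) = W k i * (adj (W k i) * W k j) * adj (W k j)"
      by (simp add: mult.assoc)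
    then show "W k i * adj (W k i) * (W k j * adj (W k j)) = 0" using orth[of i k j] ij by simp
  qed (use Wg in auto)
  have fW: "f k * W k j = W k j" if j: "j \<le> k" for k j
  proof -
    have "f k * W k j = (\<Sum>i\<le>k. W k i * (adj (W k i) * W k j))"
      by (simp add: f_def q_def sum_distrib_right mult.assoc)
    also have "\<dots> = (\<Sum>i\<le>k. if i = j then W k j else 0)"
      using j by (intro sum.cong) (auto simp: orth Wg)
    finally show ?thesis using j by simp
  qed
  have pf: "proj (f k)" for k unfolding f_def by (rule proj_sum[OF _ of]) simp
  have Wf: "adj (W k j) * f k = adj (W k j)" if "j \<le> k" for k j
    using fW[OF that] pf[of k] by (metis adj_mult proj_adj)
  have "f k * f l = 0" if "k \<noteq> l" for k l
  proof -
    have "f k * f l = (\<Sum>i\<le>k. \<Sum>j\<le>l. W k i * (adj (W k i) * W l j) * adj (W l j))"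
      unfolding f_def q_def sum_product by (simp add: mult.assoc)
    also have "\<dots> = 0" using orth2[OF that] by (intro sum.neutral ballI) auto
    finally show ?thesis .
  qed
  then have off: "orthogonal_family f UNIV" using pf by (simp add: orthogonal_family_def)
  have nSh: "norm (Sh k) \<le> 1" for k
  proof (rule norm_op_bound)
    fix x
    have "adj (Sh k) * Sh k = (\<Sum>i<k. \<Sum>j<k. W k i * (adj (W k (Suc i)) * W k (Suc j)) * adj (W k j))"
      unfolding Sh_def adj_sum sum_product by (simp add: mult.assoc)
    also have "\<dots> = (\<Sum>i<k. \<Sum>j<k. if j = i then q k i else 0)"
      by (intro sum.cong refl) (auto simp: orth q_def Wg gW mult.assoc)
    also have "\<dots> = (\<Sum>i<k. q k i)" by simp
    finally have eq: "adj (Sh k) * Sh k = (\<Sum>i<k. q k i)" .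
    have p: "proj (\<Sum>i<k. q k i)" using of[of k] by (intro proj_sum) (auto simp: orthogonal_family_def)
    have "(norm (ap (Sh k) x))\<^sup>2 = (norm (ap (\<Sum>i<k. q k i) x))\<^sup>2"
      unfolding norm_ap_sq[of "Sh k"] eq norm_ap_proj_sq[OF p] ..
    then show "norm (ap (Sh k) x) \<le> 1 * norm x" using norm_ap_proj_le[OF p, of x] by simp
  qed simp
  have nt: "norm (t k) \<le> 2" for k
  proof -
    have "norm (q k k) \<le> 1" unfolding q_def by (rule norm_proj_le) (simp add: Wg)
    then show ?thesis unfolding t_def using norm_triangle_ineq[of "Sh k" "q k k"] nSh[of k] by simp
  qed
  have ft: "f k * t k = t k" and tf: "t k * f k = t k" for k
  proof -
    have "f k * Sh k = Sh k" unfolding Sh_def sum_distrib_left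
      by (rule sum.cong) (auto simp: fW simp flip: mult.assoc)
    moreover have "f k * q k k = q k k" unfolding q_def by (simp add: fW flip: mult.assoc)
    ultimately show "f k * t k = t k" by (simp add: t_def distrib_left)
    have "Sh k * f k = Sh k" unfolding Sh_def sum_distrib_right
      by (rule sum.cong) (auto simp: Wf mult.assoc)
    moreover have "q k k * f k = q k k" unfolding q_def by (simp add: Wf mult.assoc)
    ultimately show "t k * f k = t k" by (simp add: t_def distrib_right)
  qed
  have tW: "t k * W k j = W k (if j < k then Suc j else k)" if j: "j \<le> k" for k j
  proof -
    have "Sh k * W k j = (\<Sum>i<k. W k (Suc i) * (adj (W k i) * W k j))"
      by (simp add: Sh_def sum_distrib_right mult.assoc)
    also have "\<dots> = (\<Sum>i<k. if i = j then W k (Suc j) else 0)"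
      using j by (intro sum.cong) (auto simp: orth Wg)
    finally have "Sh k * W k j = (if j < k then W k (Suc j) else 0)" by simp
    moreover have "q k k * W k j = (if j < k then 0 else W k k)"
      using j orth[of k k j] by (auto simp: q_def mult.assoc Wg)
    ultimately show ?thesis by (simp add: t_def distrib_right)
  qed
  have tA: "t k \<in> A" for k
    unfolding t_def Sh_def q_def using WA by (intro closed) auto
  \<comment> \<open>The blocks are bounded by 2 uniformly, so their direct sum exists, whereas the
    idempotents it would need have unbounded norm.\<close>
  obtain T where T: "\<And>k. T * f k = t k" "\<And>R. (\<And>k. R * t k = t k * R) \<Longrightarrow> R * T = T * R"
  proof (rule direct_sum[OF off, of t 2])
    show "under (t k) (f k)" for k using ft tf by (simp add: under_def)
  qed (use nt that in auto)
  have TA: "T \<in> A" by (rule bicommutant) (use T(2) tA in blast)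
  have TW: "T * W k j = W k (if j < k then Suc j else k)" if "j \<le> k" for k j
    using T(1)[of k] tW[OF that] fW[OF that] by (metis mult.assoc)
  have "\<not> strongly_clean_at A 1 T"
  proof
    assume "strongly_clean_at A 1 T"
    then obtain P U V where P: "P * P = P" "U * V = 1" "V * U = 1" "T = U + P" "U * P = P * U"
      unfolding strongly_clean_at_def by auto
    define Q where "Q = 1 - P"
    have QQ: "Q * Q = Q" using P(1) by (simp add: Q_def left_diff_distrib right_diff_distrib)
    have QT: "Q * T = T * Q" using P(5) by (simp add: Q_def P(4) left_diff_distrib right_diff_distrib distrib_left distrib_right)
    have fixed: "Q * w = w" if w: "T * w = w" for w
    proof -
      have "U * (P * w) = P * (T * w) - P * w"
        using P(1,5) by (simp add: P(4) distrib_left distrib_right flip: mult.assoc)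
      then have "U * (P * w) = 0" by (simp add: w)
      then have "P * w = 0" using P(3) by (metis mult.assoc mult_1_left mult_zero_right)
      then show ?thesis by (simp add: Q_def left_diff_distrib)
    qed
    have inj: "z = 0" if z: "T * z = 0" "Q * z = z" for z
    proof -
      have "P * z = 0" using z(2) by (simp add: Q_def left_diff_distrib)
      then have "U * z = 0" using z(1) by (simp add: P(4) distrib_right)
      then show ?thesis using P(3) by (metis mult.assoc mult_1_left mult_zero_right)
    qed
    \<comment> \<open>Downward induction: \<open>Q * W k j\<close> and \<open>W k k\<close> both lie
      in the range of \<open>Q\<close>, where \<open>T\<close> equals \<open>U\<close> and is
      injective, and by the induction hypothesis \<open>T\<close> maps both to
      \<open>W k k\<close>.\<close>
    have QW: "Q * W k j = W k k" if "j \<le> k" for k j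
      using that
    proof (induction j rule: inc_induct)
      case base
      show ?case by (rule fixed) (simp add: TW)
    next
      case (step j)
      have "T * (Q * W k j - W k k) = Q * (T * W k j) - T * W k k"
        using QT by (simp add: right_diff_distrib flip: mult.assoc)
      also have "\<dots> = 0" using step by (simp add: TW)
      finally have "T * (Q * W k j - W k k) = 0" .
      moreover have "Q * (Q * W k j - W k k) = Q * W k j - W k k"
        using fixed[of "W k k"] QQ by (simp add: TW right_diff_distrib flip: mult.assoc)
      ultimately show ?case using inj by fastforce
    qed
    have "real (Suc k) \<le> (norm Q)\<^sup>2" for k
    proof -
      obtain x where x: "ap (g k) x \<noteq> 0" using g(2)[of k] op_eqI[of "g k" 0] by auto
      \<comment> \<open>The summands of \<open>Y\<close> have orthogonal ranges, so norms grow by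
        the square root of k + 1; after applying \<open>Q\<close> all summands coincide and norms
        grow by k + 1.\<close>
      define Y where "Y = (\<Sum>i\<le>k. W k i)"
      have "adj Y * Y = (\<Sum>i\<le>k. \<Sum>j\<le>k. adj (W k i) * W k j)" by (simp add: Y_def adj_sum sum_product)
      also have "\<dots> = (\<Sum>i\<le>k. \<Sum>j\<le>k. if j = i then g k else 0)" by (intro sum.cong) (auto simp: orth)
      also have "\<dots> = real (Suc k) *\<^sub>R g k" by (simp add: sum_constant_scaleR)
      finally have nY: "(norm (ap Y x))\<^sup>2 = real (Suc k) * (norm (ap (g k) x))\<^sup>2"
        by (simp add: norm_ap_sq[of Y] norm_ap_proj_sq[OF g(1)] rip_simps)
      have "Q * Y = (\<Sum>i\<le>k. W k k)" unfolding Y_def sum_distrib_left by (rule sum.cong) (auto simp: QW)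
      also have "\<dots> = real (Suc k) *\<^sub>R W k k" by (simp add: sum_constant_scaleR)
      finally have "norm (ap Q (ap Y x)) = real (Suc k) * norm (ap (W k k) x)" by (metis abs_of_nat ap_simps(6,7) norm_scaleR)
      moreover have "(norm (ap (W k k) x))\<^sup>2 = (norm (ap (g k) x))\<^sup>2"
        unfolding norm_ap_sq[of "W k k"] norm_ap_proj_sq[OF g(1)] by (simp add: orth)
      ultimately have "(norm (ap Q (ap Y x)))\<^sup>2 = (real (Suc k))\<^sup>2 * (norm (ap (g k) x))\<^sup>2" by (simp only: power_mult_distrib)
      moreover have "(norm (ap Q (ap Y x)))\<^sup>2 \<le> (norm Q * norm (ap Y x))\<^sup>2" by (intro power_mono norm_ap) auto
      ultimately have "(real (Suc k) * (norm (ap (g k) x))\<^sup>2) * real (Suc k) \<le> (real (Suc k) * (norm (ap (g k) x))\<^sup>2) * (norm Q)\<^sup>2"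
        by (simp only: power_mult_distrib nY) (simp add: power2_eq_square mult_ac)
      then show ?thesis using x by (subst (asm) mult_le_cancel_left_pos) auto
    qed
    moreover obtain k where "(norm Q)\<^sup>2 < real k" using reals_Archimedean2 by blast
    ultimately show False by (smt (verit) of_nat_Suc)
  qed
  then show ?thesis using that TA by blast
qed

text \<open>A single sequence with orthogonal ranges is distributed over the blocks by the pairing
  function. Within a block the partial isometries are restricted to one projection
  \<open>e j\<close> far enough along for all of them to be isometric on it. Different blocks are
  separated by their ranges, not by these projections.\<close>

lemma block_sequence_of_isometries:
  fixes e V :: "nat \<Rightarrow> 'h op"
  assumes e: "\<And>j. proj (e j) \<and> e j \<noteq> 0 \<and> e j \<in> A" and V: "\<And>j. V j \<in> A"
    and Ve: "\<And>i j. i \<le> j \<Longrightarrow> adj (V i) * V i * e j = e j"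
    and VV: "\<And>i j. i < j \<Longrightarrow> adj (V i) * V j = 0"
  shows "\<exists>W g. block_sequence A W g"
proof -
  have VV': "adj (V i) * V j = 0" if "i \<noteq> j" for i j
  proof (cases "i < j")
    case False
    then have "j < i" using that by simp
    then have "adj (V j) * V i = 0" by (rule VV)
    then show ?thesis by (metis adj_adj adj_mult adj_simps(1))
  qed (rule VV)
  \<comment> \<open>Any bound for the indices occurring in block \<open>k\<close> would do; the sum
    of these indices is one.\<close>
  define m where "m k = (\<Sum>i\<le>k. prod_encode (k, i))" for k
  have m: "prod_encode (k, i) \<le> m k" if "i \<le> k" for i k
    unfolding m_def by (rule member_le_sum) (use that in auto)
  define W where "W k i = V (prod_encode (k, i)) * e (m k)" for k i
  have prod: "adj (W k i) * W l j = e (m k) * (adj (V (prod_encode (k, i))) * V (prod_encode (l, j))) * e (m l)" for k i l j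
    using e by (simp add: W_def mult.assoc)
  have "block_sequence A W (\<lambda>k. e (m k))"
    unfolding block_sequence_def
  proof (intro conjI allI impI)
    fix k i j :: nat assume ij: "i \<le> k" "j \<le> k"
    show "adj (W k i) * W k j = (if i = j then e (m k) else 0)"
    proof (cases "i = j")
      case True
      then show ?thesis unfolding prod using Ve[OF m[OF ij(2)]] e by (simp add: mult.assoc)
    qed (simp add: prod VV')
  next
    fix k l i j :: nat assume "k \<noteq> l"
    then show "adj (W k i) * W l j = 0" by (simp add: prod VV')
  qed (use e V in \<open>auto simp: W_def closed\<close>)
  then show ?thesis by blast
qed

lemma abelian_proj_sub:
  assumes "abelian_proj A e" "d \<in> A" "proj d" "e * d = d"
  shows "abelian_proj A d"
proof -
  have e: "proj e" using assms(1) by (simp add: abelian_proj_def)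
  have d: "d * e = d" using assms(3,4) e by (metis adj_mult proj_adj)
  have "under S e" if "under S d" for S
    using that assms(4) d unfolding under_def by (metis mult.assoc)
  then show ?thesis using assms unfolding abelian_proj_def by blast
qed

text \<open>Otherwise each projection under \<open>p\<close> contains a partial isometry of square
  0, and the construction continues inside its initial projection. The range of \<open>V n\<close>
  is orthogonal to \<open>e n\<close>, while all later ranges lie under \<open>e n\<close>; thus the
  ranges are orthogonal and the initial projections decrease.\<close>

lemma abelian_subprojection:
  assumes nb: "\<nexists>W g. block_sequence A W g" and p: "p \<in> A" "proj p" "p \<noteq> 0"
  shows "\<exists>e. abelian_proj A e \<and> e \<noteq> 0 \<and> p * e = e"
proof (rule ccontr)
  assume "\<not> ?thesis"
  then have na: "\<not> abelian_proj A q" if "q \<noteq> 0" "p * q = q" for q using that by blast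
  define St where "St x \<longleftrightarrow> fst x \<in> A \<and> proj (fst x) \<and> fst x \<noteq> 0 \<and> p * fst x = fst x \<and> snd x \<in> A \<and>
      adj (snd x) * snd x = fst x \<and> snd x * snd x = 0" for x :: "'h op \<times> 'h op"
  have step: "\<exists>v. St (adj v * v, v) \<and> q * (adj v * v) = adj v * v \<and> q * v = v"
    if q: "q \<in> A" "proj q" "q \<noteq> 0" "p * q = q" for q
  proof -
    obtain v where v: "v \<in> A" "adj v * v \<noteq> 0" "proj (adj v * v)" "q * (adj v * v) = adj v * v" "q * v = v" "v * v = 0"
      using nonabelian_partial_isometry[OF q(1,2) na[OF q(3,4)]] by metis
    moreover have "p * (adj v * v) = adj v * v" using v(4) q(4) by (metis mult.assoc)
    ultimately show ?thesis by (intro exI[of _ v]) (simp add: St_def closed)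
  qed
  have "\<exists>x. St x" using step[of p] p by auto
  moreover have "\<exists>y. St y \<and> (fst x * fst y = fst y \<and> fst x * snd y = snd y)" if x: "St x" for x
  proof -
    have "fst x \<in> A" "proj (fst x)" "fst x \<noteq> 0" "p * fst x = fst x" using x by (auto simp: St_def)
    from step[OF this] show ?thesis by (metis fst_conv snd_conv)
  qed
  ultimately obtain s where "\<forall>n. St (s n) \<and> (fst (s n) * fst (s (Suc n)) = fst (s (Suc n)) \<and> fst (s n) * snd (s (Suc n)) = snd (s (Suc n)))"
    using dependent_nat_choice[of "\<lambda>_. St" "\<lambda>_ x y. fst x * fst y = fst y \<and> fst x * snd y = snd y"] by blast
  then have s: "St (s n)" "fst (s n) * fst (s (Suc n)) = fst (s (Suc n))" "fst (s n) * snd (s (Suc n)) = snd (s (Suc n))" for n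
    by auto
  define e where "e n = fst (s n)" for n
  define V where "V n = snd (s n)" for n
  have eV: "e n \<in> A" "proj (e n)" "e n \<noteq> 0" "V n \<in> A" "adj (V n) * V n = e n" "V n * V n = 0" for n
    using s(1)[of n] by (auto simp: St_def e_def V_def)
  have ee: "e n * e (Suc n) = e (Suc n)" "e n * V (Suc n) = V (Suc n)" for n using s by (auto simp: e_def V_def)
  have mono: "e m * e n = e n" if "m \<le> n" for m n
    using that
  proof (induction n rule: dec_induct)
    case base
    show ?case using eV(2) by simp
  next
    case (step n)
    then show ?case using ee(1)[of n] by (metis mult.assoc)
  qed
  have "\<exists>W g. block_sequence A W g"
  proof (rule block_sequence_of_isometries[of e V])
    show "proj (e j) \<and> e j \<noteq> 0 \<and> e j \<in> A" "V j \<in> A" for j using eV by auto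
    show "adj (V i) * V i * e j = e j" if "i \<le> j" for i j using mono[OF that] by (simp add: eV)
    fix i j :: nat assume "i < j"
    \<comment> \<open>The range of \<open>V j\<close> lies under the projection of the stage before,
      hence the shift by one.\<close>
    then obtain l where l: "j = Suc l" "i \<le> l" by (cases j) auto
    have "e i * V j = V j" using mono[OF l(2)] ee(2)[of l] unfolding l(1) by (metis mult.assoc)
    moreover have "adj (V i) * e i = 0"
    proof -
      have "e i * V i = 0" using eV(5,6)[of i] by (metis mult.assoc mult_zero_right)
      then show ?thesis using eV(2)[of i] by (metis adj_mult adj_simps(1) proj_adj)
    qed
    ultimately show "adj (V i) * V j = 0" by (metis mult.assoc mult_zero_left)
  qed
  then show False using nb by blast
qed

end

section \<open>Type I summands\<close>

context vn_algebra
begin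

text \<open>Since \<open>e\<close> is abelian, a new copy of \<open>d' \<le> d \<le> e\<close> that is orthogonal to the old copies of \<open>d\<close> is
  automatically orthogonal to the old copies of \<open>e\<close>.\<close>

lemma orthogonal_copy:
  fixes V :: "nat \<Rightarrow> 'h op"
  assumes e: "abelian_proj A e" and d: "d \<in> A" "proj d" "e * d = d"
    and V: "\<And>i. i < n \<Longrightarrow> V i \<in> A" "\<And>i. i < n \<Longrightarrow> proj (adj (V i) * V i)" "\<And>i. i < n \<Longrightarrow> V i * e = V i"
      "\<And>i. i < n \<Longrightarrow> adj (V i) * V i * d = d" "\<And>i j. i < n \<Longrightarrow> j < n \<Longrightarrow> i \<noteq> j \<Longrightarrow> adj (V i) * V j = 0"
    and not: "\<not> (\<forall>x\<in>A. (\<Sum>i<n. V i * d * adj (V i)) * x = x * (\<Sum>i<n. V i * d * adj (V i)))"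
  shows "\<exists>w\<in>A. w \<noteq> 0 \<and> proj (adj w * w) \<and> w * d = w \<and> (\<forall>i<n. adj (V i) * w = 0)"
proof -
  have pe: "proj e" "e \<in> A" using e by (auto simp: abelian_proj_def)
  have de: "d * e = d" using d(2,3) pe by (metis adj_mult proj_adj)
  define f where "f = (\<Sum>i<n. V i * d * adj (V i))"
  have fA: "f \<in> A" unfolding f_def using V(1) d(1) by (intro closed) auto
  have af: "adj f = f" using d(2) by (simp add: f_def adj_sum mult.assoc)
  have dVf: "d * adj (V i) * f = d * adj (V i)" if i: "i < n" for i
  proof -
    have dr: "d * (adj (V i) * V i) = d" using V(4)[OF i] V(2)[OF i] d(2) by (metis adj_mult proj_adj)
    have "d * adj (V i) * f = (\<Sum>j<n. d * (adj (V i) * V j) * d * adj (V j))"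
      by (simp add: f_def sum_distrib_left mult.assoc)
    also have "\<dots> = (\<Sum>j<n. if j = i then d * adj (V i) else 0)"
      by (intro sum.cong refl) (use V(5)[OF i] dr d(2) in auto)
    finally show ?thesis using i by simp
  qed
  \<comment> \<open>If no \<open>y\<close> moved \<open>d\<close> out of \<open>f\<close>, then
    \<open>f\<close> would be invariant under \<open>A\<close>, and central because \<open>A\<close>
    contains adjoints.\<close>
  have "\<exists>y\<in>A. (1 - f) * y * d \<noteq> 0"
  proof (rule ccontr)
    assume "\<not> ?thesis"
    then have z: "(1 - f) * y * d = 0" if "y \<in> A" for y using that by blast
    have yf: "y * f = f * y * f" if y: "y \<in> A" for y
    proof -
      have "(1 - f) * y * f = (\<Sum>i<n. (1 - f) * (y * V i) * d * adj (V i))"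
        by (simp add: f_def sum_distrib_left mult.assoc)
      also have "\<dots> = 0" using z[of "y * V _"] y V(1) by (intro sum.neutral ballI) (simp add: closed)
      finally show ?thesis by (simp add: left_diff_distrib)
    qed
    have "f * x = x * f" if x: "x \<in> A" for x
    proof -
      have "f * x = adj (adj x * f)" using af by simp
      also have "\<dots> = adj (f * adj x * f)" by (simp only: yf[OF adj_closed[OF x], symmetric])
      also have "\<dots> = f * x * f" using af by (simp add: mult.assoc)
      finally show ?thesis using yf[OF x] by (rule trans[OF _ sym])
    qed
    then show False using not by (simp add: f_def)
  qed
  then obtain y where y: "y \<in> A" "(1 - f) * y * d \<noteq> 0" by blast
  have "(1 - f) * y * d \<in> A" using y fA d by (simp add: closed)
  from partial_isometry_exists[OF this y(2)] obtain w where w: "w \<in> A" "w \<noteq> 0" "proj (adj w * w)"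
    "\<And>q. adj q = q \<Longrightarrow> (1 - f) * y * d * q = (1 - f) * y * d \<Longrightarrow> w * q = w"
    "\<And>p. p * ((1 - f) * y * d) = (1 - f) * y * d \<Longrightarrow> p * w = w" by metis
  have wd: "w * d = w" by (rule w(4)) (use d(2) in \<open>simp_all add: mult.assoc\<close>)
  have Vw: "adj (V i) * w = 0" if i: "i < n" for i
  proof -
    define r where "r = adj (V i) * V i"
    have rA: "r \<in> A" using V(1)[OF i] by (simp add: r_def closed)
    have pr: "proj r" using V(2)[OF i] by (simp add: r_def)
    have "r * d = d" using V(4)[OF i] by (simp add: r_def)
    then have dr: "d * r = d" using pr d(2) by (metis adj_mult proj_adj)
    have re: "r * e = r" using V(3)[OF i] by (simp add: r_def mult.assoc)
    then have er: "e * r = r" using pr pe by (metis adj_mult proj_adj)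
    have Vr: "V i * r = V i" using partial_isometry_eq(1)[of "V i" r] pr by (simp add: r_def)
    then have rV: "r * adj (V i) = adj (V i)" using pr by (metis adj_mult proj_adj)
    have "d * adj (V i) * f = d * adj (V i)" by (rule dVf[OF i])
    then have "d * adj (V i) * (1 - f) = 0" by (simp add: right_diff_distrib)
    moreover have "(1 - f) * w = w"
    proof (rule w(5))
      have "f * f = f"
      proof -
        have "f * f = (\<Sum>i<n. V i * (d * adj (V i) * f))" by (simp add: f_def sum_distrib_right mult.assoc)
        also have "\<dots> = (\<Sum>i<n. V i * (d * adj (V i)))" by (rule sum.cong) (simp_all add: dVf)
        finally show ?thesis by (simp add: f_def mult.assoc)
      qed
      then have "(1 - f) * (1 - f) = 1 - f" by (simp add: left_diff_distrib right_diff_distrib)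
      then show "(1 - f) * ((1 - f) * y * d) = (1 - f) * y * d" by (simp flip: mult.assoc)
    qed
    ultimately have dVw: "d * (adj (V i) * w) = 0" by (metis mult.assoc mult_zero_left)
    define X where "X = adj (V i) * w"
    have XA: "X \<in> A" using V(1)[OF i] w(1) by (simp add: X_def closed)
    have rX: "r * X = X" unfolding X_def using rV by (simp flip: mult.assoc)
    have Xd: "X * d = X" unfolding X_def using wd by (simp add: mult.assoc)
    have uX: "under X e" using rX Xd er de unfolding under_def by (metis mult.assoc)
    have urd: "under (r - d) e"
      using re er d(3) de by (simp add: under_def left_diff_distrib right_diff_distrib)
    \<comment> \<open>\<open>X\<close> belongs to the commutative corner; it starts in
      \<open>d\<close> and ends in \<open>r - d\<close>, so moving \<open>r - d\<close> to its right
      side makes it vanish.\<close>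
    have "X = (r - d) * X" using rX dVw by (simp add: left_diff_distrib X_def)
    also have "\<dots> = X * (r - d)"
      using e uX urd XA rA d(1) closed_diff unfolding abelian_proj_def by blast
    also have "\<dots> = X * d * (r - d)" by (simp only: Xd)
    also have "\<dots> = X * (d * (r - d))" by (simp only: mult.assoc)
    also have "d * (r - d) = 0" using dr d(2) by (simp add: right_diff_distrib)
    finally show ?thesis by (simp add: X_def)
  qed
  show ?thesis using w(1-3) wd Vw by blast
qed

text \<open>Copies are added as long as the sum of the present copies of \<open>d\<close> is not
  central. If this never stops, the partial isometries obtained have orthogonal ranges and
  decreasing common initial parts, which produces blocks of every size.\<close>

lemma matrix_units_sub:
  assumes nb: "\<nexists>W g. block_sequence A W g" and e: "abelian_proj A e" "e \<noteq> 0"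
  shows "\<exists>n d V f. 1 \<le> n \<and> d \<noteq> 0 \<and> e * d = d \<and> matrix_units A n d V f"
proof (rule ccontr)
  assume "\<not> ?thesis"
  then have no: "\<not> matrix_units A n d V f" if "1 \<le> n" "d \<noteq> 0" "e * d = d" for n d V f using that by blast
  have pe: "proj e" "e \<in> A" using e by (auto simp: abelian_proj_def)
  \<comment> \<open>The partial isometries are only required to be isometric on the current
    projection and are not cut down to it. So earlier ones never change, and the stages fit together
    to one sequence.\<close>
  define St where "St n x \<longleftrightarrow> fst x \<in> A \<and> proj (fst x) \<and> fst x \<noteq> 0 \<and> e * fst x = fst x \<and>
     (\<forall>i\<le>n. snd x i \<in> A \<and> proj (adj (snd x i) * snd x i) \<and> snd x i * e = snd x i \<and>
        adj (snd x i) * snd x i * fst x = fst x) \<and>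
     (\<forall>i\<le>n. \<forall>j\<le>n. i \<noteq> j \<longrightarrow> adj (snd x i) * snd x j = 0)" for n :: nat and x :: "'h op \<times> (nat \<Rightarrow> 'h op)"
  have "St 0 (e, \<lambda>_. e)" using pe e(2) by (simp add: St_def)
  moreover have "\<exists>y. St (Suc n) y \<and> (fst x * fst y = fst y \<and> (\<forall>i\<le>n. snd y i = snd x i))" if x: "St n x" for n x
  proof -
    obtain d V where xd: "x = (d, V)" by (cases x)
    have d: "d \<in> A" "proj d" "d \<noteq> 0" "e * d = d"
      and V: "\<And>i. i \<le> n \<Longrightarrow> V i \<in> A" "\<And>i. i \<le> n \<Longrightarrow> proj (adj (V i) * V i)" "\<And>i. i \<le> n \<Longrightarrow> V i * e = V i"
      "\<And>i. i \<le> n \<Longrightarrow> adj (V i) * V i * d = d" "\<And>i j. i \<le> n \<Longrightarrow> j \<le> n \<Longrightarrow> i \<noteq> j \<Longrightarrow> adj (V i) * V j = 0"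
      using x by (auto simp: St_def xd)
    have Vd: "V i * d * adj (V i * d) = V i * d * adj (V i)" for i
      using d(2) by (simp add: mult.assoc proj_idem_left)
    have notc: "\<not> (\<forall>x\<in>A. (\<Sum>i<Suc n. V i * d * adj (V i)) * x = x * (\<Sum>i<Suc n. V i * d * adj (V i)))"
    proof
      assume *: "\<forall>x\<in>A. (\<Sum>i<Suc n. V i * d * adj (V i)) * x = x * (\<Sum>i<Suc n. V i * d * adj (V i))"
      have "matrix_units A (Suc n) d (\<lambda>i. V i * d) (\<Sum>i<Suc n. V i * d * adj (V i))"
        unfolding matrix_units_def
      proof (intro conjI allI impI *)
        show "abelian_proj A d" by (rule abelian_proj_sub[OF e(1) d(1,2,4)])
        show "V i * d \<in> A" if "i < Suc n" for i using that V(1) d(1) by (simp add: closed)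
        show "(\<Sum>i<Suc n. V i * d * adj (V i * d)) = (\<Sum>i<Suc n. V i * d * adj (V i))" by (simp only: Vd)
        fix i j assume ij: "i < Suc n" "j < Suc n"
        have "adj (V i * d) * (V j * d) = d * (adj (V i) * V j * d)" using d(2) by (simp add: mult.assoc)
        then show "adj (V i * d) * (V j * d) = (if i = j then d else 0)"
          using V(4)[of i] V(5)[of i j] ij d(2) by auto
      qed
      then show False using no[of "Suc n" d] d by simp
    qed
    have less: "i \<le> n" if "i < Suc n" for i using that by simp
    obtain w where w: "w \<in> A" "w \<noteq> 0" "proj (adj w * w)" "w * d = w" "\<And>i. i < Suc n \<Longrightarrow> adj (V i) * w = 0"
      using orthogonal_copy[OF e(1) d(1,2,4) V(1)[OF less] V(2)[OF less] V(3)[OF less] V(4)[OF less]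
            V(5)[OF less less] notc] by blast
    have wV: "adj w * V i = 0" if "i \<le> n" for i
      using arg_cong[OF w(5)[of i], of adj] that by simp
    define d' where "d' = adj w * w"
    have "d * adj w = adj w" using w(4) d(2) by (metis adj_mult proj_adj)
    then have dd': "d * d' = d'" by (simp add: d'_def flip: mult.assoc)
    have we: "w * e = w"
    proof -
      have "d * e = d" using d(2,4) pe by (metis adj_mult proj_adj)
      then show ?thesis using w(4) by (metis mult.assoc)
    qed
    have "St (Suc n) (d', V(Suc n := w))"
      unfolding St_def fst_conv snd_conv
    proof (intro conjI allI impI)
      show "d' \<in> A" "proj d'" "d' \<noteq> 0" using w(1-3) by (simp_all add: d'_def closed adj_mult_self_eq_0)
      show "e * d' = d'" using dd' d(4) by (metis mult.assoc)
      fix i assume i: "i \<le> Suc n"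
      show "(V(Suc n := w)) i \<in> A" "proj (adj ((V(Suc n := w)) i) * (V(Suc n := w)) i)"
        "(V(Suc n := w)) i * e = (V(Suc n := w)) i"
        using i w V we by (auto simp: le_Suc_eq)
      show "adj ((V(Suc n := w)) i) * (V(Suc n := w)) i * d' = d'"
      proof (cases "i = Suc n")
        case True
        then show ?thesis using w(3) by (simp add: d'_def)
      next
        case False
        then have "adj (V i) * V i * (d * d') = d'" using V(4)[of i] i dd' by (metis le_Suc_eq mult.assoc)
        then show ?thesis using False dd' by simp
      qed
    next
      fix i j assume "i \<le> Suc n" "j \<le> Suc n" "i \<noteq> j"
      then show "adj ((V(Suc n := w)) i) * (V(Suc n := w)) j = 0"
        using V(5) w(5) wV by (auto simp: le_Suc_eq)
    qed
    then show ?thesis using dd' by (intro exI[of _ "(d', V(Suc n := w))"]) (simp add: xd)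
  qed
  ultimately obtain s where s: "\<forall>n. St n (s n) \<and> (fst (s n) * fst (s (Suc n)) = fst (s (Suc n)) \<and> (\<forall>i\<le>n. snd (s (Suc n)) i = snd (s n) i))"
    using dependent_nat_choice[of St "\<lambda>n x y. fst x * fst y = fst y \<and> (\<forall>i\<le>n. snd y i = snd x i)"] by blast
  define V where "V j = snd (s j) j" for j
  have sV: "snd (s n) i = V i" if "i \<le> n" for i n
    using that
  proof (induction n rule: dec_induct)
    case (step n)
    then show ?case using s by simp
  qed (simp add: V_def)
  have sn: "St n (s n)" for n using s by blast
  have "\<exists>W g. block_sequence A W g"
  proof (rule block_sequence_of_isometries[of "\<lambda>n. fst (s n)" V])
    show "proj (fst (s j)) \<and> fst (s j) \<noteq> 0 \<and> fst (s j) \<in> A" "V j \<in> A" for j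
      using sn[of j] by (auto simp: St_def V_def)
    show "adj (V i) * V i * fst (s j) = fst (s j)" if "i \<le> j" for i j
      using sn[of j] sV[OF that] that by (auto simp: St_def)
    show "adj (V i) * V j = 0" if "i < j" for i j
    proof -
      have "adj (snd (s j) i) * snd (s j) j = 0" using sn[of j] that by (simp add: St_def)
      then show ?thesis using sV[of i j] sV[of j j] that by simp
    qed
  qed
  then show False using nb by blast
qed

definition central_proj :: "'h op \<Rightarrow> bool" where
  "central_proj c \<longleftrightarrow> c \<in> A \<and> proj c \<and> (\<forall>x\<in>A. c * x = x * c)"

lemma matrix_units_props:
  assumes "matrix_units A n e V f" "1 \<le> n"
  shows "central_proj f" "f * e = e" "\<And>i. i < n \<Longrightarrow> f * V i = V i" "\<And>i. i < n \<Longrightarrow> norm (V i) \<le> 1"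
proof -
  note mu = assms
  have fV: "f * V i = V i" if "i < n" for i
    using ampl_V[OF mu that, of e] mu_e[OF mu] ampl_e[OF mu] mu_Ve[OF mu that] by simp
  then show "\<And>i. i < n \<Longrightarrow> f * V i = V i" .
  show "\<And>i. i < n \<Longrightarrow> norm (V i) \<le> 1" by (rule mu_norm[OF mu])
  have ff: "f * f = f" using ampl_mult[OF mu, of e e] mu_e[OF mu] ampl_e[OF mu] by simp
  have "adj f = f" using mu_sum[OF mu] by (simp add: adj_sum)
  then have pf: "proj f" using ff by (intro projI)
  have fA: "f \<in> A" using ampl_closed[OF mu, of e] mu_e[OF mu] ampl_e[OF mu] by simp
  show "central_proj f" using pf fA mu_central[OF mu] by (simp add: central_proj_def)
  have 0: "0 < n" using assms(2) by simp
  have "adj (V 0) * f = adj (V 0)" using fV[OF 0] pf by (metis adj_mult proj_adj)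
  moreover have "adj (V 0) * f = f * adj (V 0)" using mu_central[OF mu adj_closed[OF mu_V[OF mu 0]]] by simp
  ultimately show "f * e = e" using mu_orth[OF mu 0 0] by (metis mult.assoc)
qed


text \<open>Zorn's lemma gives a maximal orthogonal family of central summands under
  \<open>c\<close> with n by n matrix units. Direct sums of these units are matrix units for the sum
  \<open>z\<close> of the family, and a nonzero summand left under \<open>c - z\<close> would
  enlarge the family.\<close>

lemma maximal_type_I:
  assumes c: "central_proj c" and n: "1 \<le> n"
  shows "\<exists>z. central_proj z \<and> c * z = z \<and> (\<exists>e V. matrix_units A n e V z) \<and>
    (\<forall>e V f. matrix_units A n e V f \<longrightarrow> (c - z) * f = f \<longrightarrow> f = 0)"
proof -
  define \<F> where "\<F> = {f. c * f = f \<and> (\<exists>e V. matrix_units A n e V f)}"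
  define \<C> where "\<C> = {I. I \<subseteq> \<F> \<and> (\<forall>f\<in>I. \<forall>g\<in>I. f \<noteq> g \<longrightarrow> f * g = 0)}"
  have "\<exists>M\<in>\<C>. \<forall>X\<in>\<C>. M \<subseteq> X \<longrightarrow> X = M"
  proof (rule subset_Zorn')
    fix C assume C: "subset.chain \<C> C"
    have "f * g = 0" if fg: "f \<in> \<Union>C" "g \<in> \<Union>C" "f \<noteq> g" for f g
    proof -
      obtain I J where IJ: "I \<in> C" "J \<in> C" "f \<in> I" "g \<in> J" using fg by blast
      then have "I \<subseteq> J \<or> J \<subseteq> I" using C unfolding subset.chain_def by blast
      then obtain K where "K \<in> C" "f \<in> K" "g \<in> K" using IJ by blast
      then show ?thesis using C fg(3) unfolding subset.chain_def \<C>_def by blast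
    qed
    moreover have "\<Union>C \<subseteq> \<F>" using C unfolding subset.chain_def \<C>_def by blast
    ultimately show "\<Union>C \<in> \<C>" by (simp add: \<C>_def)
  qed
  then obtain M where M: "M \<in> \<C>" and max: "\<And>X. X \<in> \<C> \<Longrightarrow> M \<subseteq> X \<Longrightarrow> X = M" by blast
  have "\<forall>f\<in>M. \<exists>e V. matrix_units A n e V f" using M by (auto simp: \<C>_def \<F>_def)
  then obtain e V where mu: "\<And>f. f \<in> M \<Longrightarrow> matrix_units A n (e f) (V f) f" by metis
  have cf: "c * f = f" if "f \<in> M" for f using M that by (auto simp: \<C>_def \<F>_def)
  have cpf: "central_proj f" and fe: "f * e f = e f"
    and fV: "\<And>i. i < n \<Longrightarrow> f * V f i = V f i" and nV: "\<And>i. i < n \<Longrightarrow> norm (V f i) \<le> 1" if "f \<in> M" for f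
    using matrix_units_props[OF mu[OF that] n] by auto
  have fA: "f \<in> A" and pf: "proj f" and fc: "\<And>x. x \<in> A \<Longrightarrow> f * x = x * f" if "f \<in> M" for f
    using cpf[OF that] by (auto simp: central_proj_def)
  have eA: "e f \<in> A" and pe: "proj (e f)" if "f \<in> M" for f using mu_e[OF mu[OF that] n] by auto
  have VA: "V f i \<in> A" if "f \<in> M" "i < n" for f i by (rule mu_V[OF mu[OF that(1)] n that(2)])
  have Vf: "V f i * f = V f i" if "f \<in> M" "i < n" for f i using fc[OF that(1) VA[OF that]] fV[OF that] by simp
  have of: "orthogonal_family (\<lambda>f. f) M"
    using M pf by (auto simp: orthogonal_family_def \<C>_def)
  obtain z where z: "\<And>f. f \<in> M \<Longrightarrow> z * f = f" "\<And>f. f \<in> M \<Longrightarrow> f * z = f"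
    "\<And>B. (\<And>f. f \<in> M \<Longrightarrow> B * f = 0) \<Longrightarrow> B * z = 0" "\<And>R. (\<And>f. f \<in> M \<Longrightarrow> R * f = f * R) \<Longrightarrow> R * z = z * R"
    by (rule direct_sum[OF of, of "\<lambda>f. f" 1]) (use pf norm_proj_le in \<open>auto simp: under_def\<close>)
  have sum: "\<exists>S. S \<in> A \<and> (\<forall>f\<in>M. S * f = T f \<and> f * S = T f) \<and> S * z = S \<and> z * S = S"
    if T: "\<And>f. f \<in> M \<Longrightarrow> T f \<in> A" "\<And>f. f \<in> M \<Longrightarrow> f * T f = T f" "\<And>f. f \<in> M \<Longrightarrow> norm (T f) \<le> 1" for T
  proof -
    have T': "T f * f = T f" if "f \<in> M" for f using fc[OF that T(1)[OF that]] T(2)[OF that] by simp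
    have uT: "under (T f) f" if "f \<in> M" for f using T(2)[OF that] T'[OF that] by (simp add: under_def)
    obtain S where S: "\<And>f. f \<in> M \<Longrightarrow> S * f = T f" "\<And>f. f \<in> M \<Longrightarrow> f * S = T f"
      "\<And>B. (\<And>f. f \<in> M \<Longrightarrow> B * T f = 0) \<Longrightarrow> B * S = 0" "\<And>B. (\<And>f. f \<in> M \<Longrightarrow> f * B = 0) \<Longrightarrow> S * B = 0"
      "\<And>R. (\<And>f. f \<in> M \<Longrightarrow> R * T f = T f * R) \<Longrightarrow> R * S = S * R"
    proof (rule direct_sum[OF of uT T(3) zero_le_one], assumption, assumption, goal_cases)
      case (1 S)
      then show ?case by (intro that) blast+
    qed
    have "S \<in> A" by (rule bicommutant) (use S(5) T(1) in blast)
    moreover have "S * (1 - z) = 0" by (rule S(4)) (simp add: right_diff_distrib z(2))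
    moreover have "(1 - z) * S = 0"
    proof (rule S(3))
      fix f assume f: "f \<in> M"
      have "z * T f = z * f * T f" using T(2)[OF f] by (simp add: mult.assoc)
      then show "(1 - z) * T f = 0" using T(2)[OF f] z(1)[OF f] by (simp add: left_diff_distrib)
    qed
    ultimately show ?thesis using S(1,2)
      by (intro exI[of _ S]) (simp add: left_diff_distrib right_diff_distrib)
  qed
  obtain E where E: "E \<in> A" "\<And>f. f \<in> M \<Longrightarrow> E * f = e f" "\<And>f. f \<in> M \<Longrightarrow> f * E = e f" "E * z = E" "z * E = E"
    using sum[of e] eA fe norm_proj_le[OF pe] by blast
  define Q where "Q i S \<longleftrightarrow> S \<in> A \<and> (\<forall>f\<in>M. S * f = V f i \<and> f * S = V f i) \<and> S * z = S \<and> z * S = S" for i S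
  have "\<forall>i\<in>{..<n}. \<exists>S. Q i S"
    using sum[of "\<lambda>f. V f _"] VA fV nV unfolding Q_def by blast
  then obtain U where "\<forall>i\<in>{..<n}. Q i (U i)" by (rule bchoice[THEN exE])
  then have U: "\<And>i. i < n \<Longrightarrow> U i \<in> A" "\<And>i f. i < n \<Longrightarrow> f \<in> M \<Longrightarrow> U i * f = V f i"
    "\<And>i f. i < n \<Longrightarrow> f \<in> M \<Longrightarrow> f * U i = V f i" "\<And>i. i < n \<Longrightarrow> U i * z = U i" "\<And>i. i < n \<Longrightarrow> z * U i = U i"
    by (auto simp: Q_def)
  have zA: "z \<in> A" by (rule bicommutant) (use z(4) fA in blast)
  have zz: "z * z = z"
  proof -
    have "(1 - z) * z = 0" by (rule z(3)) (simp add: left_diff_distrib z(1))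
    then show ?thesis by (simp add: left_diff_distrib)
  qed
  \<comment> \<open>As \<open>z\<close> is the sum of the family, elements supported on
    \<open>z\<close> can be compared member by member.\<close>
  have eqI: "X = Y" if "\<And>f. f \<in> M \<Longrightarrow> X * f = Y * f" "X * z = X" "Y * z = Y" for X Y
  proof -
    have "(X - Y) * z = 0" by (rule z(3)) (simp add: left_diff_distrib that(1))
    then show ?thesis using that(2,3) by (simp add: left_diff_distrib)
  qed
  have zc: "z * x = x * z" if "x \<in> A" for x by (rule z(4)[symmetric], rule fc[OF _ that, symmetric])
  have az: "adj z = z"
  proof -
    have "(1 - adj z) * z = 0"
    proof (rule z(3))
      fix f assume f: "f \<in> M"
      have "adj z * f = f" using arg_cong[OF z(2)[OF f], of adj] pf[OF f] by simp
      then show "(1 - adj z) * f = 0" by (simp add: left_diff_distrib)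
    qed
    then have "z = adj z * z" by (simp add: left_diff_distrib)
    then show ?thesis by (metis adj_adj adj_mult)
  qed
  have pz: "proj z" using zz az by (rule projI)
  have adjz: "adj X * z = adj X" if "z * X = X" for X using arg_cong[OF that, of adj] az by simp
  have adjf: "adj (U i) * f = adj (V f i)" if "i < n" "f \<in> M" for i f
    using arg_cong[OF U(3)[OF that], of adj] pf[OF that(2)] by simp
  have pE: "proj E"
  proof (rule projI)
    show "E * E = E"
    proof (rule eqI)
      fix f assume f: "f \<in> M"
      show "E * E * f = E * f" by (metis E(2) f fe mult.assoc pe proj_idem)
    qed (simp_all add: mult.assoc E(4))
    show "adj E = E"
    proof (rule eqI)
      fix f assume f: "f \<in> M"
      show "adj E * f = E * f" using arg_cong[OF E(3)[OF f], of adj] pf[OF f] pe[OF f] E(2)[OF f] by simp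
    qed (simp_all add: adjz E)
  qed
  have abE: "S * T = T * S" if S: "S \<in> A" "under S E" and T: "T \<in> A" "under T E" for S T
  proof (rule eqI)
    have SE: "S * E = S" "E * S = S" "T * E = T" "E * T = T" using S T by (auto simp: under_def)
    show "S * T * z = S * T" "T * S * z = T * S" using SE E(4) by (metis mult.assoc)+
    fix f assume f: "f \<in> M"
    have u: "under (X * f) (e f)" if X: "X \<in> A" "X * E = X" "E * X = X" for X
    proof -
      have "e f * (X * f) = E * (f * X) * f" unfolding E(2)[OF f, symmetric] by (simp only: mult.assoc)
      also have "\<dots> = E * X * (f * f)" using fc[OF f X(1)] by (simp add: mult.assoc)
      finally have 1: "e f * (X * f) = X * f" using X(3) pf[OF f] by simp
      have "X * f * e f = X * E * f" using fe[OF f] E(2)[OF f] by (simp add: mult.assoc)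
      then show ?thesis using 1 X(2) by (simp add: under_def)
    qed
    have m: "X * f * (Y * f) = X * Y * f" if "Y \<in> A" for X Y
    proof -
      have "X * f * (Y * f) = X * (f * Y) * f" by (simp add: mult.assoc)
      also have "\<dots> = X * Y * (f * f)" using fc[OF f that] by (simp add: mult.assoc)
      finally show ?thesis using pf[OF f] by simp
    qed
    have "S * f * (T * f) = T * f * (S * f)"
      using mu_comm[OF mu[OF f] n, of "S * f" "T * f"] u[of S] u[of T] S(1) T(1) SE fA[OF f] by (simp add: closed)
    then show "S * T * f = T * S * f" by (simp add: m S(1) T(1))
  qed
  have "matrix_units A n E U z"
    unfolding matrix_units_def abelian_proj_def
  proof (intro conjI allI impI ballI)
    show "E \<in> A" "proj E" by (fact E(1), fact pE)
    show "S * T = T * S" if "S \<in> A" "T \<in> A" "under S E" "under T E" for S T using that by (intro abE)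
    show "U i \<in> A" if "i < n" for i using that by (rule U(1))
    show "z * x = x * z" if "x \<in> A" for x using that by (rule zc)
    fix i j assume ij: "i < n" "j < n"
    have *: "adj (U i) * U j * f = (if i = j then e f else 0)" if f: "f \<in> M" for f
    proof -
      have "adj (U i) * U j * f = adj (U i) * f * V f j"
        using U(2)[OF ij(2) f] fV[OF f ij(2)] by (simp add: mult.assoc)
      then show ?thesis using adjf[OF ij(1) f] mu_orth[OF mu[OF f] n ij] by simp
    qed
    show "adj (U i) * U j = (if i = j then E else 0)"
    proof (rule eqI)
      show "adj (U i) * U j * f = (if i = j then E else 0) * f" if "f \<in> M" for f using *[OF that] E(2)[OF that] by simp
    qed (use U(4)[OF ij(2)] E(4) in \<open>simp_all add: mult.assoc\<close>)
  next
    show "(\<Sum>i<n. U i * adj (U i)) = z"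
    proof (rule eqI)
      fix f assume f: "f \<in> M"
      have "(\<Sum>i<n. U i * adj (U i)) * f = (\<Sum>i<n. V f i * adj (V f i))"
        unfolding sum_distrib_right
      proof (rule sum.cong)
        fix i assume "i \<in> {..<n}"
        then have i: "i < n" by simp
        have "f * adj (V f i) = adj (V f i)" using Vf[OF f i] pf[OF f] by (metis adj_mult proj_adj)
        then have "U i * adj (U i) * f = U i * (f * adj (V f i))" using adjf[OF i f] by (simp add: mult.assoc)
        then show "U i * adj (U i) * f = V f i * adj (V f i)" using U(2)[OF i f] by (simp flip: mult.assoc)
      qed simp
      then show "(\<Sum>i<n. U i * adj (U i)) * f = z * f" using mu_sum[OF mu[OF f] n] z(1)[OF f] by simp
    next
      show "(\<Sum>i<n. U i * adj (U i)) * z = (\<Sum>i<n. U i * adj (U i))"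
        unfolding sum_distrib_right by (rule sum.cong) (use adjz U(5) in \<open>simp_all add: mult.assoc\<close>)
    qed (rule zz)
  qed
  moreover have "central_proj z" using zA pz zc by (simp add: central_proj_def)
  moreover have "c * z = z"
  proof -
    have "(1 - c) * z = 0" by (rule z(3)) (simp add: left_diff_distrib cf)
    then show ?thesis by (simp add: left_diff_distrib)
  qed
  moreover have "f = 0" if f: "matrix_units A n e V f" "(c - z) * f = f" for e V f
  proof -
    have cp: "central_proj f" by (rule matrix_units_props(1)[OF f(1) n])
    have "(c - z) * g = 0" if "g \<in> M" for g using cf[OF that] z(1)[OF that] by (simp add: left_diff_distrib)
    moreover have "f * (c - z) = f"
      using cp f(2) c zA by (metis central_proj_def closed_diff)
    ultimately have fg: "f * g = 0" if "g \<in> M" for g using that by (metis mult.assoc mult_zero_right)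
    then have gf: "g * f = 0" if "g \<in> M" for g
      using that cp fA by (metis central_proj_def)
    have "c * f = c * (c - z) * f" using f(2) by (simp add: mult.assoc)
    also have "c * (c - z) = c - z" using c \<open>c * z = z\<close> by (simp add: central_proj_def right_diff_distrib)
    finally have "c * f = f" using f(2) by simp
    then have "insert f M \<in> \<C>" using M f(1) fg gf by (auto simp: \<C>_def \<F>_def)
    then have "f \<in> M" using max by blast
    then have "f * f = 0" by (rule fg)
    then show ?thesis using cp by (simp add: central_proj_def)
  qed
  ultimately show ?thesis by blast
qed

end

section \<open>Characterisations\<close>

context vn_algebra
begin

text \<open>\<open>C k\<close> is what remains after maximal summands of sizes 1 to k are removed. A
  nonzero remainder contains an abelian projection, hence a central summand of some size, which by
  maximality exceeds k. If no remainder vanished, infinitely many sizes would occur, and those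
  summands would contain a block sequence.\<close>

lemma finite_type_I_decomposition:
  assumes nb: "\<nexists>W g. block_sequence A W g"
  shows "\<exists>m (Z :: nat \<Rightarrow> 'h op). (\<forall>k<m. central_proj (Z k) \<and> (\<exists>e V. matrix_units A (Suc k) e V (Z k))) \<and>
    (\<forall>i<m. \<forall>j<m. i \<noteq> j \<longrightarrow> Z i * Z j = 0) \<and> (\<Sum>k<m. Z k) = 1"
proof -
  define R where "R n c z \<longleftrightarrow> central_proj z \<and> c * z = z \<and> (\<exists>e V. matrix_units A (Suc n) e V z) \<and>
    (\<forall>e V f. matrix_units A (Suc n) e V f \<longrightarrow> (c - z) * f = f \<longrightarrow> f = 0)" for n c z
  define Z where "Z n c = (SOME z. R n c z)" for n c
  have Z: "R n c (Z n c)" if "central_proj c" for n c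
    unfolding Z_def by (rule someI_ex) (use maximal_type_I[OF that, of "Suc n"] in \<open>simp add: R_def\<close>)
  define C where "C = rec_nat 1 (\<lambda>k c. c - Z k c)"
  \<comment> \<open>Sizes start at 1, so \<open>z k\<close> has size \<open>Suc k\<close>; it may be
    zero.\<close>
  define z where "z k = Z k (C k)" for k
  have C0: "C 0 = 1" and CS: "C (Suc k) = C k - z k" for k by (simp_all add: C_def z_def)
  have cC: "central_proj (C k)" for k
  proof (induction k)
    case 0
    show ?case by (simp add: C0 central_proj_def closed)
  next
    case (Suc k)
    have r: "central_proj (z k)" "C k * z k = z k" using Z[OF Suc, of k] by (auto simp: R_def z_def)
    have "under (z k) (C k)" using r Suc proj_under_iff unfolding central_proj_def by blast
    then have "proj (C k - z k)" using r Suc proj_diff unfolding central_proj_def by blast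
    moreover have "C k - z k \<in> A" using r Suc closed_diff unfolding central_proj_def by blast
    moreover have "(C k - z k) * x = x * (C k - z k)" if "x \<in> A" for x
      using r(1) Suc that unfolding central_proj_def by (simp add: left_diff_distrib right_diff_distrib)
    ultimately show ?case by (simp add: CS central_proj_def)
  qed
  have zR: "central_proj (z k)" "C k * z k = z k" "\<exists>e V. matrix_units A (Suc k) e V (z k)"
    "\<And>e V f. matrix_units A (Suc k) e V f \<Longrightarrow> C (Suc k) * f = f \<Longrightarrow> f = 0" for k
    using Z[OF cC, of k k] by (auto simp: R_def z_def[symmetric] CS)
  have Cp: "C k \<in> A" "C k * C k = C k" and Cc: "\<And>x. x \<in> A \<Longrightarrow> C k * x = x * C k" for k
    using cC[of k] by (auto simp: central_proj_def)
  have zp: "z k \<in> A" "z k * z k = z k" "adj (z k) = z k" for k using zR(1)[of k] by (auto simp: central_proj_def)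
  have zC: "z k * C k = z k" for k using zR(2)[of k] Cc[OF zp(1)] by simp
  have mono: "C i * C j = C j" if "i \<le> j" for i j
    using that
  proof (induction j rule: dec_induct)
    case base
    show ?case by (rule Cp)
  next
    case (step j)
    have "C j * C (Suc j) = C (Suc j)" by (simp add: CS right_diff_distrib Cp zR(2))
    then show ?case using step by (metis mult.assoc)
  qed
  have orth1: "z i * z j = 0" if "i < j" for i j
  proof -
    have "z i * C (Suc i) = 0" by (simp add: CS right_diff_distrib zC zp)
    moreover have "C (Suc i) * z j = z j" using mono[of "Suc i" j] zR(2)[of j] that by (metis Suc_leI mult.assoc)
    ultimately show ?thesis by (metis mult.assoc mult_zero_left)
  qed
  have orth: "z i * z j = 0" if "i \<noteq> j" for i j
  proof (cases "i < j")
    case False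
    then have "z j * z i = 0" using that orth1 by simp
    then show ?thesis using zR(1)[of i] zp(1)[of j] by (simp add: central_proj_def)
  qed (rule orth1)
  have sumz: "(\<Sum>j<k. z j) = 1 - C k" for k by (induction k) (simp_all add: C0 CS)
  show ?thesis
  proof (cases "\<exists>m. C m = 0")
    case True
    then obtain m where "C m = 0" by blast
    then have "(\<Sum>j<m. z j) = 1" using sumz by simp
    then show ?thesis using zR(1,3) orth by (intro exI[of _ m] exI[of _ z]) blast
  next
    case False
    have "\<exists>j\<ge>n. z j \<noteq> 0" for n
    proof -
      obtain e where e: "abelian_proj A e" "e \<noteq> 0" "C n * e = e"
        using abelian_subprojection[OF nb, of "C n"] cC[of n] False by (auto simp: central_proj_def)
      obtain m d V f where m: "1 \<le> m" "d \<noteq> 0" "e * d = d" "matrix_units A m d V f"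
        using matrix_units_sub[OF nb e(1,2)] by blast
      obtain j where j: "m = Suc j" using m(1) by (cases m) auto
      have f0: "f \<noteq> 0" using matrix_units_props(2)[OF m(4,1)] m(2) by auto
      have Cd: "C n * d = d" using e(3) m(3) by (metis mult.assoc)
      have CV: "C n * V i = V i" if i: "i < m" for i
      proof -
        have "C n * V i = C n * V i * d" using mu_Ve[OF m(4,1) i] by (simp add: mult.assoc)
        also have "\<dots> = V i * (C n * d)" using Cc[OF mu_V[OF m(4,1) i]] by (simp add: mult.assoc)
        finally show ?thesis using mu_Ve[OF m(4,1) i] Cd by simp
      qed
      have Cf: "C n * f = f" unfolding mu_sum[OF m(4,1)] sum_distrib_left
        by (rule sum.cong) (simp_all add: CV flip: mult.assoc)
      have jn: "\<not> Suc j \<le> n"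
      proof
        assume "Suc j \<le> n"
        then have "C (Suc j) * f = f" using mono[of "Suc j" n] Cf by (metis mult.assoc)
        then show False using zR(4) m(4) f0 j by blast
      qed
      show ?thesis
      proof (rule ccontr)
        assume "\<not> ?thesis"
        then have z0: "z i = 0" if "n \<le> i" for i using that by blast
        \<comment> \<open>Without later nonzero summands the remainder stays \<open>C n\<close> even
          after size \<open>Suc j\<close> has been removed, but it still contains \<open>f\<close>
          of that size.\<close>
        have Ceq: "C i = C n" if "n \<le> i" for i
          using that by (induction i rule: dec_induct) (simp_all add: CS z0)
        have "C (Suc j) * f = f" using Ceq[of "Suc j"] Cf jn by simp
        then show False using zR(4) m(4) f0 j by blast
      qed
    qed
    then have inf: "infinite {j. z j \<noteq> 0}" unfolding infinite_nat_iff_unbounded_le by blast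
    \<comment> \<open>The increasing enumeration satisfies k \<le> r k, so the summand chosen for
      block k has at least the k + 1 partial isometries required.\<close>
    define r where "r = enumerate {j. z j \<noteq> 0}"
    have r: "z (r k) \<noteq> 0" "k \<le> r k" for k
      using enumerate_in_set[OF inf, of k] le_enumerate[OF inf, of k] by (auto simp: r_def)
    have rinj: "r k \<noteq> r l" if "k \<noteq> l" for k l
      using enumerate_mono[OF _ inf, of k l] enumerate_mono[OF _ inf, of l k] that unfolding r_def
      by (metis less_irrefl linorder_neqE_nat)
    obtain e V where mu: "\<And>k. matrix_units A (Suc k) (e k) (V k) (z k)" using zR(3) by metis
    have n1: "1 \<le> Suc k" for k by simp
    have "block_sequence A (\<lambda>k. V (r k)) (\<lambda>k. e (r k))"
      unfolding block_sequence_def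
    proof (intro conjI allI impI)
      fix k
      show "proj (e (r k))" by (rule mu_e(2)[OF mu n1])
      show "e (r k) \<noteq> 0"
      proof
        assume "e (r k) = 0"
        then have "V (r k) i = 0" if "i < Suc (r k)" for i using mu_Ve[OF mu n1 that] by simp
        then have "z (r k) = 0" unfolding mu_sum[OF mu[of "r k"] n1] by (intro sum.neutral) simp
        then show False using r(1) by blast
      qed
    next
      fix k i :: nat assume i: "i \<le> k"
      then have i': "i < Suc (r k)" using r(2)[of k] by simp
      show "V (r k) i \<in> A" by (rule mu_V[OF mu n1 i'])
      fix j assume "j \<le> k"
      then have "j < Suc (r k)" using r(2)[of k] by simp
      then show "adj (V (r k) i) * V (r k) j = (if i = j then e (r k) else 0)" by (rule mu_orth[OF mu n1 i'])
    next
      fix k l i j :: nat assume kl: "k \<noteq> l" "i \<le> k" "j \<le> l"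
      have i: "i < Suc (r k)" and j: "j < Suc (r l)" using kl r(2)[of k] r(2)[of l] by simp_all
      have "z (r k) * V (r k) i = V (r k) i" by (rule matrix_units_props(3)[OF mu n1 i])
      then have 1: "adj (V (r k) i) * z (r k) = adj (V (r k) i)" using zp(3) by (metis adj_mult)
      have 2: "z (r l) * V (r l) j = V (r l) j" by (rule matrix_units_props(3)[OF mu n1 j])
      have "adj (V (r k) i) * V (r l) j = adj (V (r k) i) * (z (r k) * z (r l)) * V (r l) j"
        using 1 2 by (metis mult.assoc)
      then show "adj (V (r k) i) * V (r l) j = 0" using orth[OF rinj[OF kl(1)]] by simp
    qed
    then show ?thesis using nb by blast
  qed
qed

lemma strongly_clean_iff_type_I:
  "(\<forall>X\<in>A. strongly_clean_at A 1 X) \<longleftrightarrow>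
     (\<exists>m (Z :: nat \<Rightarrow> 'h op) (n :: nat \<Rightarrow> nat). (\<forall>k<m. central_proj (Z k) \<and> 1 \<le> n k \<and> (\<exists>e V. matrix_units A (n k) e V (Z k))) \<and>
       (\<forall>i<m. \<forall>j<m. i \<noteq> j \<longrightarrow> Z i * Z j = 0) \<and> (\<Sum>k<m. Z k) = 1)" (is "?L \<longleftrightarrow> ?R")
proof
  assume ?L
  then have "\<nexists>W g. block_sequence A W g" using block_sequence_not_strongly_clean by blast
  then obtain m :: nat and Z where "\<forall>k<m. central_proj (Z k) \<and> (\<exists>e V. matrix_units A (Suc k) e V (Z k))"
    "\<forall>i<m. \<forall>j<m. i \<noteq> j \<longrightarrow> Z i * Z j = 0" "(\<Sum>k<m. Z k) = 1"
    using finite_type_I_decomposition by blast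
  then show ?R by (intro exI[of _ m] exI[of _ Z] exI[of _ Suc]) auto
next
  assume ?R
  then obtain m :: nat and Z n where Z': "\<forall>k<m. central_proj (Z k) \<and> 1 \<le> n k \<and> (\<exists>e V. matrix_units A (n k) e V (Z k))"
    and orth': "\<forall>i<m. \<forall>j<m. i \<noteq> j \<longrightarrow> Z i * Z j = 0" and sum: "(\<Sum>k<m. Z k) = 1" by blast
  have Z: "central_proj (Z k) \<and> 1 \<le> n k \<and> (\<exists>e V. matrix_units A (n k) e V (Z k))" if "k < m" for k
    using Z' that by blast
  have orth: "Z i * Z j = 0" if "i < m" "j < m" "i \<noteq> j" for i j using orth' that by blast
  show ?L
  proof
    fix X assume X: "X \<in> A"
    have "strongly_clean_at A (\<Sum>k<l. Z k) X" if "l \<le> m" for l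
      using that
    proof (induction l)
      case 0
      then show ?case by (simp add: strongly_clean_at_0)
    next
      case (Suc l)
      have 1: "(\<Sum>k<l. Z k) * x = x * (\<Sum>k<l. Z k)" if "x \<in> A" for x
        unfolding sum_distrib_left sum_distrib_right
        by (rule sum.cong) (use Z Suc(2) that in \<open>auto simp: central_proj_def\<close>)
      have 2: "Z l * x = x * Z l" if "x \<in> A" for x using Z[of l] Suc(2) that by (auto simp: central_proj_def)
      have 3: "(\<Sum>k<l. Z k) * Z l = 0" unfolding sum_distrib_right
        by (rule sum.neutral) (use orth Suc(2) in auto)
      have 4: "Z l * (\<Sum>k<l. Z k) = 0" unfolding sum_distrib_left
        by (rule sum.neutral) (use orth Suc(2) in auto)
      have "strongly_clean_at A (Z l) X" using Z[of l] Suc(2) strongly_clean_at_type_I X by auto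
      then have "strongly_clean_at A ((\<Sum>k<l. Z k) + Z l) X"
        using Suc by (intro strongly_clean_at_add 1 2 3 4) simp_all
      then show ?case by simp
    qed
    then show "strongly_clean_at A 1 X" using sum by fastforce
  qed
qed

section \<open>Strong *-cleanness and commutativity\<close>

definition star_clean :: "'h op \<Rightarrow> bool" where
  "star_clean X \<longleftrightarrow> (\<exists>U\<in>A. \<exists>V\<in>A. \<exists>P\<in>A. U * V = 1 \<and> V * U = 1 \<and> proj P \<and> X = U + P \<and> U * P = P * U)"

text \<open>For commuting idempotents R and P the cube of R - P is R - P. If this difference is
  invertible, its square is 1, which forces R P = 0 and R + P = 1. So an idempotent that is *-clean
  is the complement of a projection.\<close>

lemma star_clean_iff_abelian:
  "(\<forall>X\<in>A. star_clean X) \<longleftrightarrow> (\<forall>S\<in>A. \<forall>T\<in>A. S * T = T * S)"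
proof
  assume sc: "\<forall>X\<in>A. star_clean X"
  have idem: "adj R = R" if R: "R \<in> A" "R * R = R" for R
  proof -
    obtain U V P where U: "U * V = 1" "V * U = 1" "proj P" "R = U + P" "U * P = P * U"
      using sc R(1) unfolding star_clean_def by blast
    have PP: "P * P = P" "adj P = P" using U(3) by auto
    have RP: "R * P = P * R" using U(5) by (simp add: U(4) distrib_left distrib_right)
    have UR: "U = R - P" using U(4) by simp
    have "U * U = R + P - 2 *\<^sub>R (R * P)"
      using R(2) PP RP by (simp add: UR left_diff_distrib right_diff_distrib scaleR_2)
    moreover have RRP: "R * (R * P) = R * P" using R(2) by (simp flip: mult.assoc)
    moreover have "P * (R * P) = R * P" using RP PP by (metis mult.assoc)
    ultimately have "U * (U * U) = U"
      using R(2) PP RP by (simp add: UR left_diff_distrib right_diff_distrib distrib_left scaleR_2)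
    then have "V * (U * (U * U)) * V = V * U * V" by simp
    then have UU: "U * U = 1" using U(1,2) by (metis mult.assoc mult.left_neutral mult.right_neutral)
    have "R * P = R * P * (U * U)" by (simp add: UU)
    also have "\<dots> = 0"
    proof -
      have "R * P * U = R * (P * R) - R * (P * P)" by (simp add: UR right_diff_distrib mult.assoc)
      also have "\<dots> = 0" by (simp add: RP[symmetric] RRP PP)
      finally show ?thesis by (metis mult.assoc mult_zero_left)
    qed
    finally have "R + P = 1" using UU \<open>U * U = R + P - 2 *\<^sub>R (R * P)\<close> by simp
    then have "R = 1 - P" by (simp add: eq_diff_eq)
    then show ?thesis using PP by simp
  qed
  have "abelian_proj A 1"
  proof (rule abelian_projI)
    fix p x assume p: "p \<in> A" "proj p" and x: "x \<in> A"
    define y where "y = p * x * (1 - p)"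
    have py: "p * y = y" using p(2) by (simp add: y_def proj_idem_left mult.assoc)
    have yp: "y * p = 0" using p(2) by (simp add: y_def mult.assoc left_diff_distrib)
    have yy: "y * y = 0" using py yp by (metis mult.assoc mult_zero_left)
    have "(p + y) * (p + y) = p + y" using p(2) py yp yy by (simp add: distrib_left distrib_right)
    moreover have "p + y \<in> A" using p x by (simp add: y_def closed)
    ultimately have "adj (p + y) = p + y" using idem by blast
    then have ay: "adj y = y" using p(2) by simp
    have "y * p = y" using arg_cong[OF py, of adj] ay p(2) by simp
    then show "p * x * (1 - p) = 0" using yp by (simp add: y_def)
  qed (simp_all add: closed)
  then show "\<forall>S\<in>A. \<forall>T\<in>A. S * T = T * S" by (simp add: abelian_proj_def under_def)
next
  assume ab: "\<forall>S\<in>A. \<forall>T\<in>A. S * T = T * S"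
  \<comment> \<open>A commutative algebra consists of 1 by 1 matrices over itself, so the type I
    result already gives strong cleanness.\<close>
  have "matrix_units A 1 1 (\<lambda>_. 1) 1"
    using ab by (simp add: matrix_units_def abelian_proj_def closed)
  then have sc: "strongly_clean_at A 1 X" if "X \<in> A" for X using strongly_clean_at_type_I that by blast
  show "\<forall>X\<in>A. star_clean X"
  proof
    fix X assume "X \<in> A"
    then obtain P U V where P: "P \<in> A" "U \<in> A" "V \<in> A" "P * P = P" "U * V = 1" "V * U = 1" "X = U + P" "U * P = P * U"
      using sc unfolding strongly_clean_at_def by fastforce
    define Y where "Y = adj P * (1 - P)"
    have "adj P * P = P * adj P" using ab P(1) adj_closed by blast
    then have "adj Y * Y = (1 - adj P) * adj P * (P * (1 - P))" by (simp add: Y_def) (metis mult.assoc)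
    also have "P * (1 - P) = 0" by (simp add: right_diff_distrib P(4))
    finally have "Y = 0" using adj_mult_self_eq_0[of Y] by simp
    then have "adj P = adj P * P" by (simp add: Y_def right_diff_distrib)
    then have "adj P = P" by (metis adj_adj adj_mult)
    then have "proj P" using P(4) by (intro projI)
    then show "star_clean X" unfolding star_clean_def using P by blast
  qed
qed

end

section \<open>Transfer to operators given as functions\<close>

lemma ap_inject: "ap S = ap T \<longleftrightarrow> S = T"
  by (metis op_eqI)

lemma ap_comp: "ap S \<circ> ap T = ap (S * T)"
  by (rule ext) simp

lemma ap_plus: "(\<lambda>x. ap S x + ap T x) = ap (S + T)"
  by (rule ext) simp

lemma ap_id: "id = ap 1" and ap_zero: "(\<lambda>x. 0) = ap 0"
  by (rule ext, simp)+

lemma ap_sum_fun: "(\<lambda>x. \<Sum>i\<in>I. ap (f i) x) = ap (\<Sum>i\<in>I. f i)"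
  by (rule ext) (simp add: ap_sum)

lemma bounded_op_ap: "bounded_op (ap T)"
  unfolding bounded_op_def using norm_ap[of T] by (auto simp: ap_cscale)

lemma bounded_op_obtain:
  assumes "bounded_op f"
  obtains T where "f = ap T"
proof -
  have f: "\<And>x y. f (x + y) = f x + f y" "\<And>c x. f (cscale c x) = cscale c (f x)"
    using assms by (auto simp: bounded_op_def)
  obtain K where K: "\<And>x. norm (f x) \<le> K * norm x" using assms by (auto simp: bounded_op_def)
  have sc: "f (r *\<^sub>R x) = r *\<^sub>R f x" for r x by (simp add: f(2) flip: cscale_of_real)
  obtain T where "ap T = f" by (rule op_exists[OF f(1) sc f(2) K])
  then show ?thesis using that by blast
qed

text \<open>\<open>rip\<close> sees only real parts; the imaginary part of the inner product is
  recovered by using the real identity at \<open>icscale x\<close> as well.\<close>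

lemma is_adjoint_ap: "is_adjoint (ap T) (ap S) \<longleftrightarrow> S = adj T"
proof
  assume "is_adjoint (ap T) (ap S)"
  then have "rip (ap T x) y = rip x (ap S y)" for x y by (simp add: is_adjoint_def rip_def)
  then show "S = adj T" by (rule adj_eqI[symmetric])
next
  assume "S = adj T"
  moreover have "cinner (ap T x) y = cinner x (ap (adj T) y)" for x y
    using rip_ap[of T x y] rip_ap[of T "icscale x" y] by (simp add: cinner_eq_rip)
  ultimately show "is_adjoint (ap T) (ap S)" by (simp add: is_adjoint_def)
qed

lemma projection_ap: "projection (ap P) \<longleftrightarrow> proj P"
  unfolding projection_def proj_def ap_comp ap_inject is_adjoint_ap by metis

lemma von_neumann_algebra_ap:
  assumes "von_neumann_algebra A"
  obtains B where "A = ap ` B" "vn_algebra B"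
proof -
  have bd: "bounded_op T" if "T \<in> A" for T using assms that by (simp add: von_neumann_algebra_def)
  define B where "B = {T. ap T \<in> A}"
  have AB: "A = ap ` B"
  proof
    show "A \<subseteq> ap ` B"
    proof
      fix f assume "f \<in> A"
      then show "f \<in> ap ` B" using bounded_op_obtain[OF bd[of f]] by (auto simp: B_def)
    qed
  qed (auto simp: B_def)
  have "vn_algebra B"
  proof
    fix T assume "T \<in> B"
    then obtain f where f: "f \<in> A" "is_adjoint (ap T) f"
      using assms by (auto simp: B_def von_neumann_algebra_def)
    obtain S where "f = ap S" using bounded_op_obtain[OF bd[OF f(1)]] by blast
    then show "adj T \<in> B" using f by (simp add: is_adjoint_ap B_def)
  next
    fix X assume X: "\<And>S. (\<And>T. T \<in> B \<Longrightarrow> S * T = T * S) \<Longrightarrow> S * X = X * S"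
    have "ap X \<circ> f = f \<circ> ap X" if f: "f \<in> commutant A" for f
    proof -
      obtain S where S: "f = ap S" using f bounded_op_obtain unfolding commutant_def by blast
      have "S * T = T * S" if "T \<in> B" for T
        using f that by (auto simp: commutant_def S B_def ap_comp ap_inject)
      then have "S * X = X * S" by (rule X)
      then show ?thesis by (simp add: S ap_comp)
    qed
    then have "ap X \<in> commutant (commutant A)" by (simp add: commutant_def bounded_op_ap)
    then show "X \<in> B" using assms by (simp add: von_neumann_algebra_def B_def)
  qed
  then show ?thesis using that AB by blast
qed

lemma strongly_clean_ap:
  "strongly_clean (ap ` B) \<longleftrightarrow> (\<forall>X\<in>B. strongly_clean_at B 1 X)"
proof -
  have "(\<exists>U P. invertible_in (ap ` B) U \<and> P \<in> ap ` B \<and> P \<circ> P = P \<and> ap X = (\<lambda>x. U x + P x) \<and> U \<circ> P = P \<circ> U)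
      \<longleftrightarrow> strongly_clean_at B 1 X" for X
    unfolding invertible_in_def strongly_clean_at_def
    by (auto simp: ap_comp ap_plus ap_id ap_inject)
  then show ?thesis by (simp add: strongly_clean_def)
qed

lemma strongly_star_clean_ap:
  assumes "vn_algebra B"
  shows "strongly_star_clean (ap ` B) \<longleftrightarrow> (\<forall>X\<in>B. vn_algebra.star_clean B X)"
proof -
  have "(\<exists>U P. invertible_in (ap ` B) U \<and> P \<in> ap ` B \<and> projection P \<and> ap X = (\<lambda>x. U x + P x) \<and> U \<circ> P = P \<circ> U)
      \<longleftrightarrow> vn_algebra.star_clean B X" for X
    unfolding invertible_in_def vn_algebra.star_clean_def[OF assms]
    by (auto simp: ap_comp ap_plus ap_id ap_inject projection_ap)
  then show ?thesis by (simp add: strongly_star_clean_def)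
qed

lemma central_projection_ap:
  assumes "vn_algebra B"
  shows "central_projection (ap ` B) f \<longleftrightarrow> (\<exists>P. f = ap P \<and> vn_algebra.central_proj B P)"
  unfolding central_projection_def vn_algebra.central_proj_def[OF assms]
  by (auto simp: projection_ap ap_comp ap_inject)

lemma corner_ap: "corner (ap P) (ap ` B) = ap ` ((*) P ` B)"
  by (auto simp: corner_def ap_comp image_image)

lemma mvn_equiv_ap:
  "mvn_equiv (ap ` C) (ap E) (ap F) \<longleftrightarrow> (\<exists>V\<in>C. adj V \<in> C \<and> adj V * V = E \<and> V * adj V = F)"
  unfolding mvn_equiv_def by (auto simp: is_adjoint_ap ap_comp ap_inject)

lemma abelian_projection_ap:
  "abelian_projection (ap ` C) (ap E) \<longleftrightarrow> E \<in> C \<and> proj E \<and>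
    (\<forall>S\<in>C. \<forall>T\<in>C. (E * S * E) * (E * T * E) = (E * T * E) * (E * S * E))"
  unfolding abelian_projection_def by (auto simp: projection_ap ap_comp ap_inject)

text \<open>Given equivalent abelian projections, the partial isometries from \<open>E 0\<close> to
  the \<open>E i\<close> form the first column of a system of matrix units. Conversely the range
  projections of the \<open>V i\<close> are abelian and equivalent through
  \<open>V j * adj (V i)\<close>.\<close>

lemma type_I_n_ap:
  assumes B: "vn_algebra B" and P: "vn_algebra.central_proj B P"
  shows "type_I_n (corner (ap P) (ap ` B)) (ap P) n \<longleftrightarrow> 1 \<le> n \<and> (\<exists>e V. matrix_units B n e V P)"
proof -
  interpret vn_algebra B by fact
  have PA: "P \<in> B" and pP: "proj P" and Pc: "\<And>x. x \<in> B \<Longrightarrow> P * x = x * P"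
    using P by (auto simp: central_proj_def)
  have cornerI: "x \<in> (*) P ` B" if "x \<in> B" "P * x = x" for x using that by (metis imageI)
  have cornerD: "x \<in> B" "P * x = x" if "x \<in> (*) P ` B" for x
    using that PA pP by (auto simp: closed proj_idem_left)
  show ?thesis
  proof
    assume "type_I_n (corner (ap P) (ap ` B)) (ap P) n"
    then have tI: "1 \<le> n \<and> (\<exists>F. (\<forall>i<n. abelian_projection (ap ` (*) P ` B) (F i)) \<and>
        (\<forall>i<n. \<forall>j<n. i \<noteq> j \<longrightarrow> F i \<circ> F j = (\<lambda>x. 0)) \<and>
        (\<forall>i<n. \<forall>j<n. mvn_equiv (ap ` (*) P ` B) (F i) (F j)) \<and> (\<lambda>x. \<Sum>i<n. F i x) = ap P)"
      unfolding type_I_n_def corner_ap .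
    then have n: "1 \<le> n" by (rule conjunct1)
    obtain F where F': "(\<forall>i<n. abelian_projection (ap ` (*) P ` B) (F i)) \<and>
        (\<forall>i<n. \<forall>j<n. i \<noteq> j \<longrightarrow> F i \<circ> F j = (\<lambda>x. 0)) \<and>
        (\<forall>i<n. \<forall>j<n. mvn_equiv (ap ` (*) P ` B) (F i) (F j)) \<and> (\<lambda>x. \<Sum>i<n. F i x) = ap P"
      using tI[THEN conjunct2] by (rule exE)
    have F: "abelian_projection (ap ` (*) P ` B) (F i)" "i \<noteq> j \<Longrightarrow> F i \<circ> F j = (\<lambda>x. 0)"
      "mvn_equiv (ap ` (*) P ` B) (F i) (F j)" if "i < n" "j < n" for i j
      using F' that by simp_all
    have F4: "(\<lambda>x. \<Sum>i<n. F i x) = ap P" using F' by simp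
    have "\<forall>i\<in>{..<n}. \<exists>E. F i = ap E" 
    proof
      fix i assume "i \<in> {..<n}"
      then show "\<exists>E. F i = ap E" using F(1)[of i i] unfolding abelian_projection_def by blast
    qed
    then obtain E where FE: "\<And>i. i < n \<Longrightarrow> F i = ap (E i)" by (metis lessThan_iff)
    have E: "E i \<in> (*) P ` B" "proj (E i)"
      "\<And>S T. S \<in> (*) P ` B \<Longrightarrow> T \<in> (*) P ` B \<Longrightarrow> (E i * S * E i) * (E i * T * E i) = (E i * T * E i) * (E i * S * E i)"
      if "i < n" for i
      using F(1)[OF that that] unfolding FE[OF that] abelian_projection_ap by blast+
    have EE: "E i * E j = 0" if "i < n" "j < n" "i \<noteq> j" for i j
      using F(2)[OF that] by (simp add: FE that ap_comp ap_zero ap_inject)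
    have 0: "0 < n" using n by simp
    have "\<forall>i\<in>{..<n}. \<exists>V. V \<in> (*) P ` B \<and> adj V * V = E 0 \<and> V * adj V = E i"
    proof
      fix i assume "i \<in> {..<n}"
      then have i: "i < n" by simp
      show "\<exists>V. V \<in> (*) P ` B \<and> adj V * V = E 0 \<and> V * adj V = E i"
        using F(3)[OF 0 i] unfolding FE[OF 0] FE[OF i] mvn_equiv_ap by blast
    qed
    then obtain V where "\<forall>i\<in>{..<n}. V i \<in> (*) P ` B \<and> adj (V i) * V i = E 0 \<and> V i * adj (V i) = E i"
      by (rule bchoice[THEN exE])
    then have V: "V i \<in> (*) P ` B" "adj (V i) * V i = E 0" "V i * adj (V i) = E i" if "i < n" for i
      using that by auto
    have "matrix_units B n (E 0) V P"
      unfolding matrix_units_def abelian_proj_def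
    proof (intro conjI allI impI ballI)
      show "E 0 \<in> B" "proj (E 0)" by (fact cornerD(1)[OF E(1)[OF 0]], fact E(2)[OF 0])
      show "S * T = T * S" if S: "S \<in> B" "under S (E 0)" and T: "T \<in> B" "under T (E 0)" for S T
      proof -
        have PS: "P * S = S" "P * T = T" using cornerD(2)[OF E(1)[OF 0]] S(2) T(2) unfolding under_def by (metis mult.assoc)+
        have "S \<in> (*) P ` B" "T \<in> (*) P ` B" by (fact cornerI[OF S(1) PS(1)], fact cornerI[OF T(1) PS(2)])
        from E(3)[OF 0 this] show ?thesis using S(2) T(2) by (simp add: under_def)
      qed
      show "V i \<in> B" if "i < n" for i by (rule cornerD(1)[OF V(1)[OF that]])
      show "P * x = x * P" if "x \<in> B" for x by (rule Pc[OF that])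
      show "(\<Sum>i<n. V i * adj (V i)) = P"
      proof -
        have "(\<lambda>x. \<Sum>i<n. F i x) = (\<lambda>x. \<Sum>i<n. ap (E i) x)" by (rule ext, rule sum.cong) (simp_all add: FE)
        then have "(\<Sum>i<n. E i) = P" using F4 by (simp add: ap_sum_fun ap_inject)
        then show ?thesis using V(3) by simp
      qed
      fix i j assume ij: "i < n" "j < n"
      show "adj (V i) * V j = (if i = j then E 0 else 0)"
      proof (cases "i = j")
        case True
        then show ?thesis using V(2) ij by simp
      next
        case False
        have EV: "E k * V k = V k" if "k < n" for k
          using partial_isometry_eq(1)[OF V(2)[OF that] E(2)[OF 0]] V(2,3)[OF that] by (metis mult.assoc)
        have "adj (V i) = adj (V i) * E i" using EV[OF ij(1)] E(2)[OF ij(1)] by (metis adj_mult proj_adj)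
        then have "adj (V i) * V j = adj (V i) * (E i * E j) * V j" using EV[OF ij(2)] by (metis mult.assoc)
        then show ?thesis using EE ij False by simp
      qed
    qed
    then show "1 \<le> n \<and> (\<exists>e V. matrix_units B n e V P)" using n by blast
  next
    assume "1 \<le> n \<and> (\<exists>e V. matrix_units B n e V P)"
    then obtain e V where n: "1 \<le> n" and mu: "matrix_units B n e V P" by blast
    note e = mu_e[OF mu n] and VB = mu_V[OF mu n] and orth = mu_orth[OF mu n] and Ve = mu_Ve[OF mu n]
      and eV = mu_eV[OF mu n] and PV = matrix_units_props(3)[OF mu n]
    define E where "E i = V i * adj (V i)" for i
    have EB: "E i \<in> B" "P * E i = E i" if "i < n" for i
      using VB[OF that] PV[OF that] by (auto simp: E_def closed simp flip: mult.assoc)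
    have pE: "proj (E i)" if "i < n" for i
      unfolding E_def using partial_isometry_eq(2)[of "V i" e] orth[OF that that] e by simp
    have ab: "(E i * S * E i) * (E i * T * E i) = (E i * T * E i) * (E i * S * E i)"
      if i: "i < n" and S: "S \<in> B" and T: "T \<in> B" for i S T
    proof -
      define s t where "s = adj (V i) * S * V i" and "t = adj (V i) * T * V i"
      have u: "under s e" "under t e" unfolding s_def t_def by (rule under_compress; simp add: Ve i e)+
      have st: "s * t = t * s"
        by (rule mu_comm[OF mu n _ _ u]) (use S T VB[OF i] in \<open>simp_all add: s_def t_def closed\<close>)
      have red: "(E i * S' * E i) * (E i * T' * E i) = V i * ((adj (V i) * S' * V i) * (adj (V i) * T' * V i)) * adj (V i)" for S' T'
      proof -
        have "(E i * S' * E i) * (E i * T' * E i) = V i * (adj (V i) * S' * V i) * ((adj (V i) * V i) * (adj (V i)) * T' * V i) * adj (V i)"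
          using pE[OF i] by (simp add: proj_idem_left E_def mult.assoc)
        also have "(adj (V i) * V i) * adj (V i) = adj (V i)" using orth[OF i i] eV[OF i] by simp
        finally show ?thesis by (simp only: mult.assoc)
      qed
      show ?thesis unfolding red using st by (simp add: s_def t_def)
    qed
    show "type_I_n (corner (ap P) (ap ` B)) (ap P) n"
      unfolding type_I_n_def corner_ap
    proof (intro conjI n exI[of _ "\<lambda>i. ap (E i)"] allI impI)
      fix i assume i: "i < n"
      show "abelian_projection (ap ` (*) P ` B) (ap (E i))"
        unfolding abelian_projection_ap using cornerI EB[OF i] pE[OF i] ab[OF i] cornerD by blast
      fix j assume j: "j < n"
      show "ap (E i) \<circ> ap (E j) = (\<lambda>x. 0)" if "i \<noteq> j"
      proof -
        have "E i * E j = V i * (adj (V i) * V j) * adj (V j)" by (simp add: E_def mult.assoc)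
        then show ?thesis using orth[OF i j] that by (simp add: ap_comp ap_zero)
      qed
      show "mvn_equiv (ap ` (*) P ` B) (ap (E i)) (ap (E j))"
        unfolding mvn_equiv_ap
      proof (intro bexI[of _ "V j * adj (V i)"] conjI)
        show "V j * adj (V i) \<in> (*) P ` B" "adj (V j * adj (V i)) \<in> (*) P ` B"
          using VB i j PV by (auto intro!: cornerI simp: closed simp flip: mult.assoc)
        have *: "adj (V l * adj (V k)) * (V l * adj (V k)) = E k" if "k < n" "l < n" for k l
        proof -
          have "adj (V l * adj (V k)) * (V l * adj (V k)) = V k * (adj (V l) * V l) * adj (V k)" by (simp add: mult.assoc)
          then show ?thesis using orth[OF that(2) that(2)] Ve[OF that(1)] by (simp add: E_def)
        qed
        show "adj (V j * adj (V i)) * (V j * adj (V i)) = E i" by (rule *[OF i j])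
        show "V j * adj (V i) * adj (V j * adj (V i)) = E j" using *[OF j i] by simp
      qed
    next
      show "(\<lambda>x. \<Sum>i<n. ap (E i) x) = ap P" unfolding ap_sum_fun by (simp add: E_def mu_sum[OF mu n])
    qed
  qed
qed

theorem theorem1p1:
  fixes A :: "('h::chilbert_space \<Rightarrow> 'h) set"
  assumes "von_neumann_algebra A"
  shows "(strongly_clean A \<longleftrightarrow>
            (\<exists>k (P :: nat \<Rightarrow> ('h \<Rightarrow> 'h)) (n :: nat \<Rightarrow> nat).
               (\<forall>i<k. central_projection A (P i)) \<and>
               (\<forall>i<k. \<forall>j<k. i \<noteq> j \<longrightarrow> P i \<circ> P j = (\<lambda>x. 0)) \<and>
               (\<lambda>x. \<Sum>i<k. P i x) = id \<and>
               (\<forall>i<k. type_I_n (corner (P i) A) (P i) (n i))))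
       \<and> (strongly_star_clean A \<longleftrightarrow> abelian_algebra A)"
proof -
  obtain B where A: "A = ap ` B" and B: "vn_algebra B" using von_neumann_algebra_ap[OF assms] by blast
  interpret vn_algebra B by fact
  let ?R = "\<exists>k (P :: nat \<Rightarrow> ('h \<Rightarrow> 'h)) (n :: nat \<Rightarrow> nat).
               (\<forall>i<k. central_projection A (P i)) \<and>
               (\<forall>i<k. \<forall>j<k. i \<noteq> j \<longrightarrow> P i \<circ> P j = (\<lambda>x. 0)) \<and>
               (\<lambda>x. \<Sum>i<k. P i x) = id \<and>
               (\<forall>i<k. type_I_n (corner (P i) A) (P i) (n i))"
  let ?S = "\<exists>m (Z :: nat \<Rightarrow> 'h op) (n :: nat \<Rightarrow> nat). (\<forall>k<m. central_proj (Z k) \<and> 1 \<le> n k \<and> (\<exists>e V. matrix_units B (n k) e V (Z k))) \<and>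
       (\<forall>i<m. \<forall>j<m. i \<noteq> j \<longrightarrow> Z i * Z j = 0) \<and> (\<Sum>k<m. Z k) = 1"
  have "?R \<longleftrightarrow> ?S"
  proof
    assume ?R
    then obtain k :: nat and P n where P': "\<forall>i<k. central_projection A (P i)"
      "\<forall>i<k. \<forall>j<k. i \<noteq> j \<longrightarrow> P i \<circ> P j = (\<lambda>x. 0)" "(\<lambda>x. \<Sum>i<k. P i x) = id"
      "\<forall>i<k. type_I_n (corner (P i) A) (P i) (n i)" by blast
    then have P: "\<And>i. i < k \<Longrightarrow> central_projection A (P i)"
      "\<And>i j. i < k \<Longrightarrow> j < k \<Longrightarrow> i \<noteq> j \<Longrightarrow> P i \<circ> P j = (\<lambda>x. 0)" "(\<lambda>x. \<Sum>i<k. P i x) = id"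
      "\<And>i. i < k \<Longrightarrow> type_I_n (corner (P i) A) (P i) (n i)" by blast+
    have "\<forall>i\<in>{..<k}. \<exists>Q. P i = ap Q \<and> central_proj Q"
      using P(1) unfolding A central_projection_ap[OF B] by blast
    then obtain Z where "\<forall>i\<in>{..<k}. P i = ap (Z i) \<and> central_proj (Z i)" by (rule bchoice[THEN exE])
    then have Z: "P i = ap (Z i)" "central_proj (Z i)" if "i < k" for i using that by auto
    have "1 \<le> n i \<and> (\<exists>e V. matrix_units B (n i) e V (Z i))" if "i < k" for i
      using P(4)[OF that] type_I_n_ap[OF B Z(2)[OF that]] by (simp add: Z(1)[OF that] A)
    moreover have "Z i * Z j = 0" if "i < k" "j < k" "i \<noteq> j" for i j
      using P(2)[OF that] by (simp add: Z(1) that ap_comp ap_zero ap_inject)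
    moreover have "(\<Sum>i<k. Z i) = 1"
    proof -
      have "(\<lambda>x. \<Sum>i<k. P i x) = (\<lambda>x. \<Sum>i<k. ap (Z i) x)" by (rule ext, rule sum.cong) (simp_all add: Z(1))
      then show ?thesis using P(3) by (simp add: ap_sum_fun ap_id ap_inject)
    qed
    ultimately show ?S using Z(2) by blast
  next
    assume ?S
    then obtain m :: nat and Z n where Z': "\<forall>k<m. central_proj (Z k) \<and> 1 \<le> n k \<and> (\<exists>e V. matrix_units B (n k) e V (Z k))"
      "\<forall>i<m. \<forall>j<m. i \<noteq> j \<longrightarrow> Z i * Z j = 0" "(\<Sum>k<m. Z k) = 1" by blast
    then have Z: "\<And>k. k < m \<Longrightarrow> central_proj (Z k) \<and> 1 \<le> n k \<and> (\<exists>e V. matrix_units B (n k) e V (Z k))"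
      "\<And>i j. i < m \<Longrightarrow> j < m \<Longrightarrow> i \<noteq> j \<Longrightarrow> Z i * Z j = 0" "(\<Sum>k<m. Z k) = 1" by blast+
    show ?R
    proof (intro exI conjI allI impI)
      show "central_projection A (ap (Z i))" if "i < m" for i
        unfolding A central_projection_ap[OF B] using Z(1)[OF that] by blast
      show "ap (Z i) \<circ> ap (Z j) = (\<lambda>x. 0)" if "i < m" "j < m" "i \<noteq> j" for i j
        using Z(2)[OF that] by (simp add: ap_comp ap_zero)
      show "(\<lambda>x. \<Sum>i<m. ap (Z i) x) = id" using Z(3) by (simp add: ap_sum_fun ap_id)
      show "type_I_n (corner (ap (Z i)) A) (ap (Z i)) (n i)" if "i < m" for i
        unfolding A using type_I_n_ap[OF B, of "Z i" "n i"] Z(1)[OF that] by blast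
    qed
  qed
  then have "strongly_clean A \<longleftrightarrow> ?R"
    unfolding A strongly_clean_ap strongly_clean_iff_type_I by (rule sym)
  moreover have "abelian_algebra A \<longleftrightarrow> (\<forall>S\<in>B. \<forall>T\<in>B. S * T = T * S)"
    by (simp add: A abelian_algebra_def ap_comp ap_inject)
  then have "strongly_star_clean A \<longleftrightarrow> abelian_algebra A"
    using star_clean_iff_abelian strongly_star_clean_ap[OF B] by (simp add: A)
  ultimately show ?thesis by blast
qed

end
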